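(* Let $\Omega\subseteq\mathbb{R}^N$ be a bounded open set with Lipschitz boundary, let $A$ be a bounded (measurable) vector field, with values in $\mathbb{R}^N$, on the convex hull of $\Omega$, and let $s\in(0,1)$. Assume $1\le q\le\infty$ and $1\le r<p<\infty$ are such that one of the following conditions holds: (a) $r=1$ and $q<\frac{N}{N-s}$; (b) $sr>N$ and $q=\infty$; (c) $q<\frac{Nr}{N-sr}$, $sr<N$ and $\frac{N}{N-s}\le q<\infty$; and that one of the following conditions holds: (i) $sp<N$ and $q<\frac{Np}{N-sp}$; (ii) $sp=N$ and $q<\infty$; (iii) $sp>N$ and $q\le\infty$. Fix $\delta\in(0,1]$. Then for any $\varepsilon>0$ there is a constant $C>0$, depending only on $\Omega,A,s,p,q,r,\delta,\varepsilon$, such that for every measurable $\Lambda\subseteq\Omega$ and all $f\in W^{s,p}(\Omega,\mathbb{C})$ with $d^q_{s,A}(f)\ge\delta\|f\|_{L^q(\Omega,\mathbb{C})}$, $$\left(\iint_{\Lambda\times\Lambda}\frac{\left|f(x)-e^{i(x-y)\cdot A\left(\frac{x+y}{2}\right)}f(y)\right|^p}{|x-y|^{N+sp}}\,dx\,dy\right)^{1/p}+C\left(\iint_{(\Omega\times\Omega)\setminus(\Lambda\times\Lambda)}\frac{\left|f(x)-e^{i(x-y)\cdot A\left(\frac{x+y}{2}\right)}f(y)\right|^r}{|x-y|^{N+sr}}\,dx\,dy\right)^{1/r}$$ $$\ge\left(\frac{1}{S+\varepsilon}+E^{p,q}_{s,A}\right)\|f\|_{L^q(\Omega,\mathbb{C})},$$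 where $S$ is the best constant defined in the context.
   Context: For $s\in(0,1)$, $p\in[1,\infty)$, an open set $\Omega\subseteq\mathbb{R}^N$ and a vector field $A$ on the convex hull of $\Omega$, the magnetic fractional seminorm is $$[f]_{W^{s,p}_A(\Omega,\mathbb{C})}:=\left(\iint_{\Omega\times\Omega}\frac{\left|f(x)-e^{i(x-y)\cdot A\left(\frac{x+y}{2}\right)}f(y)\right|^p}{|x-y|^{N+sp}}\,dx\,dy\right)^{1/p}.$$ When $A\equiv0$ it is denoted $[f]_{W^{s,p}(\Omega,\mathbb{C})}$, and $W^{s,p}(\Omega,\mathbb{C})$ is the space of $f\in L^p(\Omega,\mathbb{C})$ with $[f]_{W^{s,p}(\Omega,\mathbb{C})}<\infty$. The energy is $$E^{p,q}_{s,A}:=\inf\left\{\frac{[f]_{W^{s,p}_A(\Omega,\mathbb{C})}}{\|f\|_{L^q(\Omega,\mathbb{C})}}\ :\ f\in W^{s,p}(\Omega,\mathbb{C}),\ f\ne0\right\},$$ the ground state manifold is $$M^{p,q}_{s,A}:=\left\{f\in W^{s,p}(\Omega,\mathbb{C}),\ f\neq 0\ :\ \frac{[f]_{W^{s,p}_A(\Omega,\mathbb{C})}}{\|f\|_{L^q(\Omega,\mathbb{C})}}=E^{p,q}_{s,A}\right\},$$ and the distance from it is $$d^q_{s,A}(f):=\inf_{\phi\in M^{p,q}_{s,A}}\|f-\phi\|_{L^q(\Omega,\mathbb{C})},$$ with the convention that the infimum over the empty set is $+\infty$. The best constant $S$ (for the given $\Omega,A,s,p,q,\delta$) is the smallest constant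 such that $$\|f\|_{L^q(\Omega,\mathbb{C})}\le S\left([f]_{W^{s,p}_A(\Omega,\mathbb{C})}-E^{p,q}_{s,A}\|f\|_{L^q(\Omega,\mathbb{C})}\right)$$ for all $f\in W^{s,p}(\Omega,\mathbb{C})$ with $d^q_{s,A}(f)\ge\delta\|f\|_{L^q(\Omega,\mathbb{C})}$. The double integrals in the claim may take the value $+\infty$. *)

theory Defs
  imports "HOL-Analysis.Analysis" "HOL-Probability.Essential_Supremum"
begin

(* Near every boundary point the set is the region above the graph of a Lipschitz function, in
   suitably rotated coordinates. The rotation is encoded by its last coordinate direction v; the
   graph function lives on the hyperplane orthogonal to v, which replaces R^(N-1), and
   x - (x \<bullet> v) *\<^sub>R v is the orthogonal projection of x to that hyperplane. *)
definition lipschitz_boundary :: "(real^'n) set \<Rightarrow> bool" where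
  "lipschitz_boundary \<Omega> \<longleftrightarrow>
     (\<forall>x0 \<in> frontier \<Omega>. \<exists>v \<rho> L (g :: real^'n \<Rightarrow> real).
        norm v = 1 \<and> \<rho> > 0 \<and> L-lipschitz_on {y. y \<bullet> v = 0} g \<and>
        \<Omega> \<inter> ball x0 \<rho> = {x \<in> ball x0 \<rho>. x \<bullet> v > g (x - (x \<bullet> v) *\<^sub>R v)})"

(* Real powers of [0,\<infinity>]-valued quantities, only used for a > 0. *)
definition ennpow :: "ennreal \<Rightarrow> real \<Rightarrow> ennreal" where
  "ennpow x a = (if x = \<infinity> then \<infinity> else ennreal (enn2real x powr a))"

definition Lnorm :: "(real^'n) set \<Rightarrow> ennreal \<Rightarrow> (real^'n \<Rightarrow> complex) \<Rightarrow> ennreal" where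
  "Lnorm \<Omega> q f =
     (if q = \<infinity> then esssup (lebesgue_on \<Omega>) (\<lambda>x. ennreal (norm (f x)))
      else ennpow (\<integral>\<^sup>+x. ennreal (norm (f x) powr enn2real q) \<partial>lebesgue_on \<Omega>) (1 / enn2real q))"

(* The p-th root of the magnetic double integral over a set D of pairs (x, y). The measure is
   Lebesgue measure on R^N x R^N rather than the product of two completed measures, because
   (x, y) \<mapsto> A ((x + y)/2) need not be measurable for the latter when A is only Lebesgue measurable.
   On the null set x = y the integrand is 0 by the convention 0 / 0 = 0. *)
definition mag_double ::
    "((real^'n) \<times> (real^'n)) set \<Rightarrow> (real^'n \<Rightarrow> real^'n) \<Rightarrow> real \<Rightarrow> real \<Rightarrow> (real^'n \<Rightarrow> complex) \<Rightarrow> ennreal" where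
  "mag_double D A s p f =
     ennpow (\<integral>\<^sup>+(x, y).
        ennreal (norm (f x - exp (\<i> * complex_of_real ((x - y) \<bullet> A (midpoint x y))) * f y) powr p
                 / norm (x - y) powr (real CARD('n) + s * p)) \<partial>lebesgue_on D) (1 / p)"

definition mag_seminorm ::
    "(real^'n) set \<Rightarrow> (real^'n \<Rightarrow> real^'n) \<Rightarrow> real \<Rightarrow> real \<Rightarrow> (real^'n \<Rightarrow> complex) \<Rightarrow> ennreal" where
  "mag_seminorm \<Omega> A s p f = mag_double (\<Omega> \<times> \<Omega>) A s p f"

(* Elements are represented by functions on the whole space of which only the restriction to
   \<Omega>, up to null sets, matters. *)
definition frac_sobolev :: "(real^'n) set \<Rightarrow> real \<Rightarrow> real \<Rightarrow> (real^'n \<Rightarrow> complex) set" where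
  "frac_sobolev \<Omega> s p =
     {f. f \<in> borel_measurable (lebesgue_on \<Omega>) \<and> Lnorm \<Omega> (ennreal p) f < \<infinity> \<and>
         mag_seminorm \<Omega> (\<lambda>_. 0) s p f < \<infinity>}"

definition frac_sobolev_nz :: "(real^'n) set \<Rightarrow> real \<Rightarrow> real \<Rightarrow> (real^'n \<Rightarrow> complex) set" where
  "frac_sobolev_nz \<Omega> s p = {f \<in> frac_sobolev \<Omega> s p. \<not> (AE x in lebesgue_on \<Omega>. f x = 0)}"

definition mag_energy ::
    "(real^'n) set \<Rightarrow> (real^'n \<Rightarrow> real^'n) \<Rightarrow> real \<Rightarrow> real \<Rightarrow> ennreal \<Rightarrow> ennreal" where
  "mag_energy \<Omega> A s p q = (INF f \<in> frac_sobolev_nz \<Omega> s p. mag_seminorm \<Omega> A s p f / Lnorm \<Omega> q f)"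

definition ground_states ::
    "(real^'n) set \<Rightarrow> (real^'n \<Rightarrow> real^'n) \<Rightarrow> real \<Rightarrow> real \<Rightarrow> ennreal \<Rightarrow> (real^'n \<Rightarrow> complex) set" where
  "ground_states \<Omega> A s p q =
     {f \<in> frac_sobolev_nz \<Omega> s p. mag_seminorm \<Omega> A s p f / Lnorm \<Omega> q f = mag_energy \<Omega> A s p q}"

definition ground_dist ::
    "(real^'n) set \<Rightarrow> (real^'n \<Rightarrow> real^'n) \<Rightarrow> real \<Rightarrow> real \<Rightarrow> ennreal \<Rightarrow> (real^'n \<Rightarrow> complex) \<Rightarrow> ennreal" where
  "ground_dist \<Omega> A s p q f = (INF \<phi> \<in> ground_states \<Omega> A s p q. Lnorm \<Omega> q (\<lambda>x. f x - \<phi> x))"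

definition away_from_ground ::
    "(real^'n) set \<Rightarrow> (real^'n \<Rightarrow> real^'n) \<Rightarrow> real \<Rightarrow> real \<Rightarrow> ennreal \<Rightarrow> real \<Rightarrow> (real^'n \<Rightarrow> complex) set" where
  "away_from_ground \<Omega> A s p q \<delta> =
     {f \<in> frac_sobolev \<Omega> s p. ground_dist \<Omega> A s p q f \<ge> ennreal \<delta> * Lnorm \<Omega> q f}"

(* The smallest admissible K in [0,\<infinity>]. The truncated subtraction of ennreal is harmless here since
   mag_energy * Lnorm never exceeds the seminorm, by definition of mag_energy, when Lnorm is finite. *)
definition best_const ::
    "(real^'n) set \<Rightarrow> (real^'n \<Rightarrow> real^'n) \<Rightarrow> real \<Rightarrow> real \<Rightarrow> ennreal \<Rightarrow> real \<Rightarrow> ennreal" where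
  "best_const \<Omega> A s p q \<delta> =
     Inf {K. \<forall>f \<in> away_from_ground \<Omega> A s p q \<delta>.
            Lnorm \<Omega> q f \<le> K * (mag_seminorm \<Omega> A s p f - mag_energy \<Omega> A s p q * Lnorm \<Omega> q f)}"

end

theory Submission
  imports Defs "HOL-Probability.Probability_Measure" "HOL-Probability.Characteristic_Functions"
    "HOL-Complex_Analysis.Great_Picard"
begin

text \<open>
  The theorem follows by contradiction and compactness. If it fails, take counterexamples \<open>f\<^sub>n\<close>,
  \<open>\<Lambda>\<^sub>n\<close> for the constants \<open>C = 2\<^sup>n\<close>, with \<open>\<parallel>f\<^sub>n\<parallel>\<^sub>q = 1\<close>. On \<open>\<Lambda>\<^sub>n \<times> \<Lambda>\<^sub>n\<close> the \<open>W\<^sup>s\<^sup>,\<^sup>p\<close> energy is bounded, and on the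
  complement the \<open>W\<^sup>s\<^sup>,\<^sup>r\<close> energy tends to \<open>0\<close>. Since \<open>r < p\<close> and \<open>\<Omega>\<close> is bounded, \<open>f\<^sub>n\<close> is bounded in
  \<open>W\<^sup>t\<^sup>,\<^sup>r\<close> for every \<open>t < s\<close>, and for \<open>t\<close> close to \<open>s\<close> this space embeds compactly into \<open>L\<^sup>q\<close>. Let \<open>f\<close> be a
  limit. At almost every pair where the magnetic difference of \<open>f\<close> does not vanish, the pair
  eventually lies in \<open>\<Lambda>\<^sub>n \<times> \<Lambda>\<^sub>n\<close>, so Fatou's lemma bounds the full energy of \<open>f\<close> by
  \<open>1/(S + \<epsilon>) + E\<close>. As \<open>f\<close> has norm \<open>1\<close> and stays away from the ground states, this contradicts the
  choice of \<open>S\<close>.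

  The compact embedding uses of the Lipschitz boundary only that every ball centred in \<open>\<Omega>\<close> contains
  a comparable ball inside \<open>\<Omega>\<close>. Averages over such balls at dyadic scales converge to the function
  at a geometric rate in \<open>L\<^sup>q\<close>: the difference of two consecutive averages is controlled pointwise and
  in \<open>L\<^sup>r\<close> by the local fractional energy.
\<close>

section \<open>Powers of extended nonnegative reals and Lebesgue norms\<close>

text \<open>The energy bound on \<open>\<Lambda> n \<times> \<Lambda> n\<close> has exponent p, the
  one on the complement has exponent r. At the same order s, Hoelder's inequality would leave the
  factor |x - y|^(-N), which is not integrable. Lowering the order to some s' < s turns it into |x -
  y|^(k - N) with k > 0; subcriticality is an open condition, so it survives at a suitable s'. A
  second obstacle is the field. Compactness is proved for the energy with A = 0, and removing A
  costs the L^r norm of the function, while the normalisation in L^q directly gives only L^1. A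
  Poincare type inequality, valid with the magnetic phase because the phase has modulus 1, supplies
  the L^r bound. The constants 2^n make the complementary energies summable, so that their
  integrands tend to 0 almost everywhere. If S is infinite, the limit would attain E and be a ground
  state at distance 0 from itself. As A, f and \<Lambda> are only Lebesgue measurable, all integrals
  are moved to Borel representatives before Tonelli's theorem is applied to pairs.\<close>

lemma ennpow_ennreal: "0 \<le> x \<Longrightarrow> ennpow (ennreal x) a = ennreal (x powr a)"
  by (simp add: ennpow_def)

lemma ennpow_top [simp]: "ennpow \<infinity> a = \<infinity>" "ennpow top a = top"
  by (simp_all add: ennpow_def)

lemma ennpow_0 [simp]: "ennpow 0 a = 0"
  by (simp add: ennpow_def)

lemma ennpow_eq_top_iff [simp]: "ennpow x a = top \<longleftrightarrow> x = top"
  by (simp add: ennpow_def)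

lemma ennpow_less_top_iff [simp]: "ennpow x a < top \<longleftrightarrow> x < top"
  by (metis ennpow_eq_top_iff less_top)

text \<open>Holds for every a because \<open>0 powr a = 0\<close> in HOL, also for a = 0.\<close>

lemma ennpow_eq_0_iff [simp]: "ennpow x a = 0 \<longleftrightarrow> x = 0"
  by (cases x) (auto simp: ennpow_ennreal)

lemma ennpow_mono: "0 \<le> a \<Longrightarrow> x \<le> y \<Longrightarrow> ennpow x a \<le> ennpow y a"
  by (cases x; cases y) (auto simp: ennpow_ennreal top_unique intro!: ennreal_leI powr_mono2)

lemma ennpow_mult: "ennpow (x * y) a = ennpow x a * ennpow y a"
proof (cases x; cases y)
  fix u v assume "x = ennreal u" "0 \<le> u" "y = ennreal v" "0 \<le> v"
  then show ?thesis
    by (simp add: ennpow_ennreal ennreal_mult[symmetric] powr_mult)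
qed (auto simp: ennreal_mult_top ennreal_top_mult ennpow_ennreal)

lemma ennpow_ennpow: "ennpow (ennpow x a) b = ennpow x (a * b)"
  by (cases x) (auto simp: ennpow_ennreal powr_powr)

lemma ennpow_one [simp]: "ennpow x 1 = x"
  by (cases x) (auto simp: ennpow_ennreal)

lemma ennpow_root: "a \<noteq> 0 \<Longrightarrow> ennpow (ennpow x a) (1 / a) = x" "a \<noteq> 0 \<Longrightarrow> ennpow (ennpow x (1 / a)) a = x"
  by (simp_all add: ennpow_ennpow)

lemma ennpow_root_le_iff: "0 < a \<Longrightarrow> ennpow x (1 / a) \<le> y \<longleftrightarrow> x \<le> ennpow y a"
  by (metis ennpow_mono ennpow_root less_eq_real_def less_irrefl zero_less_divide_1_iff)

section \<open>The norm of L^q with values in [0, \<infinity>], for all q \<ge> 1 at once\<close>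

lemma Lnorm_top: "Lnorm \<Omega> \<infinity> f = esssup (lebesgue_on \<Omega>) (\<lambda>x. ennreal (norm (f x)))"
  by (simp add: Lnorm_def)

lemma Lnorm_real:
  "0 \<le> Q \<Longrightarrow> Lnorm \<Omega> (ennreal Q) f = ennpow (\<integral>\<^sup>+x. ennreal (norm (f x) powr Q) \<partial>lebesgue_on \<Omega>) (1 / Q)"
  by (simp add: Lnorm_def)

lemma ge1_ennreal_cases [consumes 1, case_names top real]:
  assumes "1 \<le> (q::ennreal)"
  obtains "q = \<infinity>" | Q where "q = ennreal Q" "1 \<le> Q"
  using assms by (cases q) (auto simp: ennreal_ge_1)

lemma Lnorm_mono_AE:
  assumes "1 \<le> q" and [measurable]: "f \<in> borel_measurable (lebesgue_on \<Omega>)"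
    and "AE x in lebesgue_on \<Omega>. norm (f x) \<le> norm (g x)"
  shows "Lnorm \<Omega> q f \<le> Lnorm \<Omega> q g"
  using assms(1)
proof (cases q rule: ge1_ennreal_cases)
  case top
  show ?thesis unfolding top Lnorm_top
    by (rule esssup_AE_mono) (use assms(3) in auto)
next
  case (real Q)
  show ?thesis unfolding real(1) using real(2) assms(3)
    by (auto simp: Lnorm_real intro!: ennpow_mono nn_integral_mono_AE ennreal_leI powr_mono2 elim!: eventually_mono)
qed

lemma Lnorm_cong_AE:
  assumes "1 \<le> q" "f \<in> borel_measurable (lebesgue_on \<Omega>)" "g \<in> borel_measurable (lebesgue_on \<Omega>)"
    and "AE x in lebesgue_on \<Omega>. f x = g x"
  shows "Lnorm \<Omega> q f = Lnorm \<Omega> q g"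
  by (rule antisym; rule Lnorm_mono_AE) (use assms in auto)

lemma esssup_ennreal_le_iff:
  fixes g :: "'a \<Rightarrow> ennreal"
  assumes "g \<in> borel_measurable M"
  shows "esssup M g \<le> c \<longleftrightarrow> (AE x in M. g x \<le> c)"
  using esssup_AE[of g M] esssup_I[OF assms, of c] by (auto elim!: eventually_mono)

lemma Lnorm_top_le_iff:
  "f \<in> borel_measurable (lebesgue_on \<Omega>) \<Longrightarrow>
    Lnorm \<Omega> \<infinity> f \<le> c \<longleftrightarrow> (AE x in lebesgue_on \<Omega>. ennreal (norm (f x)) \<le> c)"
  unfolding Lnorm_top by (rule esssup_ennreal_le_iff) auto

lemma Lnorm_real_le_iff:
  "0 < Q \<Longrightarrow> Lnorm \<Omega> (ennreal Q) f \<le> c \<longleftrightarrow>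
    (\<integral>\<^sup>+x. ennreal (norm (f x) powr Q) \<partial>lebesgue_on \<Omega>) \<le> ennpow c Q"
  by (simp add: Lnorm_real ennpow_root_le_iff)

text \<open>Lower semicontinuity under almost everywhere convergence: Fatou's lemma when q is
  finite, and a countable union of exceptional null sets when q = \<infinity>. It carries norm
  bounds for averages and subsequences to their limits.\<close>

lemma Lnorm_Fatou:
  assumes "1 \<le> q" and [measurable]: "\<And>n. f n \<in> borel_measurable (lebesgue_on \<Omega>)" "g \<in> borel_measurable (lebesgue_on \<Omega>)"
    and lim: "AE x in lebesgue_on \<Omega>. (\<lambda>n. f n x) \<longlonglongrightarrow> g x"
    and le: "\<forall>\<^sub>F n in sequentially. Lnorm \<Omega> q (f n) \<le> c"
  shows "Lnorm \<Omega> q g \<le> c"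
proof -
  obtain n0 where n0: "\<And>n. n \<ge> n0 \<Longrightarrow> Lnorm \<Omega> q (f n) \<le> c"
    using le unfolding eventually_sequentially by auto
  show ?thesis using assms(1)
  proof (cases q rule: ge1_ennreal_cases)
    case top
    have "AE x in lebesgue_on \<Omega>. \<forall>n. n \<ge> n0 \<longrightarrow> ennreal (norm (f n x)) \<le> c"
      using n0 by (auto simp: AE_all_countable top Lnorm_top_le_iff[symmetric])
    with lim show ?thesis unfolding top Lnorm_top_le_iff[OF assms(3)]
    proof eventually_elim
      case (elim x)
      then have "(\<lambda>n. ennreal (norm (f n x))) \<longlonglongrightarrow> ennreal (norm (g x))"
        by (intro tendsto_ennrealI tendsto_norm) auto
      then show ?case
        by (rule LIMSEQ_le_const2) (use elim in auto)
    qed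
  next
    case (real Q)
    let ?I = "\<lambda>h. \<integral>\<^sup>+x. ennreal (norm (h x) powr Q) \<partial>lebesgue_on \<Omega>"
    have "?I g \<le> (\<integral>\<^sup>+x. liminf (\<lambda>n. ennreal (norm (f n x) powr Q)) \<partial>lebesgue_on \<Omega>)"
      using lim
    proof (intro nn_integral_mono_AE, eventually_elim)
      case (elim x)
      then have "(\<lambda>n. ennreal (norm (f n x) powr Q)) \<longlonglongrightarrow> ennreal (norm (g x) powr Q)"
        using real(2) by (intro tendsto_ennrealI tendsto_powr' tendsto_norm tendsto_const) auto
      then have "liminf (\<lambda>n. ennreal (norm (f n x) powr Q)) = ennreal (norm (g x) powr Q)"
        by (rule lim_imp_Liminf[OF sequentially_bot])
      then show ?case by simp
    qed
    also have "\<dots> \<le> liminf (\<lambda>n. ?I (f n))"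
      by (rule nn_integral_liminf) auto
    also have "\<dots> \<le> ennpow c Q"
    proof -
      have "\<forall>\<^sub>F n in sequentially. ?I (f n) \<le> ennpow c Q"
        unfolding eventually_sequentially using n0 real by (auto simp: Lnorm_real_le_iff[symmetric])
      then have "limsup (\<lambda>n. ?I (f n)) \<le> ennpow c Q"
        by (rule Limsup_bounded)
      then show ?thesis
        using Liminf_le_Limsup[of sequentially "\<lambda>n. ?I (f n)"] by (auto intro: order.trans)
    qed
    finally show ?thesis using real by (simp add: Lnorm_real_le_iff)
  qed
qed

lemma nn_integral_norm_powr_cmult:
  fixes f :: "'a \<Rightarrow> complex"
  assumes "f \<in> borel_measurable M"
  shows "(\<integral>\<^sup>+x. ennreal (norm (c * f x) powr Q) \<partial>M)
     = ennreal (norm c powr Q) * (\<integral>\<^sup>+x. ennreal (norm (f x) powr Q) \<partial>M)"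
  using assms by (subst nn_integral_cmult[symmetric]) (auto simp: norm_mult powr_mult ennreal_mult)

text \<open>One inequality suffices: for c \<noteq> 0 the reverse one is the same inequality for the
  function c f and the factor 1 / c.\<close>

lemma Lnorm_cmult:
  assumes "1 \<le> q" and [measurable]: "f \<in> borel_measurable (lebesgue_on \<Omega>)"
  shows "Lnorm \<Omega> q (\<lambda>x. c * f x) = ennreal (norm c) * Lnorm \<Omega> q f"
proof -
  have le: "Lnorm \<Omega> q (\<lambda>x. c * f x) \<le> ennreal (norm c) * Lnorm \<Omega> q f"
    if "f \<in> borel_measurable (lebesgue_on \<Omega>)" for c f
    using assms(1)
  proof (cases q rule: ge1_ennreal_cases)
    case top
    have "AE x in lebesgue_on \<Omega>. ennreal (norm (f x)) \<le> Lnorm \<Omega> \<infinity> f"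
      using Lnorm_top_le_iff[OF that, of "Lnorm \<Omega> \<infinity> f"] by simp
    then show ?thesis using that unfolding top
      by (subst Lnorm_top_le_iff)
        (auto simp: norm_mult ennreal_mult intro!: mult_left_mono elim!: eventually_mono)
  next
    case (real Q)
    then show ?thesis
      using nn_integral_norm_powr_cmult[OF that, of c Q]
      by (simp add: Lnorm_real ennpow_mult ennpow_ennreal powr_powr)
  qed
  show ?thesis
  proof (cases "c = 0")
    case True
    with le[of f 0] show ?thesis by simp
  next
    case False
    have "ennreal (norm c) * Lnorm \<Omega> q f = ennreal (norm c) * Lnorm \<Omega> q (\<lambda>x. inverse c * (c * f x))"
      using False by (simp add: mult.assoc[symmetric])
    also have "\<dots> \<le> ennreal (norm c) * (ennreal (norm (inverse c)) * Lnorm \<Omega> q (\<lambda>x. c * f x))"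
      by (intro mult_left_mono le) auto
    also have "\<dots> = Lnorm \<Omega> q (\<lambda>x. c * f x)"
      using False by (simp add: mult.assoc[symmetric] ennreal_mult[symmetric] norm_inverse)
    finally show ?thesis using le[of f c] by (intro antisym) auto
  qed
qed

lemma Lnorm_eq_0_iff:
  assumes "1 \<le> q" and [measurable]: "f \<in> borel_measurable (lebesgue_on \<Omega>)"
  shows "Lnorm \<Omega> q f = 0 \<longleftrightarrow> (AE x in lebesgue_on \<Omega>. f x = 0)"
  using assms(1)
proof (cases q rule: ge1_ennreal_cases)
  case top
  have "Lnorm \<Omega> \<infinity> f = 0 \<longleftrightarrow> Lnorm \<Omega> \<infinity> f \<le> 0" by simp
  also have "\<dots> \<longleftrightarrow> (AE x in lebesgue_on \<Omega>. f x = 0)"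
    by (subst Lnorm_top_le_iff) auto
  finally show ?thesis by (simp add: top)
next
  case (real Q)
  then show ?thesis
    by (auto simp: Lnorm_real nn_integral_0_iff_AE)
qed

text \<open>A zero argument is treated separately; the claim then reduces to
  \<open>u powr Q \<le> u\<close> for 0 < u < 1.\<close>

lemma powr_convex_combination:
  assumes "1 \<le> Q" "0 \<le> a" "0 \<le> b" "0 < t" "t < (1::real)"
  shows "(t * a + (1 - t) * b) powr Q \<le> t * a powr Q + (1 - t) * b powr Q"
proof -
  have small: "(u * c) powr Q \<le> u * c powr Q" if "0 < u" "u < 1" "0 \<le> c" for u c :: real
  proof -
    have "u powr Q \<le> u powr 1" using that assms(1) by (intro powr_mono') auto
    then show ?thesis using that by (simp add: powr_mult mult_right_mono)
  qed
  show ?thesis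
  proof (cases "a = 0 \<or> b = 0")
    case True
    then show ?thesis using small[of t a] small[of "1 - t" b] assms by auto
  next
    case False
    then show ?thesis
      using convex_onD[OF powr_convex[OF assms(1)], of "1-t" a b] assms by (simp)
  qed
qed

text \<open>Minkowski's inequality from convexity. With a, b the norms of f, g and t = a / (a + b),
  the sum |f| + |g| is (a + b) times the convex combination of |f| / a and |g| / b with weight t,
  and these two functions have Q-th powers of integral at most 1.\<close>

lemma Lnorm_triangle:
  assumes "1 \<le> q" and f[measurable]: "f \<in> borel_measurable (lebesgue_on \<Omega>)" and g[measurable]: "g \<in> borel_measurable (lebesgue_on \<Omega>)"
  shows "Lnorm \<Omega> q (\<lambda>x. f x + g x) \<le> Lnorm \<Omega> q f + Lnorm \<Omega> q g"
  using assms(1)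
proof (cases q rule: ge1_ennreal_cases)
  case top
  have "AE x in lebesgue_on \<Omega>. ennreal (norm (f x)) \<le> Lnorm \<Omega> \<infinity> f"
    "AE x in lebesgue_on \<Omega>. ennreal (norm (g x)) \<le> Lnorm \<Omega> \<infinity> g"
    using Lnorm_top_le_iff[OF f, of "Lnorm \<Omega> \<infinity> f"] Lnorm_top_le_iff[OF g, of "Lnorm \<Omega> \<infinity> g"] by auto
  then have "AE x in lebesgue_on \<Omega>. ennreal (norm (f x + g x)) \<le> Lnorm \<Omega> \<infinity> f + Lnorm \<Omega> \<infinity> g"
  proof eventually_elim
    case (elim x)
    have "ennreal (norm (f x + g x)) \<le> ennreal (norm (f x)) + ennreal (norm (g x))"
      by (simp add: ennreal_plus[symmetric] norm_triangle_ineq ennreal_leI del: ennreal_plus)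
    also have "\<dots> \<le> Lnorm \<Omega> \<infinity> f + Lnorm \<Omega> \<infinity> g" using elim by (intro add_mono)
    finally show ?case .
  qed
  then show ?thesis unfolding top by (subst Lnorm_top_le_iff) auto
next
  case (real Q)
  consider "Lnorm \<Omega> q f = top \<or> Lnorm \<Omega> q g = top" | "Lnorm \<Omega> q f = 0" | "Lnorm \<Omega> q g = 0"
    | a b where "Lnorm \<Omega> q f = ennreal a" "Lnorm \<Omega> q g = ennreal b" "0 < a" "0 < b"
    by (cases "Lnorm \<Omega> q f"; cases "Lnorm \<Omega> q g") (auto simp: ennreal_eq_0_iff, force)
  then show ?thesis
  proof cases
    case 1
    then show ?thesis by auto
  next
    case 2
    have "Lnorm \<Omega> q (\<lambda>x. f x + g x) \<le> Lnorm \<Omega> q g"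
      using 2 Lnorm_eq_0_iff[OF assms(1) f] assms(1) by (intro Lnorm_mono_AE) auto
    then show ?thesis using 2 by simp
  next
    case 3
    have "Lnorm \<Omega> q (\<lambda>x. f x + g x) \<le> Lnorm \<Omega> q f"
      using 3 Lnorm_eq_0_iff[OF assms(1) g] assms(1) by (intro Lnorm_mono_AE) auto
    then show ?thesis using 3 by simp
  next
    case 4
    define t where "t = a / (a + b)"
    have t: "0 < t" "t < 1" "1 - t = b / (a + b)" using 4 by (auto simp: t_def field_simps)
    let ?I = "\<lambda>h. \<integral>\<^sup>+x. ennreal (norm (h x :: complex) powr Q) \<partial>lebesgue_on \<Omega>"
    have If: "?I f \<le> ennreal (a powr Q)" "?I g \<le> ennreal (b powr Q)"
      using Lnorm_real_le_iff[of Q \<Omega> f "ennreal a"] Lnorm_real_le_iff[of Q \<Omega> g "ennreal b"] real 4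
      by (auto simp: ennpow_ennreal)
    have pw: "norm (f x + g x) powr Q \<le> (a+b) powr Q * (t / a powr Q * norm (f x) powr Q + (1-t) / b powr Q * norm (g x) powr Q)" for x
    proof -

      have "t * (norm (f x) / a) = norm (f x) / (a + b)" "(1-t) * (norm (g x) / b) = norm (g x) / (a + b)"
        unfolding t(3) unfolding t_def using 4 by auto
      then have eq: "norm (f x) + norm (g x) = (a+b) * (t * (norm (f x) / a) + (1-t) * (norm (g x) / b))"
        using 4 by (simp add: add_divide_distrib[symmetric])
      have "norm (f x + g x) powr Q \<le> (norm (f x) + norm (g x)) powr Q"
        using real by (intro powr_mono2 norm_triangle_ineq) auto
      also note eq
      also have "((a+b) * (t * (norm (f x) / a) + (1-t) * (norm (g x) / b))) powr Q = (a+b) powr Q * (t * (norm (f x) / a) + (1-t) * (norm (g x) / b)) powr Q"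
        using 4 t by (intro powr_mult) 
      also have "\<dots> \<le> (a+b) powr Q * (t * (norm (f x) / a) powr Q + (1-t) * (norm (g x) / b) powr Q)"
        using real 4 t by (intro mult_left_mono powr_convex_combination) auto
      also have "\<dots> = (a+b) powr Q * (t / a powr Q * norm (f x) powr Q + (1-t) / b powr Q * norm (g x) powr Q)"
        using 4 by (simp add: powr_divide)
      finally show ?thesis .
    qed
    have "?I (\<lambda>x. f x + g x) \<le> (\<integral>\<^sup>+x. ennreal ((a+b) powr Q) * (ennreal (t / a powr Q) * ennreal (norm (f x) powr Q)
        + ennreal ((1-t) / b powr Q) * ennreal (norm (g x) powr Q)) \<partial>lebesgue_on \<Omega>)"
      using pw t 4 by (intro nn_integral_mono)
        (auto simp: ennreal_mult[symmetric] ennreal_plus[symmetric] intro!: ennreal_leI simp del: ennreal_plus)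
    also have "\<dots> = ennreal ((a+b) powr Q) * (ennreal (t / a powr Q) * ?I f + ennreal ((1-t) / b powr Q) * ?I g)"
      by (simp add: nn_integral_cmult nn_integral_add)
    also have "\<dots> \<le> ennreal ((a+b) powr Q) * (ennreal (t / a powr Q) * ennreal (a powr Q) + ennreal ((1-t) / b powr Q) * ennreal (b powr Q))"
      by (intro mult_left_mono add_mono If) auto
    also have "\<dots> = ennreal ((a+b) powr Q)"
      using t 4 by (simp add: ennreal_mult[symmetric] ennreal_plus[symmetric] del: ennreal_plus)
    finally have "Lnorm \<Omega> q (\<lambda>x. f x + g x) \<le> ennreal (a+b)"
      unfolding real(1) using real(2) 4 by (subst Lnorm_real_le_iff) (auto simp: ennpow_ennreal ennreal_plus[symmetric] simp del: ennreal_plus)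
    then show ?thesis using 4 by simp
  qed
qed

lemma Lnorm_minus_triangle:
  assumes "1 \<le> q" "f \<in> borel_measurable (lebesgue_on \<Omega>)" "g \<in> borel_measurable (lebesgue_on \<Omega>)" "h \<in> borel_measurable (lebesgue_on \<Omega>)"
  shows "Lnorm \<Omega> q (\<lambda>x. f x - h x) \<le> Lnorm \<Omega> q (\<lambda>x. f x - g x) + Lnorm \<Omega> q (\<lambda>x. g x - h x)"
  using Lnorm_triangle[of q "\<lambda>x. f x - g x" \<Omega> "\<lambda>x. g x - h x"] assms by simp

lemma Lnorm_minus_commute:
  "Lnorm \<Omega> q (\<lambda>x. f x - g x) = Lnorm \<Omega> q (\<lambda>x. g x - f x)"
  by (simp add: Lnorm_def norm_minus_commute)

lemma Lnorm_one_finite: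
  assumes "1 \<le> q" "emeasure lebesgue \<Omega> < \<infinity>" "\<Omega> \<in> sets lebesgue"
  shows "Lnorm \<Omega> q (\<lambda>_. 1) < \<infinity>"
  using assms(1)
proof (cases q rule: ge1_ennreal_cases)
  case top
  have "Lnorm \<Omega> \<infinity> (\<lambda>_. 1) \<le> 1" by (subst Lnorm_top_le_iff) auto
  then show ?thesis using top by (auto simp: ennreal_one_less_top intro: le_less_trans)
next
  case (real Q)
  have "emeasure (lebesgue_on \<Omega>) \<Omega> < \<infinity>" using assms by (simp add: emeasure_restrict_space)
  with real show ?thesis by (simp add: Lnorm_real)
qed

lemma Lnorm_le_const:
  assumes "1 \<le> q" "\<Omega> \<in> sets lebesgue" "f \<in> borel_measurable (lebesgue_on \<Omega>)"
    and "\<And>x. x \<in> \<Omega> \<Longrightarrow> norm (f x) \<le> c" "0 \<le> c"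
  shows "Lnorm \<Omega> q f \<le> ennreal c * Lnorm \<Omega> q (\<lambda>_. 1)"
proof -
  have "Lnorm \<Omega> q f \<le> Lnorm \<Omega> q (\<lambda>_. of_real c * 1)"
    using assms by (intro Lnorm_mono_AE) auto
  also have "\<dots> = ennreal c * Lnorm \<Omega> q (\<lambda>_. 1)"
    using assms by (subst Lnorm_cmult) auto
  finally show ?thesis .
qed

text \<open>A substitute for Jensen's and Hoelder's inequalities at the cost of a constant factor.\<close>

lemma powr_le_split:
  assumes "0 < l" "0 \<le> x" "0 \<le> a" "a \<le> b"
  shows "x powr a \<le> l powr a + l powr (a - b) * x powr (b::real)"
proof (cases "x \<le> l")
  case True
  then have "x powr a \<le> l powr a" using assms by (intro powr_mono2) auto
  then show ?thesis by (simp add: add_increasing2)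
next
  case False
  then have "x powr a = x powr (a - b) * x powr b" using assms by (simp add: powr_add[symmetric])
  also have "\<dots> \<le> l powr (a - b) * x powr b"
    using False assms by (intro mult_right_mono powr_mono2') auto
  finally show ?thesis by (simp add: add_increasing)
qed

text \<open>For finite q, \<open>powr_le_split\<close> at the level l equal to the norm bounds the
  integral by l |\<Omega>| + l^(1 - Q) l^Q, which is the right-hand side. One constant serves all q,
  including q = \<infinity>.\<close>

lemma L1_le_Lnorm:
  assumes "1 \<le> q" "\<Omega> \<in> sets lebesgue" and [measurable]: "f \<in> borel_measurable (lebesgue_on \<Omega>)"
  shows "(\<integral>\<^sup>+x. ennreal (norm (f x)) \<partial>lebesgue_on \<Omega>) \<le> (emeasure lebesgue \<Omega> + 1) * Lnorm \<Omega> q f"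
  using assms(1)
proof (cases q rule: ge1_ennreal_cases)
  case top
  have "(\<integral>\<^sup>+x. ennreal (norm (f x)) \<partial>lebesgue_on \<Omega>) \<le> (\<integral>\<^sup>+x. Lnorm \<Omega> q f \<partial>lebesgue_on \<Omega>)"
    using Lnorm_top_le_iff[OF assms(3), of "Lnorm \<Omega> q f"] top
    by (intro nn_integral_mono_AE) auto
  also have "\<dots> = emeasure lebesgue \<Omega> * Lnorm \<Omega> q f"
    using assms(2) by (simp add: emeasure_restrict_space mult.commute)
  also have "\<dots> \<le> (emeasure lebesgue \<Omega> + 1) * Lnorm \<Omega> q f"
    by (intro mult_right_mono) auto
  finally show ?thesis .
next
  case (real Q)
  consider "Lnorm \<Omega> q f = top" | "Lnorm \<Omega> q f = 0" | l where "Lnorm \<Omega> q f = ennreal l" "0 < l"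
    by (cases "Lnorm \<Omega> q f") (auto simp: ennreal_eq_0_iff, force)
  then show ?thesis
  proof cases
    case 1
    then show ?thesis by (simp add: ennreal_mult_top)
  next
    case 2
    then have "AE x in lebesgue_on \<Omega>. f x = 0" using Lnorm_eq_0_iff assms by blast
    then have "(\<integral>\<^sup>+x. ennreal (norm (f x)) \<partial>lebesgue_on \<Omega>) = (\<integral>\<^sup>+x. 0 \<partial>lebesgue_on \<Omega>)"
      by (intro nn_integral_cong_AE) auto
    then show ?thesis by simp
  next
    case 3
    have "(\<integral>\<^sup>+x. ennreal (norm (f x)) \<partial>lebesgue_on \<Omega>)
        \<le> (\<integral>\<^sup>+x. ennreal l + ennreal (l powr (1 - Q)) * ennreal (norm (f x) powr Q) \<partial>lebesgue_on \<Omega>)"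
      using powr_le_split[of l "norm (f x)" 1 Q for x] 3 real
      by (intro nn_integral_mono) (auto simp: ennreal_mult[symmetric] ennreal_plus[symmetric] intro!: ennreal_leI simp del: ennreal_plus)
    also have "\<dots> = ennreal l * emeasure lebesgue \<Omega> + ennreal (l powr (1 - Q)) * (\<integral>\<^sup>+x. ennreal (norm (f x) powr Q) \<partial>lebesgue_on \<Omega>)"
      using assms(2) by (simp add: nn_integral_add nn_integral_cmult emeasure_restrict_space)
    also have "\<dots> \<le> ennreal l * emeasure lebesgue \<Omega> + ennreal (l powr (1 - Q)) * ennreal (l powr Q)"
      using Lnorm_real_le_iff[of Q \<Omega> f "ennreal l"] real 3
      by (intro add_mono mult_left_mono) (auto simp: ennpow_ennreal)
    also have "\<dots> = (emeasure lebesgue \<Omega> + 1) * Lnorm \<Omega> q f"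
      using 3 by (simp add: ennreal_mult[symmetric] powr_add[symmetric] distrib_left distrib_right mult.commute)
    finally show ?thesis .
  qed
qed

section \<open>Borel representatives of the magnetic double integrals\<close>

text \<open>A nondegenerate affine map pulls null sets back to null sets. The exceptional set is
  first enlarged to a Borel null set, since P itself need not be measurable.\<close>

lemma AE_lborel_affine:
  fixes t :: "'a::euclidean_space"
  assumes "AE x in lborel. P x" "c \<noteq> 0"
  shows "AE x in lborel. P (t + c *\<^sub>R x)"
proof -
  from assms(1) obtain N where N: "N \<in> sets borel" "emeasure lborel N = 0" "{x. \<not> P x} \<subseteq> N"
    by (auto elim!: AE_E)
  have "AE x in lborel. x \<notin> N"
    using N by (intro AE_not_in) auto
  then have "AE x in density (distr lborel borel (\<lambda>x. t + c *\<^sub>R x)) (\<lambda>_. ennreal (\<bar>c\<bar> ^ DIM('a))). x \<notin> N"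
    unfolding lborel_affine[OF assms(2), of t, symmetric] .
  then have "AE x in distr lborel borel (\<lambda>x. t + c *\<^sub>R x). x \<notin> N"
    using assms(2) by (simp add: AE_density)
  then have "AE x in lborel. t + c *\<^sub>R x \<notin> N"
    using N(1) by (subst (asm) AE_distr_iff) auto
  then show ?thesis using N(3) by (auto elim!: eventually_mono)
qed

text \<open>Transfers almost everywhere statements from points to pairs. The midpoint is included
  because the field is evaluated there; for fixed x it is an affine function of y with factor
  1/2.\<close>

lemma AE_lborel_pair:
  fixes P :: "'a::euclidean_space \<Rightarrow> bool"
  assumes "AE x in lborel. P x"
  shows "AE z in (lborel :: ('a \<times> 'a) measure). P (fst z) \<and> P (snd z) \<and> P (midpoint (fst z) (snd z))"
proof -
  from assms obtain N where N[measurable]: "N \<in> sets borel" and N': "emeasure lborel N = 0" "{x. \<not> P x} \<subseteq> N"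
    by (auto elim!: AE_E)
  have N0: "AE x in lborel. x \<notin> N"
    using N' by (intro AE_not_in) auto
  have mid: "AE y in lborel. midpoint x y \<notin> N" for x
    using AE_lborel_affine[OF N0, of "1/2" "(1/2) *\<^sub>R x"] by (simp add: midpoint_def scaleR_add_right)
  have "AE z in (lborel \<Otimes>\<^sub>M lborel :: ('a \<times> 'a) measure). fst z \<notin> N \<and> snd z \<notin> N \<and> midpoint (fst z) (snd z) \<notin> N"
  proof (rule lborel_pair.AE_pair_measure)
    show "{z \<in> space (lborel \<Otimes>\<^sub>M lborel). fst z \<notin> N \<and> snd z \<notin> N \<and> midpoint (fst z) (snd z) \<notin> N}
        \<in> sets (lborel \<Otimes>\<^sub>M lborel)"
      unfolding midpoint_def by measurable
    show "AE x in lborel. AE y in lborel. fst (x, y) \<notin> N \<and> snd (x, y) \<notin> N \<and> midpoint (fst (x, y)) (snd (x, y)) \<notin> N"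
      using N0
    proof eventually_elim
      case (elim x)
      with N0 mid[of x] show ?case by auto
    qed
  qed
  then show ?thesis unfolding lborel_prod
    by (rule eventually_mono) (use N'(2) in auto)
qed

text \<open>Borel measurability is what makes \<open>A (midpoint x y)\<close> jointly measurable for
  the product of the Borel sigma-algebras, where Tonelli's theorem is used.\<close>

lemma borel_representative:
  fixes f :: "'a::euclidean_space \<Rightarrow> 'b::euclidean_space"
  assumes "S \<in> sets lebesgue" "f \<in> borel_measurable (lebesgue_on S)"
  obtains g where "g \<in> borel_measurable borel" "AE x in lborel. x \<in> S \<longrightarrow> f x = g x"
proof -
  define F where "F x = (if x \<in> S then f x else 0)" for x
  have F: "F \<in> borel_measurable (completion lborel)"
    unfolding F_def[abs_def] using borel_measurable_if[OF assms(1)] assms(2) by blast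
  have "\<exists>g. g \<in> borel_measurable lborel \<and> (AE x in lborel. F x \<bullet> b = g x)" for b
    using completion_ex_borel_measurable_real[of "\<lambda>x. F x \<bullet> b" lborel] F by auto
  then obtain G where G: "\<And>b. G b \<in> borel_measurable lborel" "\<And>b. AE x in lborel. F x \<bullet> b = G b x"
    by metis
  show thesis
  proof
    show "(\<lambda>x. \<Sum>b\<in>Basis. G b x *\<^sub>R b) \<in> borel_measurable borel"
      using G(1) by simp
    have "AE x in lborel. \<forall>b\<in>Basis. F x \<bullet> b = G b x"
      using G(2) by (intro AE_finite_allI) auto
    then show "AE x in lborel. x \<in> S \<longrightarrow> f x = (\<Sum>b\<in>Basis. G b x *\<^sub>R b)"
    proof eventually_elim
      case (elim x)
      have "F x = (\<Sum>b\<in>Basis. G b x *\<^sub>R b)"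
        using elim by (subst euclidean_representation[symmetric]) (auto intro!: sum.cong)
      then show ?case by (auto simp: F_def)
    qed
  qed
qed

lemma borel_set_representative:
  assumes "S \<in> sets lebesgue"
  obtains T where "T \<in> sets borel" "AE x in lborel. x \<in> S \<longleftrightarrow> x \<in> T" "T \<subseteq> S"
proof
  show "main_part lborel S \<in> sets borel" using assms main_part_sets by fastforce
  show "AE x in lborel. x \<in> S \<longleftrightarrow> x \<in> main_part lborel S"
    using AE_in_main_part[OF assms] by (auto elim!: eventually_mono)
  show "main_part lborel S \<subseteq> S"
    using main_part_null_part_Un[OF assms] by auto
qed

lemma AE_lebesgue_on_iff:
  "S \<in> sets lebesgue \<Longrightarrow> (AE x in lebesgue_on S. P x) \<longleftrightarrow> (AE x in lborel. x \<in> S \<longrightarrow> P x)"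
  by (simp add: AE_restrict_space_iff AE_completion_iff)

lemma nn_integral_lebesgue_on:
  "S \<in> sets lebesgue \<Longrightarrow> (\<integral>\<^sup>+x. h x \<partial>lebesgue_on S) = (\<integral>\<^sup>+x. h x * indicator S x \<partial>lborel)"
  by (simp add: nn_integral_restrict_space nn_integral_completion)

lemma sets_lebesgue_AE:
  assumes "T \<in> sets borel" "AE x in lborel. x \<in> S \<longleftrightarrow> x \<in> T"
  shows "S \<in> sets lebesgue"
proof (rule completion.in_sets_AE)
  show "AE x in completion lborel. x \<in> T \<longleftrightarrow> x \<in> S"
    using assms(2) by (intro AE_completion) (auto elim!: eventually_mono)
qed (use assms in auto)

definition mag_kernel ::
    "(real^'n \<Rightarrow> real^'n) \<Rightarrow> real \<Rightarrow> real \<Rightarrow> (real^'n \<Rightarrow> complex) \<Rightarrow> (real^'n) \<times> (real^'n) \<Rightarrow> real" where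
  "mag_kernel A s p f = (\<lambda>(x, y).
     norm (f x - exp (\<i> * complex_of_real ((x - y) \<bullet> A (midpoint x y))) * f y) powr p
       / norm (x - y) powr (real CARD('n) + s * p))"

text \<open>The double integral before the root is taken, over \<open>lborel\<close> and with the
  domain as an indicator: in this form domains can be split and integrals added.\<close>

definition mag_int ::
    "((real^'n) \<times> (real^'n)) set \<Rightarrow> (real^'n \<Rightarrow> real^'n) \<Rightarrow> real \<Rightarrow> real \<Rightarrow> (real^'n \<Rightarrow> complex) \<Rightarrow> ennreal" where
  "mag_int D A s p f = (\<integral>\<^sup>+z. ennreal (mag_kernel A s p f z) * indicator D z \<partial>lborel)"

lemma mag_kernel_nonneg [simp]: "0 \<le> mag_kernel A s p f z"
  by (cases z) (simp add: mag_kernel_def)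

lemma mag_kernel_measurable [measurable]:
  assumes [measurable]: "A \<in> borel_measurable borel" "f \<in> borel_measurable borel"
  shows "mag_kernel A s p f \<in> borel_measurable borel"
  unfolding mag_kernel_def midpoint_def borel_prod[symmetric] by measurable

text \<open>The passage to Borel data: f, A and D matter only up to null sets. The field matters
  only on the convex hull, because D consists of pairs in \<Omega> and the hull contains their
  midpoints.\<close>

lemma mag_double_eq_mag_int:
  fixes \<Omega> :: "(real^'n) set"
  assumes f: "AE x in lborel. x \<in> \<Omega> \<longrightarrow> f x = f' x"
    and A: "AE x in lborel. x \<in> convex hull \<Omega> \<longrightarrow> A x = A' x"
    and D: "D \<subseteq> \<Omega> \<times> \<Omega>" "D' \<in> sets borel" "AE z in lborel. z \<in> D \<longleftrightarrow> z \<in> D'"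
  shows "mag_double D A s p f = ennpow (mag_int D' A' s p f') (1 / p)"
proof -
  have DL: "D \<in> sets lebesgue" using D by (intro sets_lebesgue_AE) auto
  have "mag_double D A s p f = ennpow (\<integral>\<^sup>+z. ennreal (mag_kernel A s p f z) \<partial>lebesgue_on D) (1 / p)"
    unfolding mag_double_def mag_kernel_def by (simp add: case_prod_unfold)
  also have "(\<integral>\<^sup>+z. ennreal (mag_kernel A s p f z) \<partial>lebesgue_on D)
      = (\<integral>\<^sup>+z. ennreal (mag_kernel A s p f z) * indicator D z \<partial>lborel)"
    by (rule nn_integral_lebesgue_on[OF DL])
  also have "\<dots> = mag_int D' A' s p f'"
    unfolding mag_int_def
  proof (rule nn_integral_cong_AE)
    show "AE z in lborel. ennreal (mag_kernel A s p f z) * indicator D z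
        = ennreal (mag_kernel A' s p f' z) * indicator D' z"
      using AE_lborel_pair[OF f] AE_lborel_pair[OF A] D(3)
    proof eventually_elim
      case (elim z)
      show ?case
      proof (cases "z \<in> D")
        case True
        then have z: "fst z \<in> \<Omega>" "snd z \<in> \<Omega>" using D(1) by auto
        then have "midpoint (fst z) (snd z) \<in> convex hull \<Omega>"
          unfolding midpoint_def scaleR_add_right by (intro convexD[OF convex_convex_hull] hull_inc) auto
        with elim z True have "mag_kernel A s p f z = mag_kernel A' s p f' z"
          by (auto simp: mag_kernel_def case_prod_unfold)
        then show ?thesis using elim True by simp
      qed (use elim in simp)
    qed
  qed
  finally show ?thesis .
qed

section \<open>Riesz kernels and corkscrew balls\<close>

lemma dyadic_shell:
  assumes "0 < d" "d < (R::real)"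
  obtains j :: nat where "R / 2 ^ Suc j \<le> d" "d < R / 2 ^ j"
proof -
  have "0 < d / R" using assms by simp
  then obtain n where "(1/2::real) ^ n < d / R" using real_arch_pow_inv[of "d/R" "1/2"] by auto
  then have n: "R / 2 ^ n \<le> d" using assms by (simp add: field_simps power_divide)
  define m where "m = (LEAST n. R / 2 ^ n \<le> d)"
  have m: "R / 2 ^ m \<le> d" unfolding m_def using n by (rule LeastI)
  have "m \<noteq> 0" using m assms by (intro notI) simp
  then obtain j where j: "m = Suc j" using not0_implies_Suc by blast
  have "\<not> R / 2 ^ j \<le> d" using not_less_Least[of j "\<lambda>n. R / 2 ^ n \<le> d"] j m_def by simp
  with m j show thesis using that[of j] by simp
qed

text \<open>Dyadic decomposition: where |x - y| lies between \<rho> / 2 and \<rho> = R / 2^j, the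
  kernel is at most a constant times \<rho>^(k - N). The ball of radius \<rho> has volume V
  \<rho>^N, and the resulting powers \<rho>^k form a geometric series because k > 0.\<close>

lemma Riesz_kernel_integral_bound:
  assumes "0 < k" "0 < R"
  obtains K where "0 \<le> K"
    "\<And>x::'a::euclidean_space.
       (\<integral>\<^sup>+y. ennreal (norm (x - y) powr (k - real DIM('a))) * indicator (ball x R) y \<partial>lborel) \<le> ennreal K"
proof
  define N where "N = real DIM('a)"
  define V where "V = unit_ball_vol N"
  have V: "0 \<le> V" unfolding V_def N_def by simp
  \<comment> \<open>The factor \<open>2 powr N\<close> covers both signs of k - N: for k \<le> N the
    kernel on a shell is largest at radius \<rho> / 2, which costs 2^(N - k).\<close>
  define c where "c j = (R / 2 ^ j) powr (k - N) * 2 powr N" for j :: nat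
  define l where "l = 2 powr (- k)"
  have l: "0 \<le> l" "l < 1" unfolding l_def using assms(1) by (auto simp: powr_minus_divide)
  have [measurable]: "ball c r \<in> sets borel" for c :: 'a and r by simp
  show "0 \<le> V * 2 powr N * R powr k * (1 / (1 - l))" using V l by auto
  fix x :: 'a
  have pw: "ennreal (norm (x - y) powr (k - N)) * indicator (ball x R) y
      \<le> (\<Sum>j. ennreal (c j) * indicator (ball x (R / 2 ^ j)) y)" for y
  proof (cases "x \<noteq> y \<and> y \<in> ball x R")
    case True
    define d where "d = norm (x - y)"
    have d: "0 < d" "d < R" using True by (auto simp: d_def dist_norm)
    then obtain j where j: "R / 2 ^ Suc j \<le> d" "d < R / 2 ^ j" by (rule dyadic_shell)
    define \<rho> where "\<rho> = R / 2 ^ j"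
    have \<rho>: "0 < \<rho>" "\<rho> \<le> 2 * d" "d < \<rho>" using j assms by (auto simp: \<rho>_def)
    have "d powr (k - N) \<le> \<rho> powr (k - N) * 2 powr N"
    proof (cases "k \<le> N")
      case True
      have "d powr (k - N) \<le> (\<rho> / 2) powr (k - N)" using \<rho> True d by (intro powr_mono2') auto
      also have "\<dots> = \<rho> powr (k - N) * 2 powr (N - k)" using \<rho> by (simp add: powr_divide powr_diff)
      also have "\<dots> \<le> \<rho> powr (k - N) * 2 powr N" using assms by (intro mult_left_mono powr_mono) auto
      finally show ?thesis .
    next
      case False
      have "d powr (k - N) \<le> \<rho> powr (k - N)" using \<rho> False d by (intro powr_mono2) auto
      also have "\<dots> \<le> \<rho> powr (k - N) * 2 powr N"
        using ge_one_powr_ge_zero[of 2 N] by (simp add: N_def mult_le_cancel_left1)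
      finally show ?thesis .
    qed
    then have "ennreal (norm (x - y) powr (k - N)) * indicator (ball x R) y \<le> ennreal (c j) * indicator (ball x (R / 2 ^ j)) y"
      using True j by (auto simp: c_def d_def \<rho>_def dist_norm intro!: ennreal_leI)
    also have "\<dots> \<le> (\<Sum>j. ennreal (c j) * indicator (ball x (R / 2 ^ j)) y)"
    proof -
      have "f j \<le> suminf f" for f :: "nat \<Rightarrow> ennreal"
        using sum_le_suminf[of f "{j}"] by simp
      then show ?thesis .
    qed
    finally show ?thesis .
  qed auto
  have "(\<integral>\<^sup>+y. ennreal (norm (x - y) powr (k - N)) * indicator (ball x R) y \<partial>lborel)
      \<le> (\<integral>\<^sup>+y. (\<Sum>j. ennreal (c j) * indicator (ball x (R / 2 ^ j)) y) \<partial>lborel)"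
    by (intro nn_integral_mono pw)
  also have "\<dots> = (\<Sum>j. \<integral>\<^sup>+y. ennreal (c j) * indicator (ball x (R / 2 ^ j)) y \<partial>lborel)"
    by (rule nn_integral_suminf) measurable
  also have "\<dots> = (\<Sum>j. ennreal (V * 2 powr N * R powr k * l ^ j))"
  proof (intro suminf_cong)
    fix j
    define \<rho> where "\<rho> = R / 2 ^ j"
    have \<rho>: "0 < \<rho>" using assms by (simp add: \<rho>_def)
    have e: "emeasure lborel (ball x \<rho>) = ennreal (V * \<rho> powr N)"
      using \<rho> by (simp add: emeasure_ball V_def N_def powr_realpow)
    have c0: "0 \<le> c j" by (simp add: c_def)
    have "c j * (V * \<rho> powr N) = V * 2 powr N * \<rho> powr k"
      using \<rho> by (simp add: c_def \<rho>_def[symmetric] powr_diff)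
    also have "\<rho> powr k = R powr k * l ^ j"
    proof -
      have "(2 ^ j) powr k = 2 powr (k * real j)" by (simp add: powr_realpow[symmetric] powr_powr mult.commute)
      moreover have "l ^ j = 1 / 2 powr (k * real j)"
      proof -
        have "l ^ j = 2 powr (real j * - k)" unfolding l_def by (rule powr_power) simp
        then show ?thesis by (simp add: powr_minus_divide mult.commute)
      qed
      ultimately show ?thesis using assms by (simp add: \<rho>_def powr_divide)
    qed
    finally have eq: "c j * (V * \<rho> powr N) = V * 2 powr N * R powr k * l ^ j" by (simp only: mult.assoc)
    have "(\<integral>\<^sup>+y. ennreal (c j) * indicator (ball x (R / 2 ^ j)) y \<partial>lborel) = ennreal (c j) * ennreal (V * \<rho> powr N)"
      by (simp add: nn_integral_cmult_indicator \<rho>_def[symmetric] e)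
    then show "(\<integral>\<^sup>+y. ennreal (c j) * indicator (ball x (R / 2 ^ j)) y \<partial>lborel) = ennreal (V * 2 powr N * R powr k * l ^ j)"
      using V c0 by (simp only: ennreal_mult[symmetric] eq mult_nonneg_nonneg powr_ge_zero)
  qed
  also have "\<dots> = ennreal (\<Sum>j. V * 2 powr N * R powr k * l ^ j)"
    using V l by (intro suminf_ennreal2 summable_mult summable_geometric) auto
  also have "\<dots> = ennreal (V * 2 powr N * R powr k * (1 / (1 - l)))"
    using l by (subst suminf_mult) (auto intro!: summable_geometric simp: suminf_geometric)
  finally show "(\<integral>\<^sup>+y. ennreal (norm (x - y) powr (k - real DIM('a))) * indicator (ball x R) y \<partial>lborel)
     \<le> ennreal (V * 2 powr N * R powr k * (1 / (1 - l)))"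
    unfolding N_def .
qed

section \<open>Corkscrew balls in Lipschitz domains\<close>

definition corkscrew :: "'a::metric_space set \<Rightarrow> real \<Rightarrow> real \<Rightarrow> bool" where
  "corkscrew \<Omega> \<kappa> t0 \<longleftrightarrow> (\<forall>x\<in>\<Omega>. \<forall>t. 0 < t \<longrightarrow> t \<le> t0 \<longrightarrow> (\<exists>z. ball z (\<kappa> * t) \<subseteq> \<Omega> \<inter> ball x t))"

text \<open>Moving from x by t / 2 in the direction v leaves room above the graph. A further
  displacement e of norm below k t lowers the point by at most k t and raises the graph by at most 2
  L k t, the 2 coming from the crude bound 2 |e| for the projection of e. The radius factor k = 1 /
  (4 (L + 1)) ensures k (1 + 2 L) < 1/2.\<close>

lemma corkscrew_above_graph:
  fixes v :: "'a::euclidean_space"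
  assumes v: "norm v = 1" and g: "L-lipschitz_on {y. y \<bullet> v = 0} g"
    and \<Omega>: "\<Omega> \<inter> ball x0 \<rho> = {x \<in> ball x0 \<rho>. x \<bullet> v > g (x - (x \<bullet> v) *\<^sub>R v)}"
    and x: "x \<in> \<Omega>" "x \<in> ball x0 (\<rho> / 2)" and t: "0 < t" "t \<le> \<rho> / 2"
  shows "ball (x + (t/2) *\<^sub>R v) (1 / (4 * (L + 1)) * t) \<subseteq> \<Omega> \<inter> ball x t"
proof
  define k where "k = 1 / (4 * (L + 1))"
  have L: "0 \<le> L" using g by (rule lipschitz_on_nonneg)
  have k: "k \<le> 1/4" "k * (1 + 2 * L) < 1/2" using L by (auto simp: k_def field_simps)
  have vv: "v \<bullet> v = 1" using v by (simp add: norm_eq_sqrt_inner)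
  fix y assume "y \<in> ball (x + (t/2) *\<^sub>R v) (1 / (4 * (L + 1)) * t)"
  then have y: "dist (x + (t/2) *\<^sub>R v) y < k * t" by (simp add: k_def)
  define e where "e = y - (x + (t/2) *\<^sub>R v)"
  have e: "norm e < k * t" using y by (simp add: e_def dist_norm norm_minus_commute)
  have yx: "y = x + (t/2) *\<^sub>R v + e" by (simp add: e_def)
  have ev: "\<bar>e \<bullet> v\<bar> \<le> norm e" using Cauchy_Schwarz_ineq2[of e v] v by simp
  have kt: "k * t \<le> t / 4" using k(1) t by (simp add: field_simps)
  have "dist x y = norm ((t/2) *\<^sub>R v + e)" by (subst dist_commute) (simp add: yx dist_norm algebra_simps)
  also have "\<dots> \<le> t/2 + norm e" using norm_triangle_ineq[of "(t/2) *\<^sub>R v" e] v t by simp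
  also have "\<dots> < t" using e kt t by linarith
  finally have xy: "dist x y < t" .
  have y0: "y \<in> ball x0 \<rho>"
    using xy x(2) t dist_triangle[of x0 y x] by (simp add: dist_commute)
  define P where "P = (\<lambda>w. w - (w \<bullet> v) *\<^sub>R v)"
  have x0: "x \<in> ball x0 \<rho>" using x(2) t by (simp add: )
  then have gx: "x \<bullet> v > g (P x)" using \<Omega> x(1) unfolding P_def by blast
  have Pv: "P w \<in> {y. y \<bullet> v = 0}" for w by (simp add: P_def inner_diff_left vv)
  have "P y - P x = e - (e \<bullet> v) *\<^sub>R v"
    by (simp add: P_def yx inner_add_left vv algebra_simps)
  then have "norm (P y - P x) \<le> norm e + \<bar>e \<bullet> v\<bar>"
    using norm_triangle_ineq4[of e "(e \<bullet> v) *\<^sub>R v"] v by simp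
  then have "norm (P y - P x) \<le> 2 * norm e" using ev by simp
  then have "L * dist (P y) (P x) \<le> L * (2 * norm e)" using L by (intro mult_left_mono) (auto simp: dist_norm)
  also have "\<dots> \<le> L * (2 * (k * t))" using L e by (intro mult_left_mono) auto
  finally have 1: "L * dist (P y) (P x) \<le> 2 * L * (k * t)" by simp
  have "dist (g (P y)) (g (P x)) \<le> L * dist (P y) (P x)" using lipschitz_onD[OF g Pv Pv] .
  then have "g (P y) \<le> g (P x) + 2 * L * (k * t)" using 1 by (simp add: dist_real_def)
  also have "\<dots> < x \<bullet> v + 2 * L * (k * t)" using gx by simp
  also have "\<dots> \<le> x \<bullet> v + t/2 - k * t"
    using mult_strict_right_mono[OF k(2) t(1)] by (simp add: algebra_simps)
  also have "\<dots> \<le> y \<bullet> v" using e ev by (simp add: yx inner_add_left vv)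
  finally have "y \<in> \<Omega>" using \<Omega> y0 unfolding P_def by blast
  then show "y \<in> \<Omega> \<inter> ball x t" using xy by simp
qed

text \<open>Each point of the closure has a neighbourhood with its own constants, trivially inside
  \<Omega> and from the graph at the boundary; finitely many such neighbourhoods cover the compact
  closure.\<close>

lemma lipschitz_boundary_corkscrew:
  assumes "open \<Omega>" "bounded \<Omega>" "lipschitz_boundary \<Omega>"
  obtains \<kappa> t0 where "0 < \<kappa>" "0 < t0" "corkscrew \<Omega> \<kappa> t0"
proof -
  have "\<exists>\<rho> \<kappa>. 0 < \<rho> \<and> 0 < \<kappa> \<and> (\<forall>x\<in>\<Omega> \<inter> ball x0 \<rho>. \<forall>t. 0 < t \<longrightarrow> t \<le> \<rho> \<longrightarrow> (\<exists>z. ball z (\<kappa> * t) \<subseteq> \<Omega> \<inter> ball x t))"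
    if "x0 \<in> closure \<Omega>" for x0
  proof (cases "x0 \<in> \<Omega>")
    case True
    then obtain e where e: "0 < e" "ball x0 e \<subseteq> \<Omega>" using assms(1) open_contains_ball by blast
    have "ball x (1 * t) \<subseteq> \<Omega> \<inter> ball x t" if "x \<in> ball x0 (e/2)" "t \<le> e/2" for x t
    proof -
      have "ball x t \<subseteq> ball x0 e"
      proof
        fix y assume "y \<in> ball x t"
        then show "y \<in> ball x0 e" using that dist_triangle[of x0 y x] by simp
      qed
      with e show ?thesis by auto
    qed
    then have "\<forall>x\<in>\<Omega> \<inter> ball x0 (e/2). \<forall>t. 0 < t \<longrightarrow> t \<le> e/2 \<longrightarrow> (\<exists>z. ball z (1 * t) \<subseteq> \<Omega> \<inter> ball x t)"
      by blast
    then have "0 < e/2 \<and> 0 < (1::real) \<and> (\<forall>x\<in>\<Omega> \<inter> ball x0 (e/2). \<forall>t. 0 < t \<longrightarrow> t \<le> e/2 \<longrightarrow> (\<exists>z. ball z (1 * t) \<subseteq> \<Omega> \<inter> ball x t))"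
      using e(1) by (intro conjI) auto
    then show ?thesis by (intro exI)
  next
    case False
    with that assms(1) have "x0 \<in> frontier \<Omega>" by (simp add: frontier_def interior_open)
    then obtain v \<rho> L g where *: "norm v = 1" "\<rho> > 0" "L-lipschitz_on {y. y \<bullet> v = 0} g"
        "\<Omega> \<inter> ball x0 \<rho> = {x \<in> ball x0 \<rho>. x \<bullet> v > g (x - (x \<bullet> v) *\<^sub>R v)}"
      using assms(3) unfolding lipschitz_boundary_def by blast
    have "0 < 1 / (4 * (L + 1))" using lipschitz_on_nonneg[OF *(3)] by simp
    moreover have "\<forall>x\<in>\<Omega> \<inter> ball x0 (\<rho>/2). \<forall>t. 0 < t \<longrightarrow> t \<le> \<rho>/2 \<longrightarrow> (\<exists>z. ball z (1 / (4 * (L + 1)) * t) \<subseteq> \<Omega> \<inter> ball x t)"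
      using corkscrew_above_graph[OF *(1,3,4)] by blast
    moreover have "0 < \<rho>/2" using *(2) by simp
    ultimately have "0 < \<rho>/2 \<and> 0 < 1 / (4 * (L + 1)) \<and> (\<forall>x\<in>\<Omega> \<inter> ball x0 (\<rho>/2). \<forall>t. 0 < t \<longrightarrow> t \<le> \<rho>/2 \<longrightarrow> (\<exists>z. ball z (1 / (4 * (L + 1)) * t) \<subseteq> \<Omega> \<inter> ball x t))"
      by (intro conjI)
    then show ?thesis by (intro exI)
  qed
  then obtain \<rho> \<kappa> where loc: "\<And>x0. x0 \<in> closure \<Omega> \<Longrightarrow> 0 < \<rho> x0 \<and> 0 < \<kappa> x0 \<and>
      (\<forall>x\<in>\<Omega> \<inter> ball x0 (\<rho> x0). \<forall>t. 0 < t \<longrightarrow> t \<le> \<rho> x0 \<longrightarrow> (\<exists>z. ball z (\<kappa> x0 * t) \<subseteq> \<Omega> \<inter> ball x t))"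
    by metis
  have "compact (closure \<Omega>)" using assms(2) by (simp add: compact_closure)
  then obtain F where F: "F \<subseteq> closure \<Omega>" "finite F" "closure \<Omega> \<subseteq> (\<Union>x0\<in>F. ball x0 (\<rho> x0))"
  proof (rule compactE_image)
    show "closure \<Omega> \<subseteq> (\<Union>x0\<in>closure \<Omega>. ball x0 (\<rho> x0))"
    proof
      fix x assume "x \<in> closure \<Omega>"
      moreover from this have "x \<in> ball x (\<rho> x)" using loc[of x] by simp
      ultimately show "x \<in> (\<Union>x0\<in>closure \<Omega>. ball x0 (\<rho> x0))" by blast
    qed
  qed auto
  have pos: "0 < \<rho> x0" "0 < \<kappa> x0" if "x0 \<in> F" for x0
    using loc[of x0] F(1) that by blast+
  \<comment> \<open>The inserted 1 keeps \<open>Min\<close> meaningful when F is empty, which is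
    possible if \<Omega> is empty.\<close>
  define k where "k = Min (insert 1 (\<kappa> ` F))"
  define t0 where "t0 = Min (insert 1 (\<rho> ` F))"
  have "0 < k" "0 < t0" unfolding k_def t0_def using F(2) pos by auto
  moreover have "corkscrew \<Omega> k t0" unfolding corkscrew_def
  proof (intro ballI allI impI)
    fix x t assume x: "x \<in> \<Omega>" and t: "0 < t" "t \<le> t0"
    then obtain x0 where x0: "x0 \<in> F" "x \<in> ball x0 (\<rho> x0)" using F(3) closure_subset by blast
    have "t0 \<le> \<rho> x0" "k \<le> \<kappa> x0" unfolding k_def t0_def using x0 F by auto
    then have "t \<le> \<rho> x0" using t by simp
    then obtain z where z: "ball z (\<kappa> x0 * t) \<subseteq> \<Omega> \<inter> ball x t"
      using loc[of x0] F(1) x0 x t(1) by blast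
    have "ball z (k * t) \<subseteq> ball z (\<kappa> x0 * t)" using t \<open>k \<le> \<kappa> x0\<close> by (intro subset_ball mult_right_mono) auto
    with z show "\<exists>z. ball z (k * t) \<subseteq> \<Omega> \<inter> ball x t" by blast
  qed
  ultimately show thesis by (rule that)
qed

text \<open>One corkscrew ball is chosen for each centre d of a finite cover of \<Omega> by balls of
  radius t, and x uses the choice of some d within distance t. The selection is measurable with
  finitely many values, at the price of the radius 2 t instead of t.\<close>

lemma corkscrew_selection:
  fixes \<Omega> :: "'a::euclidean_space set"
  assumes "corkscrew \<Omega> \<kappa> t0" "bounded \<Omega>" "0 < t" "t \<le> t0"
  obtains \<zeta> :: "'a \<Rightarrow> 'a" where "\<zeta> \<in> borel_measurable borel" "finite (range \<zeta>)"
    "\<And>x. x \<in> \<Omega> \<Longrightarrow> ball (\<zeta> x) (\<kappa> * t) \<subseteq> \<Omega> \<inter> ball x (2 * t)"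
proof -
  have "closure \<Omega> \<subseteq> (\<Union>d\<in>\<Omega>. ball d t)"
    using assms(3) by (auto simp: closure_approachable dist_commute)
  moreover have "compact (closure \<Omega>)" using assms(2) by (simp add: compact_closure)
  ultimately obtain F where F: "F \<subseteq> \<Omega>" "finite F" "closure \<Omega> \<subseteq> (\<Union>d\<in>F. ball d t)"
    using compactE_image[of "closure \<Omega>" \<Omega> "\<lambda>d. ball d t"] by auto
  have "\<exists>\<zeta>::'a \<Rightarrow> 'a. \<zeta> \<in> borel_measurable borel \<and> finite (range \<zeta>) \<and>
      (\<forall>x\<in>\<Union>d\<in>F. ball d t. ball (\<zeta> x) (\<kappa> * t) \<subseteq> \<Omega> \<inter> ball x (2 * t))"
    using F(2,1)
  proof (induction F rule: finite_induct)
    case empty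
    show ?case by (intro exI[of _ "\<lambda>_. 0"]) auto
  next
    case (insert d F)
    then obtain \<zeta> :: "'a \<Rightarrow> 'a" where [measurable]: "\<zeta> \<in> borel_measurable borel" and \<zeta>: "finite (range \<zeta>)"
      "\<forall>x\<in>\<Union>d\<in>F. ball d t. ball (\<zeta> x) (\<kappa> * t) \<subseteq> \<Omega> \<inter> ball x (2 * t)" by auto
    obtain z where z: "ball z (\<kappa> * t) \<subseteq> \<Omega> \<inter> ball d t"
      using assms insert.prems unfolding corkscrew_def by blast
    have "ball d t \<subseteq> ball x (2 * t)" if "x \<in> ball d t" for x
    proof
      fix y assume "y \<in> ball d t"
      then show "y \<in> ball x (2 * t)" using that dist_triangle[of x y d] by (simp add: dist_commute)
    qed
    with z have z': "ball z (\<kappa> * t) \<subseteq> \<Omega> \<inter> ball x (2 * t)" if "x \<in> ball d t" for x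
      using that by blast
    define \<zeta>' where "\<zeta>' x = (if x \<in> ball d t then z else \<zeta> x)" for x
    have "\<zeta>' \<in> borel_measurable borel" unfolding \<zeta>'_def[abs_def]
      by (intro measurable_If_set) auto
    moreover have "finite (range \<zeta>')"
      by (rule finite_subset[of _ "insert z (range \<zeta>)"]) (use \<zeta>(1) in \<open>auto simp: \<zeta>'_def\<close>)
    moreover have "\<forall>x\<in>\<Union>d\<in>insert d F. ball d t. ball (\<zeta>' x) (\<kappa> * t) \<subseteq> \<Omega> \<inter> ball x (2 * t)"
      using \<zeta>(2) z' by (auto simp: \<zeta>'_def)
    ultimately show ?case by blast
  qed
  then obtain \<zeta> :: "'a \<Rightarrow> 'a" where "\<zeta> \<in> borel_measurable borel" "finite (range \<zeta>)"
      "\<forall>x\<in>\<Union>d\<in>F. ball d t. ball (\<zeta> x) (\<kappa> * t) \<subseteq> \<Omega> \<inter> ball x (2 * t)" by blast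
  with F(3) closure_subset[of \<Omega>] show thesis by (intro that[of \<zeta>]) blast+
qed

section \<open>Averages over corkscrew balls\<close>

lemma ennpow_measurable [measurable (raw)]:
  assumes [measurable]: "f \<in> borel_measurable M"
  shows "(\<lambda>x. ennpow (f x) a) \<in> borel_measurable M"
  unfolding ennpow_def by measurable

lemma unit_ball_vol_of_nat_pos [simp]: "0 < unit_ball_vol (real m)" "unit_ball_vol (real m) \<noteq> 0"
  by (simp, metis less_irrefl of_nat_0_le_iff unit_ball_vol_pos)

lemma ennpow_le_split:
  assumes "0 < l" "1 \<le> r"
  shows "x \<le> ennreal l + ennreal (l powr (1 - r)) * ennpow x r"
proof (cases x)
  case (real t)
  then show ?thesis using powr_le_split[of l t 1 r] assms
    by (auto simp: ennpow_ennreal ennreal_mult[symmetric] ennreal_plus[symmetric] intro!: ennreal_leI simp del: ennreal_plus)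
next
  case top
  then show ?thesis using assms by (simp add: ennreal_mult_top)
qed

text \<open>Jensen's inequality up to the factor 2^r: at the level l with l^r = W both terms of
  \<open>ennpow_le_split\<close> contribute l.\<close>

lemma (in prob_space) ennpow_nn_integral_le:
  assumes [measurable]: "h \<in> borel_measurable M" and r: "1 \<le> r"
  shows "ennpow (\<integral>\<^sup>+x. h x \<partial>M) r \<le> ennreal (2 powr r) * (\<integral>\<^sup>+x. ennpow (h x) r \<partial>M)"
proof -
  define W where "W = (\<integral>\<^sup>+x. ennpow (h x) r \<partial>M)"
  consider "W = top" | "W = 0" | w where "W = ennreal w" "0 < w"
    by (cases W) (auto simp: ennreal_eq_0_iff, force)
  then show ?thesis
  proof cases
    case 1
    then show ?thesis unfolding W_def[symmetric] by (simp add: ennreal_mult_top)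
  next
    case 2
    then have "AE x in M. h x = 0" unfolding W_def by (subst (asm) nn_integral_0_iff_AE) auto
    then have "(\<integral>\<^sup>+x. h x \<partial>M) = (\<integral>\<^sup>+x. 0 \<partial>M)" by (intro nn_integral_cong_AE)
    then show ?thesis by simp
  next
    case 3
    define l where "l = w powr (1 / r)"
    have l: "0 < l" "l powr r = w" using 3 r by (auto simp: l_def powr_powr)
    have "(\<integral>\<^sup>+x. h x \<partial>M) \<le> (\<integral>\<^sup>+x. ennreal l + ennreal (l powr (1 - r)) * ennpow (h x) r \<partial>M)"
      using l r by (intro nn_integral_mono ennpow_le_split) auto
    also have "\<dots> = ennreal l + ennreal (l powr (1 - r)) * W"
      by (simp add: nn_integral_add nn_integral_cmult emeasure_space_1 W_def)
    also have "\<dots> = ennreal (2 * l)"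
    proof -
      have "l powr (1 - r) * w = l" unfolding l(2)[symmetric] using l(1) by (simp add: powr_add[symmetric])
      then show ?thesis using 3 l(1)
        by (simp add: ennreal_mult[symmetric] ennreal_plus[symmetric] del: ennreal_plus)
    qed
    finally have "ennpow (\<integral>\<^sup>+x. h x \<partial>M) r \<le> ennpow (ennreal (2 * l)) r" using r by (intro ennpow_mono) auto
    also have "\<dots> = ennreal (2 powr r) * W"
    proof -
      have "(2 * l) powr r = 2 powr r * w" using l by (simp add: powr_mult)
      moreover have "ennpow (ennreal (2 * l)) r = ennreal ((2 * l) powr r)" using l by (intro ennpow_ennreal) simp
      ultimately show ?thesis using 3 by (simp only: ennreal_mult powr_ge_zero less_imp_le)
    qed
    finally show ?thesis unfolding W_def .
  qed
qed

text \<open>Both measures have mass 1, so each mean can be moved under the other integral; only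
  differences f x - f y remain.\<close>

lemma norm_diff_integrals_le:
  fixes f :: "'a \<Rightarrow> 'b::{banach, second_countable_topology}"
  assumes "prob_space M" "prob_space M'" "integrable M f" "integrable M' f"
  shows "ennreal (norm (integral\<^sup>L M f - integral\<^sup>L M' f)) \<le> (\<integral>\<^sup>+x. \<integral>\<^sup>+y. ennreal (norm (f x - f y)) \<partial>M' \<partial>M)"
proof -
  interpret M: prob_space M by fact
  interpret M': prob_space M' by fact
  have "ennreal (norm (integral\<^sup>L M f - integral\<^sup>L M' f)) = ennreal (norm (integral\<^sup>L M (\<lambda>x. f x - integral\<^sup>L M' f)))"
    using assms by (simp add: M.prob_space)
  also have "\<dots> \<le> (\<integral>\<^sup>+x. ennreal (norm (f x - integral\<^sup>L M' f)) \<partial>M)"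
    using assms by (intro integral_norm_bound_ennreal) auto
  also have "\<dots> \<le> (\<integral>\<^sup>+x. \<integral>\<^sup>+y. ennreal (norm (f x - f y)) \<partial>M' \<partial>M)"
  proof (intro nn_integral_mono)
    fix x
    have "ennreal (norm (f x - integral\<^sup>L M' f)) = ennreal (norm (integral\<^sup>L M' (\<lambda>y. f x - f y)))"
      using assms by (simp add: M'.prob_space)
    also have "\<dots> \<le> (\<integral>\<^sup>+y. ennreal (norm (f x - f y)) \<partial>M')"
      using assms by (intro integral_norm_bound_ennreal) auto
    finally show "ennreal (norm (f x - integral\<^sup>L M' f)) \<le> (\<integral>\<^sup>+y. ennreal (norm (f x - f y)) \<partial>M')" .
  qed
  finally show ?thesis .
qed

text \<open>
  The map \<open>\<zeta> j\<close> picks a corkscrew ball of size \<open>t0 / 2\<^sup>j\<close> near each point. It takes finitely many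
  values, so that the averages over these balls are simple functions and the compactness of a
  bounded sequence of averages is finite-dimensional.
\<close>

locale corkscrew_scales =
  fixes \<Omega> :: "(real^'n) set" and \<kappa> t0 :: real and \<zeta> :: "nat \<Rightarrow> real^'n \<Rightarrow> real^'n"
  assumes open_\<Omega>: "open \<Omega>" and bounded_\<Omega>: "bounded \<Omega>" and \<kappa>_pos: "0 < \<kappa>" and t0_pos: "0 < t0"
    and \<zeta>_measurable: "\<And>j. \<zeta> j \<in> borel_measurable borel"
    and finite_range_\<zeta>: "\<And>j. finite (range (\<zeta> j))"
    and ball_\<zeta>_subset: "\<And>j x. x \<in> \<Omega> \<Longrightarrow> ball (\<zeta> j x) (\<kappa> * (t0 / 2 ^ j)) \<subseteq> \<Omega> \<inter> ball x (2 * (t0 / 2 ^ j))"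
begin

abbreviation L1_int :: "(real^'n \<Rightarrow> complex) \<Rightarrow> ennreal" where
  "L1_int f \<equiv> \<integral>\<^sup>+x. ennreal (norm (f x)) * indicator \<Omega> x \<partial>lborel"

abbreviation Lp_int :: "real \<Rightarrow> (real^'n \<Rightarrow> complex) \<Rightarrow> ennreal" where
  "Lp_int p f \<equiv> \<integral>\<^sup>+x. ennreal (norm (f x) powr p) * indicator \<Omega> x \<partial>lborel"

abbreviation energy :: "(real^'n \<Rightarrow> real^'n) \<Rightarrow> real \<Rightarrow> real \<Rightarrow> (real^'n \<Rightarrow> complex) \<Rightarrow> ennreal" where
  "energy \<equiv> mag_int (\<Omega> \<times> \<Omega>)"

definition u :: "nat \<Rightarrow> real" where "u j = t0 / 2 ^ j"
definition "Q j x = uniform_measure lborel (ball (\<zeta> j x) (\<kappa> * u j))"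
definition avg :: "nat \<Rightarrow> (real^'n \<Rightarrow> complex) \<Rightarrow> real^'n \<Rightarrow> complex" where
  "avg j f x = integral\<^sup>L (Q j x) f"

lemma u_pos [simp]: "0 < u j" and u_Suc: "2 * u (Suc j) = u j"
  using t0_pos by (auto simp: u_def)

lemma u_neq_0 [simp]: "u j \<noteq> 0" and \<kappa>_neq_0 [simp]: "\<kappa> \<noteq> 0"
  using \<kappa>_pos t0_pos by (auto simp: u_def)

lemma ball_\<zeta>: "x \<in> \<Omega> \<Longrightarrow> ball (\<zeta> j x) (\<kappa> * u j) \<subseteq> \<Omega> \<inter> ball x (2 * u j)"
  unfolding u_def by (rule ball_\<zeta>_subset)

lemma \<Omega>_borel [measurable]: "\<Omega> \<in> sets borel" using open_\<Omega> by simp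

lemma ball_borel [measurable]: "ball (x :: real^'n) \<rho> \<in> sets borel" by simp

lemma emeasure_ball_powr: "0 < \<rho> \<Longrightarrow> emeasure lborel (ball (z :: real^'n) \<rho>) = ennreal (unit_ball_vol (real CARD('n)) * \<rho> powr real CARD('n))"
  by (simp add: emeasure_ball powr_realpow)

lemma \<kappa>u_pos [simp]: "0 < \<kappa> * u j" using \<kappa>_pos by simp

lemma prob_space_Q: "prob_space (Q j x)"
  unfolding Q_def by (rule prob_space_uniform_measure) (auto simp: emeasure_ball_powr)

lemma sets_Q [simp, measurable_cong]: "sets (Q j x) = sets borel"
  by (simp add: Q_def)

text \<open>The selected ball is replaced by all of \<Omega> near x. The resulting integral no
  longer involves the selection, so that Tonelli's theorem can later be applied in x; only the
  volume of the small ball survives in the factor.\<close>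

lemma nn_integral_Q_le:
  assumes "x \<in> \<Omega>" and [measurable]: "g \<in> borel_measurable borel" "h \<in> borel_measurable borel"
    and le: "\<And>y. y \<in> \<Omega> \<Longrightarrow> y \<in> ball x (2 * u j) \<Longrightarrow> g y \<le> h y"
  shows "(\<integral>\<^sup>+y. g y \<partial>Q j x) \<le> ennreal (1 / (unit_ball_vol (real CARD('n)) * (\<kappa> * u j) powr real CARD('n))) *
     (\<integral>\<^sup>+y. h y * indicator \<Omega> y * indicator (ball x (2 * u j)) y \<partial>lborel)"
proof -
  have c: "0 < unit_ball_vol (real CARD('n)) * (\<kappa> * u j) powr real CARD('n)" by simp
  have "(\<integral>\<^sup>+y. g y \<partial>Q j x) = (\<integral>\<^sup>+y. g y * indicator (ball (\<zeta> j x) (\<kappa> * u j)) y \<partial>lborel) / ennreal (unit_ball_vol (real CARD('n)) * (\<kappa> * u j) powr real CARD('n))"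
    unfolding Q_def by (subst nn_integral_uniform_measure) (auto simp: emeasure_ball_powr)
  also have "\<dots> = ennreal (1 / (unit_ball_vol (real CARD('n)) * (\<kappa> * u j) powr real CARD('n))) * (\<integral>\<^sup>+y. g y * indicator (ball (\<zeta> j x) (\<kappa> * u j)) y \<partial>lborel)"
    using c by (simp add: divide_ennreal_def inverse_ennreal mult.commute inverse_eq_divide)
  also have "\<dots> \<le> ennreal (1 / (unit_ball_vol (real CARD('n)) * (\<kappa> * u j) powr real CARD('n))) * (\<integral>\<^sup>+y. h y * indicator \<Omega> y * indicator (ball x (2 * u j)) y \<partial>lborel)"
  proof (intro mult_left_mono nn_integral_mono)
    fix y
    show "g y * indicator (ball (\<zeta> j x) (\<kappa> * u j)) y \<le> h y * indicator \<Omega> y * indicator (ball x (2 * u j)) y"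
    proof (cases "y \<in> ball (\<zeta> j x) (\<kappa> * u j)")
      case True
      then have "y \<in> \<Omega>" "y \<in> ball x (2 * u j)" using ball_\<zeta>[OF assms(1), of j] by blast+
      then show ?thesis using le[of y] True by simp
    qed simp
  qed simp
  finally show ?thesis .
qed

lemma nn_integral_Q_norm_le:
  assumes "x \<in> \<Omega>" and [measurable]: "f \<in> borel_measurable borel"
  shows "(\<integral>\<^sup>+y. ennreal (norm (f y)) \<partial>Q j x) \<le> ennreal (1 / (unit_ball_vol (real CARD('n)) * (\<kappa> * u j) powr real CARD('n))) *
     L1_int f"
proof -
  have "(\<integral>\<^sup>+y. ennreal (norm (f y)) \<partial>Q j x) \<le> ennreal (1 / (unit_ball_vol (real CARD('n)) * (\<kappa> * u j) powr real CARD('n))) *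
     (\<integral>\<^sup>+y. ennreal (norm (f y)) * indicator \<Omega> y * indicator (ball x (2 * u j)) y \<partial>lborel)"
    by (rule nn_integral_Q_le[OF assms(1)]) auto
  also have "\<dots> \<le> ennreal (1 / (unit_ball_vol (real CARD('n)) * (\<kappa> * u j) powr real CARD('n))) * L1_int f"
    by (intro mult_left_mono nn_integral_mono) (auto split: split_indicator)
  finally show ?thesis .
qed

lemma integrable_Q:
  assumes "x \<in> \<Omega>" "f \<in> borel_measurable borel" "L1_int f < \<infinity>"
  shows "integrable (Q j x) (f :: _ \<Rightarrow> complex)"
proof (rule integrableI_bounded)
  show "(\<integral>\<^sup>+y. ennreal (norm (f y)) \<partial>Q j x) < \<infinity>"
    using assms(3) by (intro le_less_trans[OF nn_integral_Q_norm_le[OF assms(1,2)]]) (simp add: ennreal_mult_less_top)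
qed (use assms in simp)

lemma norm_avg_le:
  assumes "x \<in> \<Omega>" "f \<in> borel_measurable borel" "L1_int f < \<infinity>"
  shows "ennreal (norm (avg j f x)) \<le> ennreal (1 / (unit_ball_vol (real CARD('n)) * (\<kappa> * u j) powr real CARD('n))) *
     L1_int f"
  unfolding avg_def
  by (rule order_trans[OF integral_norm_bound_ennreal[OF integrable_Q[OF assms]] nn_integral_Q_norm_le[OF assms(1,2)]])

lemma finite_range_avg: "finite (range (avg j f))"
proof -
  have "range (avg j f) \<subseteq> (\<lambda>z. integral\<^sup>L (uniform_measure lborel (ball z (\<kappa> * u j))) f) ` range (\<zeta> j)"
    by (auto simp: avg_def Q_def)
  then show ?thesis using finite_range_\<zeta> by (meson finite_imageI finite_subset)
qed

lemma avg_measurable [measurable]: "avg j f \<in> borel_measurable borel"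
proof -
  have "simple_function borel (\<zeta> j)"
    using finite_range_\<zeta>[of j] \<zeta>_measurable[of j] by (auto simp: simple_function_def intro!: measurable_sets_borel)
  then have "simple_function borel ((\<lambda>z. integral\<^sup>L (uniform_measure lborel (ball z (\<kappa> * u j))) f) \<circ> \<zeta> j)"
    by (rule simple_function_compose)
  then have "simple_function borel (avg j f)" by (simp add: avg_def[abs_def] Q_def comp_def)
  then show ?thesis by (rule borel_measurable_simple_function)
qed

text \<open>The inner integral of the Gagliardo energy without field, that is, the density of this
  energy at y.\<close>

definition gag :: "real \<Rightarrow> real \<Rightarrow> (real^'n \<Rightarrow> complex) \<Rightarrow> real^'n \<Rightarrow> ennreal" where
  "gag s r f y = (\<integral>\<^sup>+z. ennreal (mag_kernel (\<lambda>_. 0) s r f (y, z)) * indicator \<Omega> z \<partial>lborel)"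

lemma mag_kernel_pair_measurable [measurable]:
  assumes [measurable]: "A \<in> borel_measurable borel" "f \<in> borel_measurable borel"
  shows "mag_kernel A s p f \<in> borel_measurable (borel \<Otimes>\<^sub>M borel)"
  using mag_kernel_measurable[OF assms] by (simp add: borel_prod)

lemma gag_measurable [measurable]:
  assumes [measurable]: "f \<in> borel_measurable borel"
  shows "gag s r f \<in> borel_measurable borel"
  unfolding gag_def[abs_def] by measurable

lemma mag_int_eq_gag:
  assumes [measurable]: "f \<in> borel_measurable borel"
  shows "energy (\<lambda>_. 0) s r f = (\<integral>\<^sup>+y. gag s r f y * indicator \<Omega> y \<partial>lborel)"
proof -
  have "energy (\<lambda>_. 0) s r f
    = (\<integral>\<^sup>+y. \<integral>\<^sup>+z. ennreal (mag_kernel (\<lambda>_. 0) s r f (y, z)) * indicator (\<Omega> \<times> \<Omega>) (y, z) \<partial>lborel \<partial>lborel)"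
    unfolding mag_int_def lborel_prod[symmetric] by (subst lborel.nn_integral_fst) auto
  also have "\<dots> = (\<integral>\<^sup>+y. gag s r f y * indicator \<Omega> y \<partial>lborel)"
    unfolding gag_def by (intro nn_integral_cong) (auto simp: indicator_def)
  finally show ?thesis .
qed

lemma norm_diff_powr_le_kernel:
  fixes f :: "real^'n \<Rightarrow> complex"
  assumes "0 < \<rho>" "0 < s" "0 < r" "norm (y - z) \<le> \<rho>"
  shows "ennreal (norm (f y - f z) powr r) \<le> ennreal (\<rho> powr (real CARD('n) + s * r)) * ennreal (mag_kernel (\<lambda>_. 0) s r f (y, z))"
proof (cases "y = z")
  case False
  then have d: "0 < norm (y - z)" by simp
  have "norm (f y - f z) powr r = norm (y - z) powr (real CARD('n) + s * r) * mag_kernel (\<lambda>_. 0) s r f (y, z)"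
    using d by (simp add: mag_kernel_def)
  also have "\<dots> \<le> \<rho> powr (real CARD('n) + s * r) * mag_kernel (\<lambda>_. 0) s r f (y, z)"
    using assms by (intro mult_right_mono powr_mono2) auto
  finally show ?thesis by (simp add: ennreal_mult[symmetric] ennreal_leI)
qed simp

lemma nn_integral_Q_diff_le:
  assumes "x \<in> \<Omega>" and [measurable]: "f \<in> borel_measurable borel" and "0 < s" "0 < r"
    and y: "dist x y \<le> 2 * u j"
  shows "(\<integral>\<^sup>+z. ennreal (norm (f y - f z) powr r) \<partial>Q j x)
    \<le> ennreal ((4 * u j) powr (real CARD('n) + s * r) / (unit_ball_vol (real CARD('n)) * (\<kappa> * u j) powr real CARD('n))) * gag s r f y"
proof -
  have "(\<integral>\<^sup>+z. ennreal (norm (f y - f z) powr r) \<partial>Q j x) \<le> ennreal (1 / (unit_ball_vol (real CARD('n)) * (\<kappa> * u j) powr real CARD('n))) *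
     (\<integral>\<^sup>+z. (ennreal ((4 * u j) powr (real CARD('n) + s * r)) * ennreal (mag_kernel (\<lambda>_. 0) s r f (y, z)))
        * indicator \<Omega> z * indicator (ball x (2 * u j)) z \<partial>lborel)"
  proof (rule nn_integral_Q_le[OF assms(1)])
    fix z assume "z \<in> ball x (2 * u j)"
    \<comment> \<open>Both y and z are within \<open>2 * u j\<close> of x.\<close>
    then have "norm (y - z) \<le> 4 * u j" using y dist_triangle[of y z x] by (simp add: dist_norm norm_minus_commute)
    then show "ennreal (norm (f y - f z) powr r) \<le> ennreal ((4 * u j) powr (real CARD('n) + s * r)) * ennreal (mag_kernel (\<lambda>_. 0) s r f (y, z))"
      using assms by (intro norm_diff_powr_le_kernel) auto
  qed auto
  also have "\<dots> \<le> ennreal (1 / (unit_ball_vol (real CARD('n)) * (\<kappa> * u j) powr real CARD('n))) *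
     (\<integral>\<^sup>+z. ennreal ((4 * u j) powr (real CARD('n) + s * r)) * (ennreal (mag_kernel (\<lambda>_. 0) s r f (y, z)) * indicator \<Omega> z) \<partial>lborel)"
    by (intro mult_left_mono nn_integral_mono) (auto split: split_indicator)
  also have "\<dots> = ennreal (1 / (unit_ball_vol (real CARD('n)) * (\<kappa> * u j) powr real CARD('n))) * (ennreal ((4 * u j) powr (real CARD('n) + s * r)) * gag s r f y)"
    unfolding gag_def by (subst nn_integral_cmult) auto
  also have "\<dots> = ennreal ((4 * u j) powr (real CARD('n) + s * r) / (unit_ball_vol (real CARD('n)) * (\<kappa> * u j) powr real CARD('n))) * gag s r f y"
    by (simp add: mult.assoc[symmetric] ennreal_mult[symmetric] less_imp_le)
  finally show ?thesis .
qed

text \<open>Gives pointwise convergence of the averages: wherever the density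
  \<open>gag s r f x\<close> is finite, the right-hand side is of order
  \<open>u j powr (s * r)\<close>.\<close>

lemma avg_diff_le:
  assumes "x \<in> \<Omega>" and [measurable]: "f \<in> borel_measurable borel"
    and fin: "L1_int f < \<infinity>" and "0 < s" "1 \<le> r"
  shows "ennreal (norm (f x - avg j f x) powr r)
     \<le> ennreal (2 powr r * ((4 * u j) powr (real CARD('n) + s * r) / (unit_ball_vol (real CARD('n)) * (\<kappa> * u j) powr real CARD('n)))) * gag s r f x"
proof -
  interpret Q: prob_space "Q j x" by (rule prob_space_Q)
  have int: "integrable (Q j x) f" by (rule integrable_Q) fact+
  have "ennreal (norm (f x - avg j f x)) = ennreal (norm (integral\<^sup>L (Q j x) (\<lambda>y. f x - f y)))"
    using int by (simp add: avg_def Q.prob_space)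
  also have "\<dots> \<le> (\<integral>\<^sup>+y. ennreal (norm (f x - f y)) \<partial>Q j x)"
    using int by (intro integral_norm_bound_ennreal) auto
  finally have "ennpow (ennreal (norm (f x - avg j f x))) r \<le> ennpow (\<integral>\<^sup>+y. ennreal (norm (f x - f y)) \<partial>Q j x) r"
    using assms by (intro ennpow_mono) auto
  also have "\<dots> \<le> ennreal (2 powr r) * (\<integral>\<^sup>+y. ennpow (ennreal (norm (f x - f y))) r \<partial>Q j x)"
    using assms by (intro Q.ennpow_nn_integral_le) auto
  also have "\<dots> \<le> ennreal (2 powr r) * (ennreal ((4 * u j) powr (real CARD('n) + s * r) / (unit_ball_vol (real CARD('n)) * (\<kappa> * u j) powr real CARD('n))) * gag s r f x)"
    using nn_integral_Q_diff_le[OF assms(1,2,4), of r x j] assms(5)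
    by (intro mult_left_mono) (auto simp: ennpow_ennreal less_imp_le)
  also have "\<dots> = ennreal (2 powr r * ((4 * u j) powr (real CARD('n) + s * r) / (unit_ball_vol (real CARD('n)) * (\<kappa> * u j) powr real CARD('n)))) * gag s r f x"
    by (simp add: mult.assoc[symmetric] ennreal_mult[symmetric] less_imp_le)
  finally show ?thesis by (simp add: ennpow_ennreal)
qed

section \<open>Differences of averages at consecutive scales\<close>

definition loc_gag :: "real \<Rightarrow> real \<Rightarrow> (real^'n \<Rightarrow> complex) \<Rightarrow> nat \<Rightarrow> real^'n \<Rightarrow> ennreal" where
  "loc_gag s r f j x = (\<integral>\<^sup>+y. gag s r f y * indicator \<Omega> y * indicator (ball x (u j)) y \<partial>lborel)"

text \<open>Each factor \<open>2 powr r\<close> comes from one use of the Jensen substitute, the two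
  fractions from averaging at the scales j and j + 1. The whole is of order
  \<open>u j powr (s * r - real CARD('n))\<close>.\<close>

definition step_const :: "real \<Rightarrow> real \<Rightarrow> nat \<Rightarrow> real" where
  "step_const s r j = 2 powr r * 2 powr r * ((4 * u j) powr (real CARD('n) + s * r) / (unit_ball_vol (real CARD('n)) * (\<kappa> * u j) powr real CARD('n))) * (1 / (unit_ball_vol (real CARD('n)) * (\<kappa> * u (Suc j)) powr real CARD('n)))"

text \<open>A double average of f y - f z: the average in z at scale j is bounded by the density at
  y, and the average in y at scale j + 1 by the integral of that density near x. Since
  \<open>2 * u (Suc j) = u j\<close>, the latter is exactly \<open>loc_gag\<close>.\<close>

lemma avg_step_le:
  assumes "x \<in> \<Omega>" and [measurable]: "f \<in> borel_measurable borel"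
    and fin: "L1_int f < \<infinity>" and "0 < s" "1 \<le> r"
  shows "ennreal (norm (avg (Suc j) f x - avg j f x) powr r) \<le> ennreal (step_const s r j) * loc_gag s r f j x"
proof -
  define a where "a = (4 * u j) powr (real CARD('n) + s * r) / (unit_ball_vol (real CARD('n)) * (\<kappa> * u j) powr real CARD('n))"
  define b where "b = 1 / (unit_ball_vol (real CARD('n)) * (\<kappa> * u (Suc j)) powr real CARD('n))"
  have ab: "0 \<le> a" "0 \<le> b" by (auto simp: a_def b_def)
  interpret Q: prob_space "Q j x" by (rule prob_space_Q)
  interpret Q': prob_space "Q (Suc j) x" by (rule prob_space_Q)
  have int: "integrable (Q i x) f" for i by (rule integrable_Q) fact+
  let ?h = "\<lambda>y z. ennreal (norm (f y - f z))"
  have "ennreal (norm (avg (Suc j) f x - avg j f x)) \<le> (\<integral>\<^sup>+y. \<integral>\<^sup>+z. ?h y z \<partial>Q j x \<partial>Q (Suc j) x)"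
    unfolding avg_def by (intro norm_diff_integrals_le prob_space_Q int)
  then have "ennpow (ennreal (norm (avg (Suc j) f x - avg j f x))) r \<le> ennpow (\<integral>\<^sup>+y. \<integral>\<^sup>+z. ?h y z \<partial>Q j x \<partial>Q (Suc j) x) r"
    using assms by (intro ennpow_mono) auto
  also have "\<dots> \<le> ennreal (2 powr r) * (\<integral>\<^sup>+y. ennpow (\<integral>\<^sup>+z. ?h y z \<partial>Q j x) r \<partial>Q (Suc j) x)"
    using assms by (intro Q'.ennpow_nn_integral_le) auto
  also have "\<dots> \<le> ennreal (2 powr r) * (\<integral>\<^sup>+y. ennreal (2 powr r) * (\<integral>\<^sup>+z. ennpow (?h y z) r \<partial>Q j x) \<partial>Q (Suc j) x)"
    using assms by (intro mult_left_mono nn_integral_mono Q.ennpow_nn_integral_le) auto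
  also have "\<dots> \<le> ennreal (2 powr r) * (ennreal b * (\<integral>\<^sup>+y. (ennreal (2 powr r) * (ennreal a * gag s r f y)) * indicator \<Omega> y * indicator (ball x (2 * u (Suc j))) y \<partial>lborel))"
  proof (rule mult_left_mono)
    show "(\<integral>\<^sup>+y. ennreal (2 powr r) * (\<integral>\<^sup>+z. ennpow (?h y z) r \<partial>Q j x) \<partial>Q (Suc j) x)
      \<le> ennreal b * (\<integral>\<^sup>+y. (ennreal (2 powr r) * (ennreal a * gag s r f y)) * indicator \<Omega> y * indicator (ball x (2 * u (Suc j))) y \<partial>lborel)"
      unfolding b_def
    proof (rule nn_integral_Q_le[OF assms(1)])
      fix y assume "y \<in> ball x (2 * u (Suc j))"
      then have "dist x y \<le> 2 * u j" using u_Suc[of j] u_pos[of j] by (simp del: u_pos)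
      then show "ennreal (2 powr r) * (\<integral>\<^sup>+z. ennpow (?h y z) r \<partial>Q j x) \<le> ennreal (2 powr r) * (ennreal a * gag s r f y)"
        using nn_integral_Q_diff_le[OF assms(1,2,4), of r y j] assms(5)
        by (intro mult_left_mono) (auto simp: ennpow_ennreal a_def)
    qed auto
  qed simp
  also have "\<dots> = ennreal (2 powr r) * (ennreal b * (\<integral>\<^sup>+y. ennreal (2 powr r * a) * (gag s r f y * indicator \<Omega> y * indicator (ball x (u j)) y) \<partial>lborel))"
    using ab by (simp add: u_Suc ennreal_mult mult.assoc)
  also have "\<dots> = ennreal (2 powr r) * (ennreal b * (ennreal (2 powr r * a) * loc_gag s r f j x))"
    unfolding loc_gag_def by (subst nn_integral_cmult, measurable)
  also have "\<dots> = ennreal (step_const s r j) * loc_gag s r f j x"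
    unfolding step_const_def a_def[symmetric] b_def[symmetric] using ab
    by (simp add: ennreal_mult mult_ac)
  finally show ?thesis by (simp add: ennpow_ennreal)
qed

lemma loc_gag_le: 
  assumes "f \<in> borel_measurable borel"
  shows "loc_gag s r f j x \<le> energy (\<lambda>_. 0) s r f"
  unfolding loc_gag_def mag_int_eq_gag[OF assms] by (intro nn_integral_mono) (auto split: split_indicator)

lemma loc_gag_measurable [measurable]:
  assumes [measurable]: "f \<in> borel_measurable borel"
  shows "loc_gag s r f j \<in> borel_measurable borel"
proof -
  have "loc_gag s r f j = (\<lambda>x. \<integral>\<^sup>+y. gag s r f y * indicator \<Omega> y * (if dist x y < u j then 1 else 0) \<partial>lborel)"
    unfolding loc_gag_def[abs_def] by (intro ext nn_integral_cong) (auto simp: indicator_def)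
  also have "\<dots> \<in> borel_measurable borel" by measurable
  finally show ?thesis .
qed

text \<open>By Tonelli the density at y is counted for all x within distance \<open>u j\<close>. The
  volume gained here cancels the power \<open>- real CARD('n)\<close> of the scale in
  \<open>step_const\<close>, so that the step is smaller in L^r than the pointwise bound from
  \<open>loc_gag_le\<close> shows.\<close>

lemma nn_integral_loc_gag_le:
  assumes [measurable]: "f \<in> borel_measurable borel"
  shows "(\<integral>\<^sup>+x. loc_gag s r f j x \<partial>lborel) \<le> ennreal (unit_ball_vol (real CARD('n)) * u j powr real CARD('n)) * energy (\<lambda>_. 0) s r f"
proof -
  let ?i = "\<lambda>x y. (if dist x y < u j then 1 else 0 :: ennreal)"
  have "(\<integral>\<^sup>+x. loc_gag s r f j x \<partial>lborel) = (\<integral>\<^sup>+x. \<integral>\<^sup>+y. gag s r f y * indicator \<Omega> y * ?i x y \<partial>lborel \<partial>lborel)"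
    unfolding loc_gag_def by (intro nn_integral_cong) (auto simp: indicator_def)
  also have "\<dots> = (\<integral>\<^sup>+y. \<integral>\<^sup>+x. gag s r f y * indicator \<Omega> y * ?i x y \<partial>lborel \<partial>lborel)"
    by (rule lborel_pair.Fubini') measurable
  also have "\<dots> = (\<integral>\<^sup>+y. gag s r f y * indicator \<Omega> y * ennreal (unit_ball_vol (real CARD('n)) * u j powr real CARD('n)) \<partial>lborel)"
  proof (intro nn_integral_cong)
    fix y :: "real^'n"
    have "(\<integral>\<^sup>+x. ?i x y \<partial>lborel) = (\<integral>\<^sup>+x. indicator (ball y (u j)) x \<partial>lborel)"
      by (intro nn_integral_cong) (auto simp: indicator_def dist_commute)
    then have "(\<integral>\<^sup>+x. ?i x y \<partial>lborel) = ennreal (unit_ball_vol (real CARD('n)) * u j powr real CARD('n))" by (simp add: emeasure_ball_powr)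
    then show "(\<integral>\<^sup>+x. gag s r f y * indicator \<Omega> y * ?i x y \<partial>lborel) = gag s r f y * indicator \<Omega> y * ennreal (unit_ball_vol (real CARD('n)) * u j powr real CARD('n))"
      by (subst nn_integral_cmult) auto
  qed
  also have "\<dots> = ennreal (unit_ball_vol (real CARD('n)) * u j powr real CARD('n)) * energy (\<lambda>_. 0) s r f"
    unfolding mag_int_eq_gag[OF assms] by (subst nn_integral_multc) (auto simp: mult.commute)
  finally show ?thesis by simp
qed

end

section \<open>Completeness and interpolation\<close>

lemma Lnorm_fast_subsequence:
  assumes Cauchy: "\<And>e. 0 < e \<Longrightarrow> \<exists>n0. \<forall>m\<ge>n0. \<forall>n\<ge>n0. Lnorm \<Omega> q (\<lambda>x. F m x - F n x) \<le> ennreal e"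
  obtains k :: "nat \<Rightarrow> nat" where "strict_mono k"
    "\<And>m n. n \<le> m \<Longrightarrow> Lnorm \<Omega> q (\<lambda>x. F (k m) x - F (k n) x) \<le> ennreal ((1/2) ^ n)"
proof -
  have "\<forall>j. \<exists>n0. \<forall>m\<ge>n0. \<forall>n\<ge>n0. Lnorm \<Omega> q (\<lambda>x. F m x - F n x) \<le> ennreal ((1/2) ^ j)"
    using Cauchy by simp
  then obtain n0 where n0: "\<And>j m n. n0 j \<le> m \<Longrightarrow> n0 j \<le> n \<Longrightarrow> Lnorm \<Omega> q (\<lambda>x. F m x - F n x) \<le> ennreal ((1/2) ^ j)"
    by metis
  \<comment> \<open>The partial sum dominates all thresholds up to j, and the summand j makes k
    strictly increasing.\<close>
  define k where "k j = j + (\<Sum>i\<le>j. n0 i)" for j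
  have "strict_mono k" unfolding strict_mono_Suc_iff by (simp add: k_def)
  moreover have "n0 n \<le> k m" if "n \<le> m" for n m
    using that member_le_sum[of n "{..m}" n0] by (simp add: k_def trans_le_add2)
  then have "Lnorm \<Omega> q (\<lambda>x. F (k m) x - F (k n) x) \<le> ennreal ((1/2) ^ n)" if "n \<le> m" for m n
    using that by (intro n0) auto
  ultimately show thesis by (rule that)
qed

lemma borel_imp_lebesgue_on: "f \<in> borel_measurable borel \<Longrightarrow> f \<in> borel_measurable (lebesgue_on S)"
  by (intro measurable_restrict_space1 measurable_completion) simp

text \<open>The Riesz-Fischer argument for all q at once: on a set of finite measure the L^q norm
  controls the L^1 norm, so the increments of a fast subsequence are summable almost everywhere;
  \<open>Lnorm_Fatou\<close> then gives the rate.\<close>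

lemma Lnorm_complete:
  fixes F :: "nat \<Rightarrow> real^'n \<Rightarrow> complex"
  assumes q: "1 \<le> q" and \<Omega>: "\<Omega> \<in> sets lebesgue" "emeasure lebesgue \<Omega> < \<infinity>"
    and [measurable]: "\<And>n. F n \<in> borel_measurable borel"
    and Cauchy: "\<And>e. 0 < e \<Longrightarrow> \<exists>n0. \<forall>m\<ge>n0. \<forall>n\<ge>n0. Lnorm \<Omega> q (\<lambda>x. F m x - F n x) \<le> ennreal e"
  obtains k g where "strict_mono (k :: nat \<Rightarrow> nat)" "g \<in> borel_measurable borel"
    "AE x in lebesgue_on \<Omega>. (\<lambda>n. F (k n) x) \<longlonglongrightarrow> g x"
    "\<And>n. Lnorm \<Omega> q (\<lambda>x. g x - F (k n) x) \<le> ennreal ((1/2) ^ n)"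
proof -
  obtain k :: "nat \<Rightarrow> nat" where k: "strict_mono k"
    "\<And>m n. n \<le> m \<Longrightarrow> Lnorm \<Omega> q (\<lambda>x. F (k m) x - F (k n) x) \<le> ennreal ((1/2) ^ n)"
    using Lnorm_fast_subsequence[OF Cauchy] by metis
  define g where "g x = lim (\<lambda>n. F (k n) x)" for x
  have g[measurable]: "g \<in> borel_measurable borel" unfolding g_def[abs_def] by measurable
  have [measurable]: "F n \<in> borel_measurable (lebesgue_on \<Omega>)" "g \<in> borel_measurable (lebesgue_on \<Omega>)" for n
    by (auto intro!: borel_imp_lebesgue_on)
  define K where "K = emeasure lebesgue \<Omega> + 1"
  have K: "K < \<infinity>" using \<Omega> by (simp add: K_def ennreal_one_less_top)
  define d where "d n x = ennreal (norm (F (k (Suc n)) x - F (k n) x))" for n x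
  have "(\<integral>\<^sup>+x. (\<Sum>n. d n x) \<partial>lebesgue_on \<Omega>) = (\<Sum>n. \<integral>\<^sup>+x. d n x \<partial>lebesgue_on \<Omega>)"
    unfolding d_def by (intro nn_integral_suminf) measurable
  also have "\<dots> \<le> (\<Sum>n. K * ennreal ((1/2) ^ n))"
  proof (intro suminf_le allI)
    fix n
    have "(\<integral>\<^sup>+x. d n x \<partial>lebesgue_on \<Omega>) \<le> K * Lnorm \<Omega> q (\<lambda>x. F (k (Suc n)) x - F (k n) x)"
      unfolding d_def K_def using \<Omega> q by (intro L1_le_Lnorm) auto
    also have "\<dots> \<le> K * ennreal ((1/2) ^ n)"
      using k(2)[of n "Suc n"] by (intro mult_left_mono) auto
    finally show "(\<integral>\<^sup>+x. d n x \<partial>lebesgue_on \<Omega>) \<le> K * ennreal ((1/2) ^ n)" .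
  qed auto
  also have "\<dots> = K * (\<Sum>n. ennreal ((1/2) ^ n))" by simp
  also have "(\<Sum>n. ennreal ((1/2) ^ n)) = ennreal (\<Sum>n. (1/2) ^ n)"
    by (intro suminf_ennreal2 summable_geometric) auto
  also have "K * \<dots> < \<infinity>" using K by (simp add: ennreal_mult_less_top)
  finally have "AE x in lebesgue_on \<Omega>. (\<Sum>n. d n x) \<noteq> \<infinity>"
    by (intro nn_integral_PInf_AE) (auto simp: d_def)
  then have conv: "AE x in lebesgue_on \<Omega>. (\<lambda>n. F (k n) x) \<longlonglongrightarrow> g x"
  proof eventually_elim
    case (elim x)
    then have "summable (\<lambda>n. norm (F (k (Suc n)) x - F (k n) x))"
      by (intro summable_suminf_not_top) (auto simp: d_def)
    then have "summable (\<lambda>n. F (k (Suc n)) x - F (k n) x)" by (rule summable_norm_cancel)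
    then have "convergent (\<lambda>n. \<Sum>i<n. F (k (Suc i)) x - F (k i) x)" by (rule summable_iff_convergent[THEN iffD1])
    then have "convergent (\<lambda>n. (F (k n) x - F (k 0) x))"
      by (simp add: sum_lessThan_telescope[of "\<lambda>n. F (k n) x"])
    then have "convergent (\<lambda>n. (F (k n) x - F (k 0) x) + F (k 0) x)" by (intro convergent_add convergent_const)
    then have "convergent (\<lambda>n. F (k n) x)" by simp
    then show ?case unfolding g_def by (rule convergent_LIMSEQ_iff[THEN iffD1])
  qed
  have "Lnorm \<Omega> q (\<lambda>x. g x - F (k n) x) \<le> ennreal ((1/2) ^ n)" for n
  proof (rule Lnorm_Fatou[OF q])
    show "AE x in lebesgue_on \<Omega>. (\<lambda>m. F (k m) x - F (k n) x) \<longlonglongrightarrow> g x - F (k n) x"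
      using conv by eventually_elim (intro tendsto_diff tendsto_const)
    show "\<forall>\<^sub>F m in sequentially. Lnorm \<Omega> q (\<lambda>x. F (k m) x - F (k n) x) \<le> ennreal ((1/2) ^ n)"
      unfolding eventually_sequentially using k(2) by blast
  qed measurable
  with k(1) g conv show thesis by (rule that)
qed

text \<open>
  The last inequality is \<open>Q < n r / (n - s r)\<close>, in a form that is meaningful for \<open>s r \<ge> n\<close> and
  visibly an open condition on \<open>s\<close>.
\<close>

definition subcritical :: "nat \<Rightarrow> ennreal \<Rightarrow> real \<Rightarrow> real \<Rightarrow> bool" where
  "subcritical n q s r \<longleftrightarrow> (q = \<infinity> \<and> s * r > real n)
     \<or> (\<exists>Q\<ge>1. q = ennreal Q \<and> (Q \<le> r \<or> real n / Q + s - real n / r > 0))"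

text \<open>Interpolates between a pointwise bound of order v^(s - n/r) and an L^r bound of order
  v^s. For Q > r the surplus Q - r is paid pointwise, and subcriticality says that the resulting
  exponent n/Q + s - n/r is positive. For Q \<le> r the L^r bound suffices because the measure is
  finite, and for q = \<infinity> the pointwise bound does.\<close>

lemma Lnorm_interpolate:
  assumes \<Omega>: "\<Omega> \<in> sets lebesgue" "emeasure lebesgue \<Omega> < \<infinity>"
    and sub: "subcritical n q s r" and s: "0 < s" and r: "1 \<le> r" and b: "0 \<le> b" "0 \<le> b'"
  obtains C a where "0 \<le> C" "0 < a"
    "\<And>f v. f \<in> borel_measurable (lebesgue_on \<Omega>) \<Longrightarrow> 0 < v \<Longrightarrow>
      (\<And>x. x \<in> \<Omega> \<Longrightarrow> norm (f x) powr r \<le> b * v powr (s * r - real n)) \<Longrightarrow>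
      (\<integral>\<^sup>+x. ennreal (norm (f x) powr r) \<partial>lebesgue_on \<Omega>) \<le> ennreal (b' * v powr (s * r)) \<Longrightarrow>
      Lnorm \<Omega> q f \<le> ennreal (C * v powr a)"
proof -
  consider (sup) "q = \<infinity>" "real n < s * r" | (low) Q where "1 \<le> Q" "q = ennreal Q" "Q \<le> r"
    | (high) Q where "1 \<le> Q" "q = ennreal Q" "r < Q" "0 < real n / Q + s - real n / r"
    using sub unfolding subcritical_def by fastforce
  then show thesis
  proof cases
  case sup
  note q = sup(1) and sr = sup(2)
  show thesis
  proof (rule that[of "b powr (1/r)" "s - real n / r"])
    show "0 < s - real n / r" using sr r by (simp add: field_simps)
    fix f :: "real^'a \<Rightarrow> complex" and v :: real
    assume f: "f \<in> borel_measurable (lebesgue_on \<Omega>)" and v: "0 < v"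
      and sup: "\<And>x. x \<in> \<Omega> \<Longrightarrow> norm (f x) powr r \<le> b * v powr (s * r - real n)"
    have "norm (f x) \<le> b powr (1/r) * v powr (s - real n / r)" if "x \<in> \<Omega>" for x
    proof -
      have "norm (f x) = (norm (f x) powr r) powr (1/r)" using r by (simp add: powr_powr)
      also have "\<dots> \<le> (b * v powr (s * r - real n)) powr (1/r)" using sup[OF that] r by (intro powr_mono2) auto
      also have "\<dots> = b powr (1/r) * v powr ((s * r - real n) * (1/r))" using b v by (simp add: powr_mult powr_powr)
      also have "(s * r - real n) * (1/r) = s - real n / r" using r by (simp add: field_simps)
      finally show ?thesis .
    qed
    then show "Lnorm \<Omega> q f \<le> ennreal (b powr (1/r) * v powr (s - real n / r))"
      unfolding q using f \<Omega> by (subst Lnorm_top_le_iff) (auto simp: AE_lebesgue_on_iff intro!: ennreal_leI)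
  qed simp
next
  case low
  note Q = low
  define w where "w = measure lebesgue \<Omega>"
  have w: "emeasure lebesgue \<Omega> = ennreal w" "0 \<le> w" using \<Omega> by (auto simp: w_def emeasure_eq_ennreal_measure)
  show thesis
  proof (rule that[of "(w + b') powr (1/Q)" s])
    fix f :: "real^'a \<Rightarrow> complex" and v :: real
    assume [measurable]: "f \<in> borel_measurable (lebesgue_on \<Omega>)" and v: "0 < v"
      and int: "(\<integral>\<^sup>+x. ennreal (norm (f x) powr r) \<partial>lebesgue_on \<Omega>) \<le> ennreal (b' * v powr (s * r))"
    \<comment> \<open>This level balances the two terms of \<open>powr_le_split\<close>: after
      integration both are multiples of \<open>l powr Q\<close>.\<close>
    define l where "l = v powr s"
    have l: "0 < l" using v by (simp add: l_def)
    have "(\<integral>\<^sup>+x. ennreal (norm (f x) powr Q) \<partial>lebesgue_on \<Omega>)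
       \<le> (\<integral>\<^sup>+x. ennreal (l powr Q) + ennreal (l powr (Q - r)) * ennreal (norm (f x) powr r) \<partial>lebesgue_on \<Omega>)"
      using powr_le_split[OF l, of "norm (f x)" Q r for x] Q
      by (intro nn_integral_mono) (auto simp: ennreal_mult[symmetric] ennreal_plus[symmetric] intro!: ennreal_leI simp del: ennreal_plus)
    also have "\<dots> = ennreal (l powr Q) * ennreal w + ennreal (l powr (Q - r)) * (\<integral>\<^sup>+x. ennreal (norm (f x) powr r) \<partial>lebesgue_on \<Omega>)"
      using \<Omega> w by (simp add: nn_integral_add nn_integral_cmult emeasure_restrict_space)
    also have "\<dots> \<le> ennreal (l powr Q) * ennreal w + ennreal (l powr (Q - r)) * ennreal (b' * v powr (s * r))"
      by (intro add_mono mult_left_mono int) auto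
    also have "\<dots> = ennreal (l powr Q * w + l powr (Q - r) * (b' * v powr (s * r)))"
      using w b by (simp add: ennreal_mult[symmetric] ennreal_plus[symmetric] del: ennreal_plus)
    also have "l powr Q * w + l powr (Q - r) * (b' * v powr (s * r)) = (w + b') * l powr Q"
    proof -
      have "l powr (Q - r) * v powr (s * r) = l powr Q"
        using l v by (simp add: powr_diff powr_powr[symmetric] l_def[symmetric])
      then show ?thesis by (simp add: algebra_simps)
    qed
    also have "\<dots> = ((w + b') powr (1/Q) * v powr s) powr Q"
      using Q w b l by (simp add: powr_mult powr_powr l_def)
    finally show "Lnorm \<Omega> q f \<le> ennreal ((w + b') powr (1/Q) * v powr s)"
      unfolding Q(2) using Q(1) by (subst Lnorm_real_le_iff) (auto simp: ennpow_ennreal)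
  qed (use s in auto)
next
  case high
  note Q = high(1,2,4)
    define a where "a = real n / Q + s - real n / r"
    define e where "e = (Q - r) / r"
    have e: "0 \<le> e" "r * e = Q - r" using high(3) r by (auto simp: e_def)
    show ?thesis
    proof (rule that[of "(b powr e * b') powr (1/Q)" a])
      show "0 < a" using Q by (simp add: a_def)
      fix f :: "real^'a \<Rightarrow> complex" and v :: real
      assume [measurable]: "f \<in> borel_measurable (lebesgue_on \<Omega>)" and v: "0 < v"
        and sup: "\<And>x. x \<in> \<Omega> \<Longrightarrow> norm (f x) powr r \<le> b * v powr (s * r - real n)"
        and int: "(\<integral>\<^sup>+x. ennreal (norm (f x) powr r) \<partial>lebesgue_on \<Omega>) \<le> ennreal (b' * v powr (s * r))"
      define M where "M = (b * v powr (s * r - real n)) powr e"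
      have M: "M = b powr e * v powr ((s * r - real n) * e)" using b v by (simp add: M_def powr_mult powr_powr)
      have "(\<integral>\<^sup>+x. ennreal (norm (f x) powr Q) \<partial>lebesgue_on \<Omega>)
         \<le> (\<integral>\<^sup>+x. ennreal M * ennreal (norm (f x) powr r) \<partial>lebesgue_on \<Omega>)"
      proof (intro nn_integral_mono)
        fix x assume "x \<in> space (lebesgue_on \<Omega>)"
        then have x: "x \<in> \<Omega>" by simp
        have "norm (f x) powr Q = (norm (f x) powr r) powr e * norm (f x) powr r"
          using e by (simp add: powr_powr powr_add[symmetric])
        also have "\<dots> \<le> M * norm (f x) powr r"
          unfolding M_def using sup[OF x] e by (intro mult_right_mono powr_mono2) auto
        finally show "ennreal (norm (f x) powr Q) \<le> ennreal M * ennreal (norm (f x) powr r)"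
          by (simp add: ennreal_mult[symmetric] M_def ennreal_leI)
      qed
      also have "\<dots> = ennreal M * (\<integral>\<^sup>+x. ennreal (norm (f x) powr r) \<partial>lebesgue_on \<Omega>)"
        by (intro nn_integral_cmult) auto
      also have "\<dots> \<le> ennreal M * ennreal (b' * v powr (s * r))" by (intro mult_left_mono int) auto
      also have "\<dots> = ennreal (M * (b' * v powr (s * r)))" using b by (simp add: ennreal_mult[symmetric] M_def)
      also have "M * (b' * v powr (s * r)) = (b powr e * b') * v powr ((s * r - real n) * e + s * r)"
        by (simp add: M powr_add)
      also have "(s * r - real n) * e + s * r = a * Q"
        using Q(1) r by (simp add: a_def e_def field_simps)
      also have "(b powr e * b') * v powr (a * Q) = ((b powr e * b') powr (1/Q) * v powr a) powr Q"
        using Q b by (simp add: powr_mult powr_powr)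
      finally show "Lnorm \<Omega> q f \<le> ennreal ((b powr e * b') powr (1/Q) * v powr a)"
        unfolding Q(2) using Q(1) by (subst Lnorm_real_le_iff) (auto simp: ennpow_ennreal)
    qed simp
  qed
qed

section \<open>Compactness of fractional Sobolev balls\<close>

context corkscrew_scales begin

lemma \<Omega>_lebesgue: "\<Omega> \<in> sets lebesgue" using open_\<Omega> by simp

lemma emeasure_\<Omega>: "emeasure lebesgue \<Omega> < \<infinity>"
  using emeasure_bounded_finite[OF bounded_\<Omega>] open_\<Omega> by simp

lemma nn_integral_\<Omega>: "(\<integral>\<^sup>+x. h x \<partial>lebesgue_on \<Omega>) = (\<integral>\<^sup>+x. h x * indicator \<Omega> x \<partial>lborel)"
  by (rule nn_integral_lebesgue_on[OF \<Omega>_lebesgue])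

lemma powr_dim_cancel:
  assumes "0 < v"
  shows "(4 * v) powr (real CARD('n) + e) / (unit_ball_vol (real CARD('n)) * (\<kappa> * v) powr real CARD('n))
    = 4 powr (real CARD('n) + e) / (unit_ball_vol (real CARD('n)) * \<kappa> powr real CARD('n)) * v powr e"
  using assms \<kappa>_pos by (simp add: powr_mult powr_add)

lemma step_const_eq:
  obtains C where "0 < C" "\<And>j. step_const s r j = C * u j powr (s * r - real CARD('n))"
proof
  define B where "B = 4 powr (real CARD('n) + s * r) / (unit_ball_vol (real CARD('n)) * \<kappa> powr real CARD('n))"
  define B' where "B' = 2 powr real CARD('n) / (unit_ball_vol (real CARD('n)) * \<kappa> powr real CARD('n))"
  show "0 < 2 powr r * 2 powr r * B * B'" using \<kappa>_pos by (simp add: B_def B'_def)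
  fix j
  have eq: "u (Suc j) = u j / 2" using u_Suc[of j] by simp
  have "1 / (unit_ball_vol (real CARD('n)) * (\<kappa> * u (Suc j)) powr real CARD('n)) = B' * u j powr (- real CARD('n))"
    unfolding eq using \<kappa>_pos by (simp add: B'_def powr_mult powr_divide powr_minus_divide)
  then show "step_const s r j = 2 powr r * 2 powr r * B * B' * u j powr (s * r - real CARD('n))"
    unfolding step_const_def powr_dim_cancel[OF u_pos] B_def[symmetric]
    by (simp add: powr_add[symmetric])
qed

text \<open>\<open>Lnorm_interpolate\<close> at v = \<open>u j\<close>: the pointwise bound holds
  because the local energy never exceeds the total one, the L^r bound because integrating it gains
  the volume of a ball.\<close>

lemma Lnorm_avg_step:
  assumes q: "1 \<le> q" and sub: "subcritical CARD('n) q s r" and s: "0 < s" and r: "1 \<le> r" and B: "0 \<le> B"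
  obtains C a where "0 \<le> C" "0 < a"
    "\<And>f j. f \<in> borel_measurable borel \<Longrightarrow> L1_int f < \<infinity> \<Longrightarrow>
      energy (\<lambda>_. 0) s r f \<le> ennreal B \<Longrightarrow>
      Lnorm \<Omega> q (\<lambda>x. avg (Suc j) f x - avg j f x) \<le> ennreal (C * u j powr a)"
proof -
  obtain c where c: "0 < c" "\<And>j. step_const s r j = c * u j powr (s * r - real CARD('n))"
    using step_const_eq[of s r] by blast
  have cB: "0 \<le> c * B" "0 \<le> c * unit_ball_vol (real CARD('n)) * B" using c B by auto
  obtain C a where C: "0 \<le> C" "0 < a" and le: "\<And>f v. f \<in> borel_measurable (lebesgue_on \<Omega>) \<Longrightarrow> 0 < v \<Longrightarrow>
      (\<And>x. x \<in> \<Omega> \<Longrightarrow> norm (f x) powr r \<le> (c * B) * v powr (s * r - real CARD('n))) \<Longrightarrow>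
      (\<integral>\<^sup>+x. ennreal (norm (f x) powr r) \<partial>lebesgue_on \<Omega>) \<le> ennreal ((c * unit_ball_vol (real CARD('n)) * B) * v powr (s * r)) \<Longrightarrow>
      Lnorm \<Omega> q f \<le> ennreal (C * v powr a)"
    using Lnorm_interpolate[OF \<Omega>_lebesgue emeasure_\<Omega> sub s r, of "c * B" "c * unit_ball_vol (real CARD('n)) * B"] cB
    by blast
  have "Lnorm \<Omega> q (\<lambda>x. avg (Suc j) f x - avg j f x) \<le> ennreal (C * u j powr a)"
    if [measurable]: "f \<in> borel_measurable borel" and L1: "L1_int f < \<infinity>"
      and G: "energy (\<lambda>_. 0) s r f \<le> ennreal B" for f j
  proof (rule le)
    show "(\<lambda>x. avg (Suc j) f x - avg j f x) \<in> borel_measurable (lebesgue_on \<Omega>)"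
      by (intro borel_imp_lebesgue_on borel_measurable_diff avg_measurable)
    let ?D = "\<lambda>x. norm (avg (Suc j) f x - avg j f x) powr r"
    have step: "ennreal (?D x) \<le> ennreal (step_const s r j) * loc_gag s r f j x" if "x \<in> \<Omega>" for x
      using that L1 s r by (intro avg_step_le) auto
    fix x assume "x \<in> \<Omega>"
    note step[OF this]
    also have "ennreal (step_const s r j) * loc_gag s r f j x \<le> ennreal (step_const s r j) * ennreal B"
      by (intro mult_left_mono order_trans[OF loc_gag_le G]) auto
    also have "\<dots> = ennreal (c * B * u j powr (s * r - real CARD('n)))"
      using c B by (simp add: ennreal_mult[symmetric] mult_ac)
    finally show "?D x \<le> c * B * u j powr (s * r - real CARD('n))"
      using c B by (subst (asm) ennreal_le_iff) auto
  next
    let ?D = "\<lambda>x. norm (avg (Suc j) f x - avg j f x) powr r"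
    have "(\<integral>\<^sup>+x. ennreal (?D x) \<partial>lebesgue_on \<Omega>) \<le> (\<integral>\<^sup>+x. ennreal (step_const s r j) * loc_gag s r f j x \<partial>lborel)"
      unfolding nn_integral_\<Omega>
    proof (intro nn_integral_mono)
      fix x
      show "ennreal (?D x) * indicator \<Omega> x \<le> ennreal (step_const s r j) * loc_gag s r f j x"
        using avg_step_le[of x f s r j] L1 s r by (cases "x \<in> \<Omega>") auto
    qed
    also have "\<dots> = ennreal (step_const s r j) * (\<integral>\<^sup>+x. loc_gag s r f j x \<partial>lborel)"
      by (rule nn_integral_cmult) measurable
    also have "\<dots> \<le> ennreal (step_const s r j) * (ennreal (unit_ball_vol (real CARD('n)) * u j powr real CARD('n)) * ennreal B)"
      by (intro mult_left_mono order_trans[OF nn_integral_loc_gag_le] G) auto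
    also have "\<dots> = ennreal (step_const s r j * (unit_ball_vol (real CARD('n)) * u j powr real CARD('n) * B))"
      using c B by (simp add: ennreal_mult[symmetric])
    also have "step_const s r j * (unit_ball_vol (real CARD('n)) * u j powr real CARD('n) * B)
       = c * unit_ball_vol (real CARD('n)) * B * u j powr (s * r)"
      unfolding c by (simp add: powr_diff)
    finally show "(\<integral>\<^sup>+x. ennreal (?D x) \<partial>lebesgue_on \<Omega>) \<le> ennreal (c * unit_ball_vol (real CARD('n)) * B * u j powr (s * r))" .
  qed simp
  with C show thesis by (rule that)
qed

lemma u_powr_Suc: "u (Suc j) powr a = 2 powr (- a) * u j powr a"
proof -
  have eq: "u (Suc j) = u j / 2" using u_Suc[of j] by simp
  show ?thesis unfolding eq by (simp add: powr_divide powr_minus_divide)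
qed

lemma u_powr_tendsto_0: "0 < a \<Longrightarrow> (\<lambda>j. u j powr a) \<longlonglongrightarrow> 0"
proof -
  assume a: "0 < a"
  have "u \<longlonglongrightarrow> 0" unfolding u_def by (real_asymp)
  then show ?thesis using a by (intro tendsto_zero_powrI) (auto simp: less_imp_le)
qed

text \<open>Finite energy takes the place of Lebesgue differentiation: the density
  \<open>gag\<close> is finite almost everywhere, and there \<open>avg_diff_le\<close> forces
  convergence.\<close>

lemma AE_avg_tendsto:
  assumes [measurable]: "f \<in> borel_measurable borel" and L1: "L1_int f < \<infinity>"
    and G: "energy (\<lambda>_. 0) s r f < \<infinity>" and s: "0 < s" and r: "1 \<le> r"
  shows "AE x in lebesgue_on \<Omega>. (\<lambda>j. avg j f x) \<longlonglongrightarrow> f x"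
proof -
  have "AE x in lborel. gag s r f x * indicator \<Omega> x \<noteq> \<infinity>"
    using G unfolding mag_int_eq_gag[OF assms(1)] by (intro nn_integral_PInf_AE) auto
  then have "AE x in lborel. x \<in> \<Omega> \<longrightarrow> (\<lambda>j. avg j f x) \<longlonglongrightarrow> f x"
  proof eventually_elim
    case (elim x)
    show ?case
    proof
      assume x: "x \<in> \<Omega>"
      then obtain g where g: "gag s r f x = ennreal g" "0 \<le> g" using elim by (cases "gag s r f x") auto
      define B where "B = 2 powr r * (4 powr (real CARD('n) + s * r) / (unit_ball_vol (real CARD('n)) * \<kappa> powr real CARD('n)))"
      have B: "0 \<le> B" by (simp add: B_def)
      have bd: "norm (f x - avg j f x) powr r \<le> B * g * u j powr (s * r)" for j
      proof -
        have "ennreal (norm (f x - avg j f x) powr r) \<le> ennreal (B * u j powr (s * r)) * ennreal g"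
          using avg_diff_le[OF x assms(1) L1 s r, of j] unfolding powr_dim_cancel[OF u_pos] g B_def by (simp only: mult.assoc)
        also have "\<dots> = ennreal (B * g * u j powr (s * r))" using B g by (simp add: ennreal_mult[symmetric] mult_ac)
        finally show ?thesis using B g by (subst (asm) ennreal_le_iff) auto
      qed
      have "(\<lambda>j. B * g * u j powr (s * r)) \<longlonglongrightarrow> B * g * 0"
        using s r by (intro tendsto_mult_left u_powr_tendsto_0) auto
      then have lim0: "(\<lambda>j. B * g * u j powr (s * r)) \<longlonglongrightarrow> 0" by simp
      have "(\<lambda>j. norm (f x - avg j f x) powr r) \<longlonglongrightarrow> 0"
      proof (rule tendsto_sandwich[OF _ _ tendsto_const lim0])
        show "\<forall>\<^sub>F j in sequentially. norm (f x - avg j f x) powr r \<le> B * g * u j powr (s * r)"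
          by (intro always_eventually allI bd)
      qed simp
      then have "(\<lambda>j. (norm (f x - avg j f x) powr r) powr (1/r)) \<longlonglongrightarrow> 0"
        by (rule tendsto_zero_powrI[OF _ tendsto_const]) (use r in \<open>simp_all\<close>)
      then have "(\<lambda>j. norm (f x - avg j f x)) \<longlonglongrightarrow> 0" using r by (simp add: powr_powr)
      then have "(\<lambda>j. f x - avg j f x) \<longlonglongrightarrow> 0" by (rule tendsto_norm_zero_cancel)
      then have "(\<lambda>j. f x - (f x - avg j f x)) \<longlonglongrightarrow> f x - 0" by (intro tendsto_diff tendsto_const)
      then show "(\<lambda>j. avg j f x) \<longlonglongrightarrow> f x" by simp
    qed
  qed
  then show ?thesis using AE_lebesgue_on_iff[OF \<Omega>_lebesgue] by blast
qed

lemma avg_lebesgue_on [measurable]: "avg j f \<in> borel_measurable (lebesgue_on \<Omega>)"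
  by (intro borel_imp_lebesgue_on avg_measurable)

text \<open>The steps are summed as a geometric series of ratio l = 2^(-a), hence the constant C /
  (1 - l), and \<open>Lnorm_Fatou\<close> passes from the averages to f. The constants do not depend
  on f, which \<open>compactness\<close> requires.\<close>

lemma Lnorm_avg_approx:
  assumes q: "1 \<le> q" and sub: "subcritical CARD('n) q s r" and s: "0 < s" and r: "1 \<le> r" and B: "0 \<le> B"
  obtains C a where "0 \<le> C" "0 < a"
    "\<And>f j. f \<in> borel_measurable borel \<Longrightarrow> L1_int f < \<infinity> \<Longrightarrow>
      energy (\<lambda>_. 0) s r f \<le> ennreal B \<Longrightarrow>
      Lnorm \<Omega> q (\<lambda>x. f x - avg j f x) \<le> ennreal (C * u j powr a)"
proof -
  obtain C a where C: "0 \<le> C" "0 < a" and step: "\<And>f j. f \<in> borel_measurable borel \<Longrightarrow> L1_int f < \<infinity> \<Longrightarrow>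
      energy (\<lambda>_. 0) s r f \<le> ennreal B \<Longrightarrow>
      Lnorm \<Omega> q (\<lambda>x. avg (Suc j) f x - avg j f x) \<le> ennreal (C * u j powr a)"
    using Lnorm_avg_step[OF assms] by blast
  define l where "l = 2 powr (- a)"
  have l: "0 < l" "l < 1" using C(2) by (auto simp: l_def powr_minus_divide)
  define C' where "C' = C / (1 - l)"
  have C': "0 \<le> C'" "C = C' * (1 - l)" using C l by (auto simp: C'_def)
  have "Lnorm \<Omega> q (\<lambda>x. f x - avg j f x) \<le> ennreal (C' * u j powr a)"
    if f: "f \<in> borel_measurable borel" and L1: "L1_int f < \<infinity>"
      and G: "energy (\<lambda>_. 0) s r f \<le> ennreal B" for f j
  proof -
    \<comment> \<open>The subtracted last term closes the induction: as C = C' (1 - l), one step is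
      C' times the decrease of \<open>u j powr a\<close>. Monotonicity is carried along to keep the
      difference nonnegative under \<open>ennreal\<close>.\<close>
    have tel: "Lnorm \<Omega> q (\<lambda>x. avg (j + m) f x - avg j f x) \<le> ennreal (C' * (u j powr a - u (j + m) powr a)) \<and> u (j + m) powr a \<le> u j powr a" for m
    proof (induction m)
      case 0
      have "Lnorm \<Omega> q (\<lambda>_. 0) = 0" by (subst Lnorm_eq_0_iff[OF q]) auto
      then show ?case by simp
    next
      case (Suc m)
      have dec: "u (Suc (j + m)) powr a \<le> u (j + m) powr a"
        using l by (simp add: u_powr_Suc l_def[symmetric] mult_left_le_one_le)
      have "Lnorm \<Omega> q (\<lambda>x. avg (j + Suc m) f x - avg j f x)
        \<le> Lnorm \<Omega> q (\<lambda>x. avg (Suc (j + m)) f x - avg (j + m) f x) + Lnorm \<Omega> q (\<lambda>x. avg (j + m) f x - avg j f x)"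
        using Lnorm_minus_triangle[OF q, of "avg (Suc (j+m)) f" \<Omega> "avg (j+m) f" "avg j f"] by simp
      also have "\<dots> \<le> ennreal (C * u (j + m) powr a) + ennreal (C' * (u j powr a - u (j + m) powr a))"
        using Suc by (intro add_mono step f L1 G) auto
      also have "\<dots> = ennreal (C * u (j + m) powr a + C' * (u j powr a - u (j + m) powr a))"
        using C C' Suc by (intro ennreal_plus[symmetric]) auto
      also have "C * u (j + m) powr a + C' * (u j powr a - u (j + m) powr a) = C' * (u j powr a - u (j + Suc m) powr a)"
        unfolding C'(2) by (simp add: u_powr_Suc l_def[symmetric] algebra_simps)
      finally show ?case using dec Suc by auto
    qed
    show ?thesis
    proof (rule Lnorm_Fatou[OF q])
      have "energy (\<lambda>_. 0) s r f < \<infinity>" using G by (rule le_less_trans) simp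
      from AE_avg_tendsto[OF f L1 this s r]
      show "AE x in lebesgue_on \<Omega>. (\<lambda>m. avg m f x - avg j f x) \<longlonglongrightarrow> f x - avg j f x"
        by eventually_elim (intro tendsto_diff tendsto_const)
      have "Lnorm \<Omega> q (\<lambda>x. avg m f x - avg j f x) \<le> ennreal (C' * u j powr a)" if "j \<le> m" for m
      proof -
        have "Lnorm \<Omega> q (\<lambda>x. avg m f x - avg j f x) \<le> ennreal (C' * (u j powr a - u m powr a))"
          using tel[of "m - j"] that by simp
        also have "\<dots> \<le> ennreal (C' * u j powr a)" using C' by (intro ennreal_leI mult_left_mono) auto
        finally show ?thesis .
      qed
      then show "\<forall>\<^sub>F m in sequentially. Lnorm \<Omega> q (\<lambda>x. avg m f x - avg j f x) \<le> ennreal (C' * u j powr a)"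
        unfolding eventually_sequentially by blast
    qed (use f in \<open>auto intro!: borel_measurable_diff borel_imp_lebesgue_on\<close>)
  qed
  with C'(1) C(2) show thesis by (rule that)
qed

text \<open>\<open>avg 0 f\<close> takes finitely many values and is therefore bounded, and f
  differs from it by a function of finite norm.\<close>

lemma Lnorm_finite:
  assumes q: "1 \<le> q" and sub: "subcritical CARD('n) q s r" and s: "0 < s" and r: "1 \<le> r"
    and f: "f \<in> borel_measurable borel" and L1: "L1_int f < \<infinity>"
    and G: "energy (\<lambda>_. 0) s r f < \<infinity>"
  shows "Lnorm \<Omega> q f < \<infinity>"
proof -
  obtain B where B: "0 \<le> B" "energy (\<lambda>_. 0) s r f = ennreal B"
    using G by (cases "energy (\<lambda>_. 0) s r f") auto
  have 1: "Lnorm \<Omega> q (\<lambda>x. f x - avg 0 f x) < \<infinity>"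
  proof (rule Lnorm_avg_approx[OF q sub s r B(1)])
    fix C a
    assume approx: "\<And>f j. f \<in> borel_measurable borel \<Longrightarrow> L1_int f < \<infinity> \<Longrightarrow>
      energy (\<lambda>_. 0) s r f \<le> ennreal B \<Longrightarrow> Lnorm \<Omega> q (\<lambda>x. f x - avg j f x) \<le> ennreal (C * u j powr a)"
    show ?thesis
      by (rule le_less_trans[OF approx[OF f L1]]) (use B in auto)
  qed
  obtain c where c: "\<forall>y\<in>range (avg 0 f). norm y \<le> c"
    using finite_imp_bounded[OF finite_range_avg[of 0 f]] unfolding bounded_iff by blast
  have "0 \<le> c" using c norm_ge_zero by (meson order_trans rangeI)
  then have "Lnorm \<Omega> q (avg 0 f) \<le> ennreal c * Lnorm \<Omega> q (\<lambda>_. 1)"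
    using c by (intro Lnorm_le_const q \<Omega>_lebesgue) auto
  also have "\<dots> < \<infinity>" using Lnorm_one_finite[OF q emeasure_\<Omega> \<Omega>_lebesgue] by (simp add: ennreal_mult_less_top)
  finally have 2: "Lnorm \<Omega> q (avg 0 f) < \<infinity>" .
  have "Lnorm \<Omega> q (\<lambda>x. (f x - avg 0 f x) + avg 0 f x) \<le> Lnorm \<Omega> q (\<lambda>x. f x - avg 0 f x) + Lnorm \<Omega> q (avg 0 f)"
    using f by (intro Lnorm_triangle q) (auto intro!: borel_measurable_diff borel_imp_lebesgue_on)
  then show ?thesis using 1 2 by (simp add: ennreal_add_less_top le_less_trans)
qed

text \<open>At each scale the averages are determined by finitely many complex numbers, so a
  diagonal subsequence makes them converge at all scales. \<open>Lnorm_avg_approx\<close> is uniform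
  in n, so the functions themselves become Cauchy in L^q along it.\<close>

lemma compactness:
  assumes q: "1 \<le> q" and sub: "subcritical CARD('n) q s r" and s: "0 < s" and r: "1 \<le> r"
    and F[measurable]: "\<And>n. F n \<in> borel_measurable borel"
    and L1: "\<And>n. L1_int (F n) \<le> ennreal B1"
    and G: "\<And>n. energy (\<lambda>_. 0) s r (F n) \<le> ennreal B"
  obtains k g where "strict_mono (k :: nat \<Rightarrow> nat)" "g \<in> borel_measurable borel"
    "AE x in lebesgue_on \<Omega>. (\<lambda>n. F (k n) x) \<longlonglongrightarrow> g x"
    "\<And>n. Lnorm \<Omega> q (\<lambda>x. g x - F (k n) x) \<le> ennreal ((1/2) ^ n)"
proof -
  \<comment> \<open>B and B1 may be negative, and \<open>ennreal\<close> sends negative reals to 0;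
    truncation makes the real bounds nonnegative.\<close>
  define B' where "B' = max B 0"
  define M where "M = max B1 0"
  have L1': "L1_int (F n) \<le> ennreal M" for n
    by (rule order_trans[OF L1]) (simp add: M_def ennreal_leI)
  have L1fin: "L1_int (F n) < \<infinity>" for n
    using L1[of n] by (rule le_less_trans) simp
  have G': "energy (\<lambda>_. 0) s r (F n) \<le> ennreal B'" for n
    by (rule order_trans[OF G]) (simp add: B'_def ennreal_leI)
  obtain C a where C: "0 \<le> C" "0 < a" and approx: "\<And>n j. Lnorm \<Omega> q (\<lambda>x. F n x - avg j (F n) x) \<le> ennreal (C * u j powr a)"
  proof -
    have "0 \<le> B'" by (simp add: B'_def)
    show thesis
    proof (rule Lnorm_avg_approx[OF q sub s r \<open>0 \<le> B'\<close>])
      fix C a assume Ca: "0 \<le> C" "0 < a"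
        and approx: "\<And>f j. f \<in> borel_measurable borel \<Longrightarrow> L1_int f < \<infinity> \<Longrightarrow>
        energy (\<lambda>_. 0) s r f \<le> ennreal B' \<Longrightarrow> Lnorm \<Omega> q (\<lambda>x. f x - avg j f x) \<le> ennreal (C * u j powr a)"
      show thesis by (rule that[OF Ca approx[OF F L1fin G']])
    qed
  qed
  define c where "c j = 1 / (unit_ball_vol (real CARD('n)) * (\<kappa> * u j) powr real CARD('n))" for j
  have c: "0 < c j" for j by (simp add: c_def)
  have bd: "norm (avg j (F n) x) \<le> c j * M" if "x \<in> \<Omega>" for x n j
  proof -
    have "ennreal (norm (avg j (F n) x)) \<le> ennreal (c j) * L1_int (F n)"
      unfolding c_def using that by (intro norm_avg_le L1fin F)
    also have "\<dots> \<le> ennreal (c j) * ennreal M" by (intro mult_left_mono L1') auto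
    also have "\<dots> = ennreal (c j * M)" using c[of j] by (simp add: ennreal_mult M_def)
    finally show ?thesis using c[of j] by (subst (asm) ennreal_le_iff) (auto simp: M_def)
  qed
  \<comment> \<open>Indexed by scale and centre, all averages of \<open>F n\<close> form one
    function on a countable set. The factor 1 / (c_j M + 1) brings its values into the unit ball,
    since \<open>function_convergent_subsequence\<close> is applied with the single bound 1; adding
    1 avoids division by 0 when M = 0.\<close>
  define val where "val n jz = (case jz of (j, z) \<Rightarrow> inverse (c j * M + 1) *\<^sub>R integral\<^sup>L (uniform_measure lborel (ball z (\<kappa> * u j))) (F n))" for n jz
  define S where "S = (\<Union>j. {j} \<times> \<zeta> j ` \<Omega>)"
  have M: "0 \<le> M" by (simp add: M_def)
  have cM: "0 < c j * M + 1" for j using c[of j] M by (intro add_nonneg_pos mult_nonneg_nonneg) auto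
  have val: "val n (j, \<zeta> j x) = inverse (c j * M + 1) *\<^sub>R avg j (F n) x" for n j x
    by (simp add: val_def avg_def Q_def)
  have "countable S"
  proof -
    have "countable (\<zeta> j ` \<Omega>)" for j
      using finite_range_\<zeta>[of j] by (meson countable_finite finite_subset image_mono subset_UNIV)
    then show ?thesis unfolding S_def by (intro countable_UN countable_SIGMA) auto
  qed
  moreover have "norm (val n y) \<le> 1" if "y \<in> S" for n y
  proof -
    from that obtain j x where y: "y = (j, \<zeta> j x)" "x \<in> \<Omega>" by (auto simp: S_def)
    have "norm (val n y) = norm (avg j (F n) x) / (c j * M + 1)" unfolding y val using cM[of j] by (simp add: divide_inverse_commute)
    also have "\<dots> \<le> 1" using bd[OF y(2), of j n] cM[of j] by (simp add: divide_le_eq)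
    finally show ?thesis .
  qed
  ultimately obtain k where k: "strict_mono (k :: nat \<Rightarrow> nat)" "\<And>y. y \<in> S \<Longrightarrow> \<exists>l. (\<lambda>n. val (k n) y) \<longlonglongrightarrow> l"
    using function_convergent_subsequence[of S val 1] by metis
  have conv: "Cauchy (\<lambda>n. avg j (F (k n)) x)" if x: "x \<in> \<Omega>" for j x
  proof -
    have "(j, \<zeta> j x) \<in> S" using x by (auto simp: S_def)
    then obtain l where "(\<lambda>n. val (k n) (j, \<zeta> j x)) \<longlonglongrightarrow> l" using k(2) by blast
    then have "(\<lambda>n. (c j * M + 1) *\<^sub>R val (k n) (j, \<zeta> j x)) \<longlonglongrightarrow> (c j * M + 1) *\<^sub>R l"
      by (intro tendsto_scaleR tendsto_const)
    then have "(\<lambda>n. avg j (F (k n)) x) \<longlonglongrightarrow> (c j * M + 1) *\<^sub>R l" unfolding val using cM[of j] by simp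
    then show ?thesis by (rule LIMSEQ_imp_Cauchy)
  qed
  \<comment> \<open>Only finitely many centres occur at scale j, so convergence is uniform in x; the
    sum of the thresholds of all centres is a common threshold.\<close>
  have unif: "\<exists>n0. \<forall>m\<ge>n0. \<forall>n\<ge>n0. \<forall>x\<in>\<Omega>. norm (avg j (F (k m)) x - avg j (F (k n)) x) \<le> e" if e: "0 < e" for j e
  proof -
    have "\<forall>z\<in>\<zeta> j ` \<Omega>. \<exists>n0. \<forall>m\<ge>n0. \<forall>n\<ge>n0. \<forall>x\<in>\<Omega>. \<zeta> j x = z \<longrightarrow> norm (avg j (F (k m)) x - avg j (F (k n)) x) \<le> e"
    proof
      fix z assume "z \<in> \<zeta> j ` \<Omega>"
      then obtain x where x: "x \<in> \<Omega>" "z = \<zeta> j x" by blast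
      obtain n0 where n0: "\<And>m n. n0 \<le> m \<Longrightarrow> n0 \<le> n \<Longrightarrow> norm (avg j (F (k m)) x - avg j (F (k n)) x) < e"
        using conv[OF x(1)] e unfolding Cauchy_iff by blast
      have "avg j f y = avg j f x" if "\<zeta> j y = z" for f y using that x by (simp add: avg_def Q_def)
      then show "\<exists>n0. \<forall>m\<ge>n0. \<forall>n\<ge>n0. \<forall>x\<in>\<Omega>. \<zeta> j x = z \<longrightarrow> norm (avg j (F (k m)) x - avg j (F (k n)) x) \<le> e"
        using n0 by (metis less_imp_le)
    qed
    then obtain n0 where n0: "\<And>z m n x. z \<in> \<zeta> j ` \<Omega> \<Longrightarrow> n0 z \<le> m \<Longrightarrow> n0 z \<le> n \<Longrightarrow> x \<in> \<Omega> \<Longrightarrow> \<zeta> j x = z \<Longrightarrow> norm (avg j (F (k m)) x - avg j (F (k n)) x) \<le> e"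
      by metis
    have fin: "finite (\<zeta> j ` \<Omega>)" using finite_range_\<zeta>[of j] by (meson finite_subset image_mono subset_UNIV)
    have "n0 (\<zeta> j x) \<le> (\<Sum>z\<in>\<zeta> j ` \<Omega>. n0 z)" if "x \<in> \<Omega>" for x using that fin by (intro member_le_sum) auto
    then show ?thesis
      by (intro exI[of _ "\<Sum>z\<in>\<zeta> j ` \<Omega>. n0 z"] allI impI ballI n0[OF imageI]) (auto intro: order_trans)
  qed
  define K where "K = Lnorm \<Omega> q (\<lambda>_. 1)"
  obtain K' where K: "K = ennreal K'" "0 \<le> K'" 
    using Lnorm_one_finite[OF q emeasure_\<Omega> \<Omega>_lebesgue] unfolding K_def by (cases "Lnorm \<Omega> q (\<lambda>_. 1)") auto
  have Fk[measurable]: "F n \<in> borel_measurable (lebesgue_on \<Omega>)" for n by (intro borel_imp_lebesgue_on F)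
  have Cauchy: "\<exists>n0. \<forall>m\<ge>n0. \<forall>n\<ge>n0. Lnorm \<Omega> q (\<lambda>x. F (k m) x - F (k n) x) \<le> ennreal e" if e: "0 < e" for e
  proof -
    \<comment> \<open>The scale j is fixed first, since the averaging error is small uniformly in n;
      the threshold n0 is chosen for this scale only.\<close>
    have "\<forall>\<^sub>F j in sequentially. C * u j powr a < e / 4"
      using e by (intro order_tendstoD[OF tendsto_mult_left[OF u_powr_tendsto_0[OF C(2)], of C]]) auto
    then obtain j where j: "C * u j powr a < e / 4" using eventually_happens'[OF sequentially_bot] by blast
    define d where "d = e / (4 * (K' + 1))"
    have d: "0 < d" "d * K' \<le> e / 4" using e K by (auto simp: d_def field_simps)
    obtain n0 where n0: "\<And>m n x. n0 \<le> m \<Longrightarrow> n0 \<le> n \<Longrightarrow> x \<in> \<Omega> \<Longrightarrow> norm (avg j (F (k m)) x - avg j (F (k n)) x) \<le> d"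
      using unif[OF d(1)] by metis
    have "Lnorm \<Omega> q (\<lambda>x. F (k m) x - F (k n) x) \<le> ennreal e" if "n0 \<le> m" "n0 \<le> n" for m n
    proof -
      have 1: "Lnorm \<Omega> q (\<lambda>x. F (k m) x - F (k n) x) \<le> Lnorm \<Omega> q (\<lambda>x. F (k m) x - avg j (F (k m)) x)
          + Lnorm \<Omega> q (\<lambda>x. avg j (F (k m)) x - F (k n) x)"
        by (intro Lnorm_minus_triangle q) measurable
      have 2: "Lnorm \<Omega> q (\<lambda>x. avg j (F (k m)) x - F (k n) x) \<le> Lnorm \<Omega> q (\<lambda>x. avg j (F (k m)) x - avg j (F (k n)) x)
          + Lnorm \<Omega> q (\<lambda>x. avg j (F (k n)) x - F (k n) x)"
        by (intro Lnorm_minus_triangle q) measurable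
      have 3: "Lnorm \<Omega> q (\<lambda>x. F (k m) x - avg j (F (k m)) x) \<le> ennreal (e / 4)"
        by (rule order_trans[OF approx]) (use j in \<open>simp add: ennreal_leI less_imp_le\<close>)
      have 4: "Lnorm \<Omega> q (\<lambda>x. avg j (F (k n)) x - F (k n) x) \<le> ennreal (e / 4)"
        unfolding Lnorm_minus_commute[of \<Omega> q "avg j (F (k n))"]
        by (rule order_trans[OF approx]) (use j in \<open>simp add: ennreal_leI less_imp_le\<close>)
      have 5: "Lnorm \<Omega> q (\<lambda>x. avg j (F (k m)) x - avg j (F (k n)) x) \<le> ennreal (e / 4)"
      proof -
        have "Lnorm \<Omega> q (\<lambda>x. avg j (F (k m)) x - avg j (F (k n)) x) \<le> ennreal d * K"
          unfolding K_def using n0 that d by (intro Lnorm_le_const q \<Omega>_lebesgue) auto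
        also have "\<dots> = ennreal (d * K')" using K d by (simp add: ennreal_mult)
        also have "\<dots> \<le> ennreal (e / 4)" using d by (intro ennreal_leI)
        finally show ?thesis .
      qed
      have "Lnorm \<Omega> q (\<lambda>x. F (k m) x - F (k n) x) \<le> ennreal (e / 4) + (ennreal (e / 4) + ennreal (e / 4))"
        using order_trans[OF 1 add_mono[OF 3 order_trans[OF 2 add_mono[OF 5 4]]]] .
      also have "\<dots> \<le> ennreal e" using e by (simp add: ennreal_plus[symmetric] ennreal_leI del: ennreal_plus)
      finally show ?thesis .
    qed
    then show ?thesis by blast
  qed
  show thesis
  proof (rule Lnorm_complete[OF q \<Omega>_lebesgue emeasure_\<Omega> F Cauchy])
    fix k' :: "nat \<Rightarrow> nat" and g
    assume k': "strict_mono k'" "g \<in> borel_measurable borel"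
      "AE x in lebesgue_on \<Omega>. (\<lambda>n. F (k (k' n)) x) \<longlonglongrightarrow> g x"
      "\<And>n. Lnorm \<Omega> q (\<lambda>x. g x - F (k (k' n)) x) \<le> ennreal ((1/2) ^ n)"
    show thesis
      by (rule that[of "k \<circ> k'" g]) (use k k' in \<open>auto simp: strict_mono_o\<close>)
  qed
qed

end

section \<open>Comparison of magnetic kernels\<close>

lemma norm_iexp_diff_le: "norm (exp (\<i> * complex_of_real \<alpha>) - exp (\<i> * complex_of_real \<beta>)) \<le> \<bar>\<alpha> - \<beta>\<bar>"
proof -
  have "exp (\<i> * complex_of_real \<alpha>) - exp (\<i> * complex_of_real \<beta>)
      = exp (\<i> * complex_of_real \<beta>) * (exp (\<i> * complex_of_real (\<alpha> - \<beta>)) - 1)"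
    by (simp add: algebra_simps exp_add[symmetric])
  then have "norm (exp (\<i> * complex_of_real \<alpha>) - exp (\<i> * complex_of_real \<beta>)) = norm (exp (\<i> * complex_of_real (\<alpha> - \<beta>)) - 1)"
    by (simp add: norm_mult)
  also have "\<dots> \<le> \<bar>\<alpha> - \<beta>\<bar>" using iexp_approx1[of "\<alpha> - \<beta>" 0] by simp
  finally show ?thesis .
qed

lemma powr_add_le:
  assumes "0 \<le> u" "0 \<le> v" "0 \<le> p"
  shows "(u + v) powr p \<le> 2 powr p * (u powr p + v powr (p::real))"
proof -
  have "(u + v) powr p \<le> (2 * max u v) powr p" using assms by (intro powr_mono2) auto
  also have "\<dots> = 2 powr p * max u v powr p" using assms by (simp add: powr_mult)
  also have "max u v powr p \<le> u powr p + v powr p" by (simp add: max_def)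
  finally show ?thesis by simp
qed

lemma geometric_mean_le_add:
  assumes "0 \<le> x" "0 \<le> y" "0 < t" "t < (1::real)"
  shows "x powr t * y powr (1 - t) \<le> x + y"
proof -
  have "x powr t * y powr (1 - t) \<le> max x y powr t * max x y powr (1 - t)"
    using assms by (intro mult_mono powr_mono2) auto
  also have "\<dots> = max x y" using assms by (simp add: powr_add[symmetric])
  also have "\<dots> \<le> x + y" using assms by simp
  finally show ?thesis .
qed

text \<open>
  This replaces Hoelder's inequality in passing from exponent \<open>p\<close> to \<open>r\<close>: the additional term is
  integrable because its exponent exceeds minus the dimension.
\<close>

lemma mag_kernel_Young:
  fixes f :: "real^'n \<Rightarrow> complex"
  assumes "0 < r" "r < p"
  shows "mag_kernel A s' r f (x, y) \<le> mag_kernel A s p f (x, y)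
    + norm (x - y) powr ((s - s') * r * p / (p - r) - real CARD('n))"
proof (cases "x = y")
  case False
  define N where "N = real CARD('n)"
  define h where "h = norm (f x - exp (\<i> * complex_of_real ((x - y) \<bullet> A (midpoint x y))) * f y)"
  define d where "d = norm (x - y)"
  have d: "0 < d" using False by (simp add: d_def)
  \<comment> \<open>The r-kernel of order s' is the geometric mean, with weights r / p and 1 - r /
    p, of the p-kernel of order s and \<open>d powr (k - N)\<close>; matching the exponents of d
    determines k.\<close>
  define k where "k = (s - s') * r * p / (p - r)"
  define X where "X = h powr p / d powr (N + s * p)"
  define t where "t = r / p"
  have t: "0 < t" "t < 1" using assms by (auto simp: t_def)
  have "1 - t = (p - r) / p" using assms by (simp add: t_def diff_divide_distrib)
  then have kt: "k * (1 - t) = (s - s') * r" using assms by (simp add: k_def)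
  have "- (N + s * p) * t + (k - N) * (1 - t) = k * (1 - t) - s * (p * t) - N"
    by (simp add: algebra_simps)
  also have "p * t = r" using assms by (simp add: t_def)
  finally have e: "- (N + s * p) * t + (k - N) * (1 - t) = - (N + s' * r)"
    unfolding kt by (simp add: algebra_simps)
  have "h powr r / d powr (N + s' * r) = h powr r * d powr (- (N + s' * r))" unfolding powr_minus_divide by simp
  also have "\<dots> = (h powr p) powr t * (d powr (- (N + s * p) * t) * d powr ((k - N) * (1 - t)))"
  proof -
    have "(h powr p) powr t = h powr r" using assms by (simp add: powr_powr t_def)
    then show ?thesis unfolding e[symmetric] powr_add by simp
  qed
  also have "\<dots> = X powr t * (d powr (k - N)) powr (1 - t)"
  proof -
    have "X powr t = (h powr p) powr t / d powr ((N + s * p) * t)" by (simp add: X_def powr_divide powr_powr)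
    also have "\<dots> = (h powr p) powr t * d powr (- (N + s * p) * t)"
      unfolding mult_minus_left powr_minus_divide by simp
    finally show ?thesis by (simp add: powr_powr)
  qed
  also have "\<dots> \<le> X + d powr (k - N)"
    using t by (intro geometric_mean_le_add) (auto simp: X_def)
  finally show ?thesis by (simp add: mag_kernel_def h_def d_def X_def k_def N_def)
qed (simp add: mag_kernel_def)

lemma mag_kernel_le_smaller_order:
  fixes f :: "real^'n \<Rightarrow> complex"
  assumes "0 < r" "s' \<le> s" "norm (x - y) \<le> R"
  shows "mag_kernel A s' r f (x, y) \<le> R powr ((s - s') * r) * mag_kernel A s r f (x, y)"
proof (cases "x = y")
  case False
  define N where "N = real CARD('n)"
  define h where "h = norm (f x - exp (\<i> * complex_of_real ((x - y) \<bullet> A (midpoint x y))) * f y)"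
  define d where "d = norm (x - y)"
  have d: "0 < d" using False by (simp add: d_def)
  have e: "N + s * r = (s - s') * r + (N + s' * r)" by (simp add: algebra_simps)
  have "h powr r / d powr (N + s' * r) = d powr ((s - s') * r) * (h powr r / d powr (N + s * r))"
    unfolding e powr_add using d by simp
  also have "\<dots> \<le> R powr ((s - s') * r) * (h powr r / d powr (N + s * r))"
    using assms by (intro mult_right_mono powr_mono2) (auto simp: d_def)
  finally show ?thesis by (simp add: mag_kernel_def h_def d_def N_def)
qed (simp add: mag_kernel_def)

text \<open>The two phases differ by at most 2 a |x - y|, so exchanging the fields adds a term with
  |x - y|^p in the numerator. For s < 1 the remaining exponent (1 - s) p - n exceeds -n, hence is
  integrable.\<close>

lemma mag_kernel_change_field:
  fixes f :: "real^'n \<Rightarrow> complex"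
  assumes p: "0 < p" and A: "\<And>x. norm (A x) \<le> a" "\<And>x. norm (A' x) \<le> a"
  shows "mag_kernel A s p f (x, y) \<le> 2 powr p * mag_kernel A' s p f (x, y)
    + 2 powr p * (2 * a) powr p * norm (f y) powr p * norm (x - y) powr ((1 - s) * p - real CARD('n))"
proof (cases "x = y")
  case False
  define N where "N = real CARD('n)"
  define \<alpha> where "\<alpha> = (x - y) \<bullet> A (midpoint x y)"
  define \<beta> where "\<beta> = (x - y) \<bullet> A' (midpoint x y)"
  define d where "d = norm (x - y)"
  have d: "0 < d" using False by (simp add: d_def)
  define h where "h = norm (f x - exp (\<i> * complex_of_real \<alpha>) * f y)"
  define h' where "h' = norm (f x - exp (\<i> * complex_of_real \<beta>) * f y)"
  have a: "0 \<le> a" using norm_ge_zero[of "A 0"] A(1)[of 0] by linarith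
  have "\<alpha> - \<beta> = (x - y) \<bullet> (A (midpoint x y) - A' (midpoint x y))" by (simp add: \<alpha>_def \<beta>_def inner_diff_right)
  then have "\<bar>\<alpha> - \<beta>\<bar> \<le> d * norm (A (midpoint x y) - A' (midpoint x y))" using Cauchy_Schwarz_ineq2 by (simp add: d_def)
  also have "\<dots> \<le> d * (2 * a)"
    using norm_triangle_ineq4[of "A (midpoint x y)" "A' (midpoint x y)"] A[of "midpoint x y"] d by (intro mult_left_mono) auto
  finally have ab: "\<bar>\<alpha> - \<beta>\<bar> \<le> 2 * a * d" by (simp add: mult.commute)
  have "h = norm ((f x - exp (\<i> * complex_of_real \<beta>) * f y) - (exp (\<i> * complex_of_real \<alpha>) - exp (\<i> * complex_of_real \<beta>)) * f y)"
    by (simp add: h_def algebra_simps)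
  also have "\<dots> \<le> h' + norm (exp (\<i> * complex_of_real \<alpha>) - exp (\<i> * complex_of_real \<beta>)) * norm (f y)"
    unfolding h'_def norm_mult[symmetric] by (rule norm_triangle_ineq4)
  also have "\<dots> \<le> h' + 2 * a * d * norm (f y)"
    using norm_iexp_diff_le[of \<alpha> \<beta>] ab by (intro add_left_mono mult_right_mono) auto
  finally have "h powr p \<le> (h' + 2 * a * d * norm (f y)) powr p" using p by (intro powr_mono2) (auto simp: h_def)
  also have "\<dots> \<le> 2 powr p * (h' powr p + (2 * a * d * norm (f y)) powr p)"
    using p a d by (intro powr_add_le) (auto simp: h'_def)
  also have "(2 * a * d * norm (f y)) powr p = (2 * a) powr p * d powr p * norm (f y) powr p"
    using a d by (simp add: powr_mult)
  finally have "h powr p / d powr (N + s * p)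
      \<le> 2 powr p * (h' powr p + (2 * a) powr p * d powr p * norm (f y) powr p) / d powr (N + s * p)"
    by (intro divide_right_mono) auto
  also have "\<dots> = 2 powr p * (h' powr p / d powr (N + s * p)) + 2 powr p * (2 * a) powr p * norm (f y) powr p * (d powr p / d powr (N + s * p))"
    by (simp add: add_divide_distrib distrib_left mult_ac)
  also have "d powr p / d powr (N + s * p) = d powr ((1 - s) * p - N)"
    by (simp add: powr_diff[symmetric] algebra_simps)
  finally show ?thesis by (simp add: mag_kernel_def h_def h'_def d_def N_def \<alpha>_def \<beta>_def)
qed (simp add: mag_kernel_def)

text \<open>The phase has modulus 1, so it disappears from |f y|. Averaged over y, this becomes the
  Poincare type inequality \<open>Lp_le_mag_int\<close>, for any field.\<close>

lemma norm_le_mag_kernel: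
  fixes f :: "real^'n \<Rightarrow> complex"
  assumes "0 < p" "0 < s" "norm (x - y) \<le> R"
  shows "norm (f x) \<le> (R powr (real CARD('n) + s * p) * mag_kernel A s p f (x, y)) powr (1 / p) + norm (f y)"
proof (cases "x = y")
  case False
  define N where "N = real CARD('n)"
  define c where "c = exp (\<i> * complex_of_real ((x - y) \<bullet> A (midpoint x y)))"
  have c: "norm c = 1" by (simp add: c_def)
  define h where "h = norm (f x - c * f y)"
  define d where "d = norm (x - y)"
  have d: "0 < d" using False by (simp add: d_def)
  have "h powr p = d powr (N + s * p) * (h powr p / d powr (N + s * p))" using d by simp
  also have "\<dots> \<le> R powr (N + s * p) * (h powr p / d powr (N + s * p))"
    using assms by (intro mult_right_mono powr_mono2) (auto simp: d_def N_def)
  finally have "(h powr p) powr (1 / p) \<le> (R powr (N + s * p) * (h powr p / d powr (N + s * p))) powr (1 / p)"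
    using assms by (intro powr_mono2) auto
  moreover have "(h powr p) powr (1 / p) = h" using assms by (simp add: powr_powr h_def)
  moreover have "norm (f x) \<le> h + norm (f y)"
    using norm_triangle_ineq[of "f x - c * f y" "c * f y"] c by (simp add: h_def norm_mult)
  ultimately show ?thesis by (simp add: mag_kernel_def h_def d_def N_def c_def)
qed (simp add: mag_kernel_def)

lemma ennpow_add_le: "0 < p \<Longrightarrow> ennpow (x + y) p \<le> ennreal (2 powr p) * (ennpow x p + ennpow y p)"
  by (cases x; cases y)
    (auto simp: ennpow_ennreal ennreal_mult_top ennreal_plus[symmetric] ennreal_mult[symmetric]
      simp del: ennreal_plus intro!: ennreal_leI powr_add_le)

section \<open>Comparison of energies on the domain\<close>

context corkscrew_scales begin

lemma diameter_bound:
  obtains R where "0 < R" "\<And>x y. x \<in> \<Omega> \<Longrightarrow> y \<in> \<Omega> \<Longrightarrow> norm (x - y) < R"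
proof -
  obtain b where b: "0 < b" "\<And>x. x \<in> \<Omega> \<Longrightarrow> norm x \<le> b"
    using bounded_\<Omega> unfolding bounded_pos by blast
  show thesis
  proof
    show "0 < 3 * b" using b by simp
    show "norm (x - y) < 3 * b" if "x \<in> \<Omega>" "y \<in> \<Omega>" for x y
      using norm_triangle_ineq4[of x y] b(2)[OF that(1)] b(2)[OF that(2)] b(1) by simp
  qed
qed

lemma \<Omega>\<Omega>_borel [measurable]: "\<Omega> \<times> \<Omega> \<in> sets borel"
  using open_\<Omega> by (simp add: open_Times)

text \<open>The integration in x comes first, as only the kernel involves x. For y in \<Omega> the
  domain lies in the ball of radius R around y, and the Riesz bound is uniform in the
  centre.\<close>

lemma Riesz_double_integral:
  assumes "0 < k"
  obtains K where "0 \<le> K" "\<And>g. g \<in> borel_measurable borel \<Longrightarrow>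
     (\<integral>\<^sup>+z. ennreal (norm (fst z - snd z) powr (k - real CARD('n))) * g (snd z) * indicator (\<Omega> \<times> \<Omega>) z \<partial>lborel)
       \<le> ennreal K * (\<integral>\<^sup>+y. g y * indicator \<Omega> y \<partial>lborel)"
proof -
  obtain R where R: "0 < R" "\<And>x y. x \<in> \<Omega> \<Longrightarrow> y \<in> \<Omega> \<Longrightarrow> norm (x - y) < R" using diameter_bound by blast
  obtain K where K: "0 \<le> K"
    "\<And>x::real^'n. (\<integral>\<^sup>+y. ennreal (norm (x - y) powr (k - real CARD('n))) * indicator (ball x R) y \<partial>lborel) \<le> ennreal K"
    using Riesz_kernel_integral_bound[OF assms R(1), where 'a = "real^'n"] by auto
  have "(\<integral>\<^sup>+z. ennreal (norm (fst z - snd z) powr (k - real CARD('n))) * g (snd z) * indicator (\<Omega> \<times> \<Omega>) z \<partial>lborel)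
       \<le> ennreal K * (\<integral>\<^sup>+y. g y * indicator \<Omega> y \<partial>lborel)" if g[measurable]: "g \<in> borel_measurable borel" for g
  proof -
    let ?w = "\<lambda>x y::real^'n. ennreal (norm (x - y) powr (k - real CARD('n)))"
    have "(\<integral>\<^sup>+z. ?w (fst z) (snd z) * g (snd z) * indicator (\<Omega> \<times> \<Omega>) z \<partial>lborel)
      = (\<integral>\<^sup>+y. \<integral>\<^sup>+x. ?w x y * g y * indicator (\<Omega> \<times> \<Omega>) (x, y) \<partial>lborel \<partial>lborel)"
      unfolding lborel_prod[symmetric] by (subst lborel_pair.nn_integral_snd[symmetric]) auto
    also have "\<dots> \<le> (\<integral>\<^sup>+y. ennreal K * (g y * indicator \<Omega> y) \<partial>lborel)"
    proof (intro nn_integral_mono)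
      fix y :: "real^'n"
      have "(\<integral>\<^sup>+x. ?w x y * g y * indicator (\<Omega> \<times> \<Omega>) (x, y) \<partial>lborel)
          \<le> (\<integral>\<^sup>+x. (g y * indicator \<Omega> y) * (?w y x * indicator (ball y R) x) \<partial>lborel)"
        using R(2) by (intro nn_integral_mono)
          (auto simp: indicator_def norm_minus_commute dist_norm mult.commute)
      also have "\<dots> = (g y * indicator \<Omega> y) * (\<integral>\<^sup>+x. ?w y x * indicator (ball y R) x \<partial>lborel)"
        by (rule nn_integral_cmult) measurable
      also have "\<dots> \<le> (g y * indicator \<Omega> y) * ennreal K" by (intro mult_left_mono K) auto
      finally show "(\<integral>\<^sup>+x. ?w x y * g y * indicator (\<Omega> \<times> \<Omega>) (x, y) \<partial>lborel) \<le> ennreal K * (g y * indicator \<Omega> y)"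
        by (simp add: mult.commute)
    qed
    also have "\<dots> = ennreal K * (\<integral>\<^sup>+y. g y * indicator \<Omega> y \<partial>lborel)"
      by (rule nn_integral_cmult) measurable
    finally show ?thesis .
  qed
  with K(1) show thesis by (rule that)
qed

text \<open>\<open>mag_kernel_Young\<close> on \<open>\<Lambda> \<times> \<Lambda>\<close>, where
  exponent p is available, and a mere lowering of the order elsewhere. K and c are independent of A,
  f and \<Lambda>, so the estimate is uniform along a sequence; with \<Lambda> = \<Omega> it bounds
  the energy of order s' and exponent r by that of order s and exponent p.\<close>

lemma mag_int_split_le:
  assumes r: "0 < r" "r < p" and s: "s' < s"
  obtains K c where "0 \<le> K" "0 \<le> c"
    "\<And>A f \<Lambda>. A \<in> borel_measurable borel \<Longrightarrow> f \<in> borel_measurable borel \<Longrightarrow> \<Lambda> \<in> sets borel \<Longrightarrow> \<Lambda> \<subseteq> \<Omega> \<Longrightarrow>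
      energy A s' r f \<le> mag_int (\<Lambda> \<times> \<Lambda>) A s p f + ennreal K + ennreal c * mag_int (\<Omega> \<times> \<Omega> - \<Lambda> \<times> \<Lambda>) A s r f"
proof -
  define k where "k = (s - s') * r * p / (p - r)"
  have k: "0 < k" using r s by (simp add: k_def)
  obtain R where R: "0 < R" "\<And>x y. x \<in> \<Omega> \<Longrightarrow> y \<in> \<Omega> \<Longrightarrow> norm (x - y) < R" using diameter_bound by blast
  obtain K where K: "0 \<le> K" "\<And>g. g \<in> borel_measurable borel \<Longrightarrow>
     (\<integral>\<^sup>+z. ennreal (norm (fst z - snd z) powr (k - real CARD('n))) * g (snd z) * indicator (\<Omega> \<times> \<Omega>) z \<partial>lborel)
       \<le> ennreal K * (\<integral>\<^sup>+y. g y * indicator \<Omega> y \<partial>lborel)"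
    using Riesz_double_integral[OF k] by blast
  define w where "w = measure lborel \<Omega>"
  have w: "emeasure lborel \<Omega> = ennreal w" "0 \<le> w"
    using emeasure_\<Omega> open_\<Omega> by (auto simp: w_def emeasure_eq_ennreal_measure)
  define c where "c = R powr ((s - s') * r)"
  let ?w = "\<lambda>z::(real^'n) \<times> (real^'n). ennreal (norm (fst z - snd z) powr (k - real CARD('n)))"
  have "energy A s' r f \<le> mag_int (\<Lambda> \<times> \<Lambda>) A s p f + ennreal (K * w) + ennreal c * mag_int (\<Omega> \<times> \<Omega> - \<Lambda> \<times> \<Lambda>) A s r f"
    if A[measurable]: "A \<in> borel_measurable borel" and f[measurable]: "f \<in> borel_measurable borel"
      and \<Lambda>: "\<Lambda> \<in> sets borel" "\<Lambda> \<subseteq> \<Omega>" for A f \<Lambda>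
  proof -
    have [measurable]: "\<Lambda> \<times> \<Lambda> \<in> sets borel"
      using \<Lambda>(1) by (metis borel_prod pair_measureI)
    have [measurable]: "\<Omega> \<times> \<Omega> - \<Lambda> \<times> \<Lambda> \<in> sets borel" by measurable
    have w_measurable: "?w \<in> borel_measurable borel"
      unfolding borel_prod[symmetric] by measurable
    note [measurable] = w_measurable
    have "energy A s' r f \<le> (\<integral>\<^sup>+z. (ennreal (mag_kernel A s p f z) * indicator (\<Lambda> \<times> \<Lambda>) z + ?w z * indicator (\<Omega> \<times> \<Omega>) z)
        + ennreal c * (ennreal (mag_kernel A s r f z) * indicator (\<Omega> \<times> \<Omega> - \<Lambda> \<times> \<Lambda>) z) \<partial>lborel)"
      unfolding mag_int_def
    proof (intro nn_integral_mono)
      fix z :: "(real^'n) \<times> (real^'n)"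
      obtain x y where z: "z = (x, y)" by (cases z)
      show "ennreal (mag_kernel A s' r f z) * indicator (\<Omega> \<times> \<Omega>) z \<le>
        (ennreal (mag_kernel A s p f z) * indicator (\<Lambda> \<times> \<Lambda>) z + ?w z * indicator (\<Omega> \<times> \<Omega>) z)
        + ennreal c * (ennreal (mag_kernel A s r f z) * indicator (\<Omega> \<times> \<Omega> - \<Lambda> \<times> \<Lambda>) z)"
      proof (cases "z \<in> \<Omega> \<times> \<Omega>")
        case zO: True
        show ?thesis
        proof (cases "z \<in> \<Lambda> \<times> \<Lambda>")
          case True
          have "mag_kernel A s' r f z \<le> mag_kernel A s p f z + norm (fst z - snd z) powr (k - real CARD('n))"
            unfolding z fst_conv snd_conv k_def by (rule mag_kernel_Young[OF r])
          then have "ennreal (mag_kernel A s' r f z) \<le> ennreal (mag_kernel A s p f z) + ?w z"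
            by (simp add: ennreal_plus[symmetric] ennreal_leI del: ennreal_plus)
          with True zO show ?thesis by simp
        next
          case False
          have "mag_kernel A s' r f z \<le> c * mag_kernel A s r f z"
            unfolding z c_def using r s R(2)[of x y] zO z by (intro mag_kernel_le_smaller_order) auto
          then have "ennreal (mag_kernel A s' r f z) \<le> ennreal c * ennreal (mag_kernel A s r f z)"
            by (simp add: ennreal_mult[symmetric] ennreal_leI c_def)
          with False zO show ?thesis by (simp add: add_increasing)
        qed
      qed (use \<Lambda> in auto)
    qed
    also have "\<dots> = (mag_int (\<Lambda> \<times> \<Lambda>) A s p f + (\<integral>\<^sup>+z. ?w z * indicator (\<Omega> \<times> \<Omega>) z \<partial>lborel)) + ennreal c * mag_int (\<Omega> \<times> \<Omega> - \<Lambda> \<times> \<Lambda>) A s r f"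
      unfolding mag_int_def by (simp add: nn_integral_add nn_integral_cmult)
    also have "\<dots> \<le> (mag_int (\<Lambda> \<times> \<Lambda>) A s p f + ennreal (K * w)) + ennreal c * mag_int (\<Omega> \<times> \<Omega> - \<Lambda> \<times> \<Lambda>) A s r f"
    proof (intro add_mono order_refl)
      have "(\<integral>\<^sup>+z. ?w z * indicator (\<Omega> \<times> \<Omega>) z \<partial>lborel) \<le> ennreal K * emeasure lborel \<Omega>"
        using K(2)[of "\<lambda>_. 1"] by simp
      also have "\<dots> = ennreal (K * w)" using w K by (simp add: ennreal_mult)
      finally show "(\<integral>\<^sup>+z. ?w z * indicator (\<Omega> \<times> \<Omega>) z \<partial>lborel) \<le> ennreal (K * w)" .
    qed
    finally show ?thesis .
  qed
  moreover have "0 \<le> K * w" "0 \<le> c" using K w by (auto simp: c_def)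
  ultimately show thesis using that by blast
qed

text \<open>The constant depends on the fields only through their common bound a, and the fields
  enter symmetrically: the lemma serves both to introduce and to remove a field.\<close>

lemma mag_int_change_field:
  assumes p: "0 < p" and s: "s < 1"
  obtains C where "0 \<le> C"
    "\<And>A A' f. A \<in> borel_measurable borel \<Longrightarrow> A' \<in> borel_measurable borel \<Longrightarrow> f \<in> borel_measurable borel \<Longrightarrow>
      (\<And>x. norm (A x) \<le> a) \<Longrightarrow> (\<And>x. norm (A' x) \<le> a) \<Longrightarrow>
      energy A s p f \<le> ennreal C * (energy A' s p f + Lp_int p f)"
proof -
  have k: "0 < (1 - s) * p" using assms by simp
  obtain K where K: "0 \<le> K" "\<And>g. g \<in> borel_measurable borel \<Longrightarrow>
     (\<integral>\<^sup>+z. ennreal (norm (fst z - snd z) powr ((1 - s) * p - real CARD('n))) * g (snd z) * indicator (\<Omega> \<times> \<Omega>) z \<partial>lborel)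
       \<le> ennreal K * (\<integral>\<^sup>+y. g y * indicator \<Omega> y \<partial>lborel)"
    using Riesz_double_integral[OF k] by blast
  define c where "c = 2 powr p * (2 * a) powr p"
  have c: "0 \<le> c" by (simp add: c_def)
  let ?w = "\<lambda>z::(real^'n) \<times> (real^'n). ennreal (norm (fst z - snd z) powr ((1 - s) * p - real CARD('n)))"
  have "energy A s p f \<le> ennreal (2 powr p + c * K) * (energy A' s p f + Lp_int p f)"
    if A[measurable]: "A \<in> borel_measurable borel" "A' \<in> borel_measurable borel" and f[measurable]: "f \<in> borel_measurable borel"
      and bd: "\<And>x. norm (A x) \<le> a" "\<And>x. norm (A' x) \<le> a" for A A' f
  proof -
    let ?F = "\<integral>\<^sup>+x. ennreal (norm (f x) powr p) * indicator \<Omega> x \<partial>lborel"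
    have [measurable]: "?w \<in> borel_measurable borel" "(\<lambda>z::(real^'n) \<times> (real^'n). ennreal (norm (f (snd z)) powr p)) \<in> borel_measurable borel"
      unfolding borel_prod[symmetric] by measurable
    have "energy A s p f \<le> (\<integral>\<^sup>+z. ennreal (2 powr p) * (ennreal (mag_kernel A' s p f z) * indicator (\<Omega> \<times> \<Omega>) z)
        + ennreal c * (?w z * ennreal (norm (f (snd z)) powr p) * indicator (\<Omega> \<times> \<Omega>) z) \<partial>lborel)"
      unfolding mag_int_def
    proof (intro nn_integral_mono)
      fix z :: "(real^'n) \<times> (real^'n)"
      obtain x y where z: "z = (x, y)" by (cases z)
      have "mag_kernel A s p f z \<le> 2 powr p * mag_kernel A' s p f z + c * (norm (fst z - snd z) powr ((1 - s) * p - real CARD('n)) * norm (f (snd z)) powr p)"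
        using mag_kernel_change_field[OF p bd, where s = s and f = f and x = x and y = y] unfolding z c_def by (simp add: mult_ac)
      then have "ennreal (mag_kernel A s p f z) \<le> ennreal (2 powr p) * ennreal (mag_kernel A' s p f z) + ennreal c * (?w z * ennreal (norm (f (snd z)) powr p))"
        using c by (simp add: ennreal_plus[symmetric] ennreal_mult[symmetric] ennreal_leI del: ennreal_plus)
      then show "ennreal (mag_kernel A s p f z) * indicator (\<Omega> \<times> \<Omega>) z \<le> ennreal (2 powr p) * (ennreal (mag_kernel A' s p f z) * indicator (\<Omega> \<times> \<Omega>) z)
        + ennreal c * (?w z * ennreal (norm (f (snd z)) powr p) * indicator (\<Omega> \<times> \<Omega>) z)"
        by (auto split: split_indicator)
    qed
    also have "\<dots> = ennreal (2 powr p) * energy A' s p f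
       + ennreal c * (\<integral>\<^sup>+z. ?w z * ennreal (norm (f (snd z)) powr p) * indicator (\<Omega> \<times> \<Omega>) z \<partial>lborel)"
      unfolding mag_int_def by (simp add: nn_integral_add nn_integral_cmult)
    also have "\<dots> \<le> ennreal (2 powr p) * energy A' s p f + ennreal c * (ennreal K * ?F)"
      by (intro add_mono mult_left_mono K(2)) auto
    also have "\<dots> \<le> ennreal (2 powr p + c * K) * (energy A' s p f + ?F)"
      using c K by (simp add: ennreal_plus ennreal_mult distrib_left distrib_right add_increasing2 add_mono mult.assoc add_increasing)
    finally show ?thesis .
  qed
  moreover have "0 \<le> 2 powr p + c * K" using c K by simp
  ultimately show thesis using that by blast
qed

text \<open>A Poincare type inequality with magnetic phase: \<open>norm_le_mag_kernel\<close> is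
  averaged over y in \<Omega> and raised to the power p. It upgrades an L^1 bound, which the L^q
  normalisation provides for every q \<ge> 1, to an L^p bound.\<close>

lemma Lp_le_mag_int:
  assumes p: "1 \<le> p" and s: "0 < s" and ne: "\<Omega> \<noteq> {}"
  obtains C where "0 \<le> C"
    "\<And>A f. A \<in> borel_measurable borel \<Longrightarrow> f \<in> borel_measurable borel \<Longrightarrow>
      Lp_int p f
        \<le> ennreal C * (energy A s p f + ennpow (L1_int f) p)"
proof -
  obtain R where R: "0 < R" "\<And>x y. x \<in> \<Omega> \<Longrightarrow> y \<in> \<Omega> \<Longrightarrow> norm (x - y) < R" using diameter_bound by blast
  define w where "w = measure lborel \<Omega>"
  have w: "emeasure lborel \<Omega> = ennreal w" "0 \<le> w"
    using emeasure_\<Omega> open_\<Omega> by (auto simp: w_def emeasure_eq_ennreal_measure)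
  have "emeasure lborel \<Omega> \<noteq> 0"
  proof -
    obtain x e where "x \<in> \<Omega>" "0 < e" "ball x e \<subseteq> \<Omega>" using ne open_\<Omega> open_contains_ball by blast
    then have "emeasure lborel (ball x e) \<le> emeasure lborel \<Omega>" by (intro emeasure_mono) auto
    then show ?thesis using \<open>0 < e\<close> by (auto simp: emeasure_ball_powr)
  qed
  then have w0: "0 < w" using w by (cases "w = 0") auto
  define P where "P = uniform_measure lborel \<Omega>"
  interpret P: prob_space P unfolding P_def by (rule prob_space_uniform_measure) (use w w0 in auto)
  have [measurable_cong]: "sets P = sets borel" by (simp add: P_def)
  have P_int: "(\<integral>\<^sup>+y. g y \<partial>P) = ennreal (1 / w) * (\<integral>\<^sup>+y. g y * indicator \<Omega> y \<partial>lborel)"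
    if [measurable]: "g \<in> borel_measurable borel" for g
    unfolding P_def using w0
    by (subst nn_integral_uniform_measure) (auto simp: w divide_ennreal_def inverse_ennreal mult.commute inverse_eq_divide)
  \<comment> \<open>As R bounds all distances in \<Omega>, this factor removes the denominator of
    the kernel.\<close>
  define \<rho> where "\<rho> = R powr (real CARD('n) + s * p)"
  define a where "a = 2 powr p * (2 powr p * (1 / w * \<rho>))"
  define b where "b = 2 powr p * (1 / w) powr p * w"
  have ab: "0 \<le> a" "0 \<le> b" using w0 by (auto simp: a_def b_def \<rho>_def)
  have "Lp_int p f
        \<le> ennreal (a + b) * (energy A s p f + ennpow (L1_int f) p)"
    if A[measurable]: "A \<in> borel_measurable borel" and f[measurable]: "f \<in> borel_measurable borel" for A f
  proof -
    let ?m = "\<integral>\<^sup>+x. ennreal (norm (f x)) * indicator \<Omega> x \<partial>lborel"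
    define G where "G x = (\<integral>\<^sup>+y. ennreal (mag_kernel A s p f (x, y)) * indicator \<Omega> y \<partial>lborel)" for x
    have G[measurable]: "G \<in> borel_measurable borel" unfolding G_def[abs_def] by measurable
    have mG: "energy A s p f = (\<integral>\<^sup>+x. G x * indicator \<Omega> x \<partial>lborel)"
    proof -
      have "energy A s p f
        = (\<integral>\<^sup>+y. \<integral>\<^sup>+z. ennreal (mag_kernel A s p f (y, z)) * indicator (\<Omega> \<times> \<Omega>) (y, z) \<partial>lborel \<partial>lborel)"
        unfolding mag_int_def lborel_prod[symmetric] by (subst lborel.nn_integral_fst) auto
      also have "\<dots> = (\<integral>\<^sup>+x. G x * indicator \<Omega> x \<partial>lborel)"
        unfolding G_def by (intro nn_integral_cong) (auto simp: indicator_def)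
      finally show ?thesis .
    qed
    have pw: "ennreal (norm (f x) powr p) \<le> ennreal a * G x + ennreal (2 powr p * (1 / w) powr p) * ennpow ?m p" if x: "x \<in> \<Omega>" for x
    proof -
      let ?H = "\<lambda>y. ennpow (ennreal (\<rho> * mag_kernel A s p f (x, y))) (1 / p)"
      have H: "ennreal (norm (f x)) * indicator \<Omega> y \<le> (?H y + ennreal (norm (f y))) * indicator \<Omega> y" for y
      proof (cases "y \<in> \<Omega>")
        case True
        have "norm (f x) \<le> (\<rho> * mag_kernel A s p f (x, y)) powr (1 / p) + norm (f y)"
          unfolding \<rho>_def using p s R(2)[OF x True] by (intro norm_le_mag_kernel) auto
        then show ?thesis using True
          by (simp add: ennpow_ennreal \<rho>_def ennreal_plus[symmetric] ennreal_leI del: ennreal_plus)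
      qed simp
      have "ennreal (norm (f x)) = (\<integral>\<^sup>+y. ennreal (norm (f x)) \<partial>P)" by (simp add: P.emeasure_space_1)
      also have "\<dots> \<le> (\<integral>\<^sup>+y. ?H y + ennreal (norm (f y)) \<partial>P)"
      proof -
        have "(\<integral>\<^sup>+y. ennreal (norm (f x)) \<partial>P) = ennreal (1 / w) * (\<integral>\<^sup>+y. ennreal (norm (f x)) * indicator \<Omega> y \<partial>lborel)"
          by (rule P_int) measurable
        also have "\<dots> \<le> ennreal (1 / w) * (\<integral>\<^sup>+y. (?H y + ennreal (norm (f y))) * indicator \<Omega> y \<partial>lborel)"
          by (intro mult_left_mono nn_integral_mono H) auto
        also have "\<dots> = (\<integral>\<^sup>+y. ?H y + ennreal (norm (f y)) \<partial>P)"
          by (rule P_int[symmetric]) measurable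
        finally show ?thesis .
      qed
      also have "\<dots> = (\<integral>\<^sup>+y. ?H y \<partial>P) + (\<integral>\<^sup>+y. ennreal (norm (f y)) \<partial>P)"
        by (intro nn_integral_add) measurable
      finally have "ennpow (ennreal (norm (f x))) p \<le> ennpow ((\<integral>\<^sup>+y. ?H y \<partial>P) + (\<integral>\<^sup>+y. ennreal (norm (f y)) \<partial>P)) p"
        using p by (intro ennpow_mono) auto
      also have "\<dots> \<le> ennreal (2 powr p) * (ennpow (\<integral>\<^sup>+y. ?H y \<partial>P) p + ennpow (\<integral>\<^sup>+y. ennreal (norm (f y)) \<partial>P) p)"
        using p by (intro ennpow_add_le) auto
      also have "\<dots> \<le> ennreal (2 powr p) * (ennreal (2 powr p) * (\<integral>\<^sup>+y. ennpow (?H y) p \<partial>P) + ennpow (\<integral>\<^sup>+y. ennreal (norm (f y)) \<partial>P) p)"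
        using p by (intro mult_left_mono add_mono P.ennpow_nn_integral_le) auto
      also have "(\<integral>\<^sup>+y. ennpow (?H y) p \<partial>P) = ennreal (1 / w * \<rho>) * G x"
      proof -
        have "(\<integral>\<^sup>+y. ennpow (?H y) p \<partial>P) = (\<integral>\<^sup>+y. ennreal \<rho> * ennreal (mag_kernel A s p f (x, y)) \<partial>P)"
          using p by (intro nn_integral_cong) (simp add: ennpow_ennpow ennreal_mult \<rho>_def)
        also have "\<dots> = ennreal (1 / w) * (\<integral>\<^sup>+y. ennreal \<rho> * (ennreal (mag_kernel A s p f (x, y)) * indicator \<Omega> y) \<partial>lborel)"
          by (subst P_int) (auto simp: mult.assoc)
        also have "\<dots> = ennreal (1 / w) * (ennreal \<rho> * G x)"
          unfolding G_def by (subst nn_integral_cmult) auto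
        also have "\<dots> = ennreal (1 / w * \<rho>) * G x"
          using w0 by (subst ennreal_mult) (auto simp: \<rho>_def mult.assoc)
        finally show ?thesis .
      qed
      also have "(\<integral>\<^sup>+y. ennreal (norm (f y)) \<partial>P) = ennreal (1 / w) * ?m" by (rule P_int) measurable
      also have "ennpow (ennreal (1 / w) * ?m) p = ennreal ((1 / w) powr p) * ennpow ?m p"
        using w0 by (simp add: ennpow_mult ennpow_ennreal)
      finally have "ennreal (norm (f x) powr p) \<le> ennreal (2 powr p) * (ennreal (2 powr p) * (ennreal (1 / w * \<rho>) * G x) + ennreal ((1 / w) powr p) * ennpow ?m p)"
        by (simp add: ennpow_ennreal)
      also have "\<dots> = ennreal a * G x + ennreal (2 powr p * (1 / w) powr p) * ennpow ?m p"
      proof -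
        have \<rho>: "0 \<le> \<rho>" by (simp add: \<rho>_def)
        have e: "ennreal a = ennreal (2 powr p) * (ennreal (2 powr p) * ennreal (1 / w * \<rho>))"
          unfolding a_def using w0 \<rho> by (simp add: ennreal_mult[symmetric])
        have e': "ennreal (2 powr p * (1 / w) powr p) = ennreal (2 powr p) * ennreal ((1 / w) powr p)"
          by (rule ennreal_mult) auto
        show ?thesis unfolding e e' by (simp only: distrib_left mult.assoc)
      qed
      finally show ?thesis .
    qed
    have "Lp_int p f
      \<le> (\<integral>\<^sup>+x. ennreal a * (G x * indicator \<Omega> x) + (ennreal (2 powr p * (1 / w) powr p) * ennpow ?m p) * indicator \<Omega> x \<partial>lborel)"
      using pw by (intro nn_integral_mono) (auto split: split_indicator)
    also have "\<dots> = ennreal a * energy A s p f + (ennreal (2 powr p * (1 / w) powr p) * ennpow ?m p) * ennreal w"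
      unfolding mG w(1)[symmetric] by (simp add: nn_integral_add nn_integral_cmult nn_integral_cmult_indicator)
    also have "\<dots> = ennreal a * energy A s p f + ennreal b * ennpow ?m p"
      using w0 by (simp add: b_def ennreal_mult mult_ac)
    also have "\<dots> \<le> ennreal (a + b) * (energy A s p f + ennpow ?m p)"
      using ab by (auto simp: distrib_left distrib_right intro!: add_mono add_increasing2 add_increasing)
    finally show ?thesis .
  qed
  moreover have "0 \<le> a + b" using ab by simp
  ultimately show thesis using that by blast
qed

end

section \<open>Lower semicontinuity and scaling\<close>

lemma mag_kernel_tendsto:
  assumes "0 < p" "(\<lambda>n. F n x) \<longlonglongrightarrow> g x" "(\<lambda>n. F n y) \<longlonglongrightarrow> g y"
  shows "(\<lambda>n. mag_kernel A s p (F n) (x, y)) \<longlonglongrightarrow> mag_kernel A s p g (x, y)"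
proof -
  let ?c = "exp (\<i> * complex_of_real ((x - y) \<bullet> A (midpoint x y)))"
  have "(\<lambda>n. norm (F n x - ?c * F n y)) \<longlonglongrightarrow> norm (g x - ?c * g y)"
    using assms by (intro tendsto_intros)
  then have "(\<lambda>n. norm (F n x - ?c * F n y) powr p) \<longlonglongrightarrow> norm (g x - ?c * g y) powr p"
    using assms(1) by (intro tendsto_powr' tendsto_const) auto
  then show ?thesis unfolding mag_kernel_def divide_inverse prod.case by (rule tendsto_mult_right)
qed

text \<open>The condition involves neither s nor p, so positivity passes from the exponent p to the
  exponent r.\<close>

lemma mag_kernel_pos_iff: "0 < mag_kernel A s p f z \<longleftrightarrow>
   fst z \<noteq> snd z \<and> f (fst z) \<noteq> exp (\<i> * complex_of_real ((fst z - snd z) \<bullet> A (midpoint (fst z) (snd z)))) * f (snd z)"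
  by (cases z) (auto simp: mag_kernel_def zero_less_divide_iff)

lemma suminf_ennreal_imp_tendsto_0:
  fixes h :: "nat \<Rightarrow> real"
  assumes "\<And>n. 0 \<le> h n" "(\<Sum>n. ennreal (h n)) \<noteq> \<infinity>"
  shows "h \<longlonglongrightarrow> 0"
  using assms by (intro summable_LIMSEQ_zero summable_suminf_not_top) auto

text \<open>The two hypotheses concern different exponents. Summability forces the r-kernels, cut
  off to the complement, to 0 at almost every pair, while the uncut r-kernels have a positive limit
  wherever the p-kernel of g is positive. Such a pair eventually leaves the complement, and Fatou's
  lemma applies with exponent p on \<open>\<Lambda> n \<times> \<Lambda> n\<close>.\<close>

lemma mag_int_Fatou:
  fixes \<Omega> :: "(real^'n) set"
  assumes pr: "0 < p" "0 < r" and A[measurable]: "A \<in> borel_measurable borel"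
    and F[measurable]: "\<And>n. F n \<in> borel_measurable borel" and g[measurable]: "g \<in> borel_measurable borel"
    and \<Omega>[measurable]: "\<Omega> \<times> \<Omega> \<in> sets borel" and \<Lambda>[measurable]: "\<And>n. \<Lambda> n \<times> \<Lambda> n \<in> sets borel" and "\<And>n. \<Lambda> n \<subseteq> \<Omega>"
    and lim: "AE x in lborel. x \<in> \<Omega> \<longrightarrow> (\<lambda>n. F n x) \<longlonglongrightarrow> g x"
    and rest: "(\<Sum>n. mag_int (\<Omega> \<times> \<Omega> - \<Lambda> n \<times> \<Lambda> n) A s r (F n)) < \<infinity>"
    and le: "\<And>n. mag_int (\<Lambda> n \<times> \<Lambda> n) A s p (F n) \<le> c"
  shows "mag_int (\<Omega> \<times> \<Omega>) A s p g \<le> c"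
proof -
  let ?D = "\<lambda>n. \<Omega> \<times> \<Omega> - \<Lambda> n \<times> \<Lambda> n"
  have [measurable]: "?D n \<in> sets borel" for n by measurable
  have eqm: "ennreal (mag_kernel A s q f z) * indicator D z = ennreal (mag_kernel A s q f z * indicator D z)" for q f z D
    by (auto split: split_indicator)
  have "(\<integral>\<^sup>+z. (\<Sum>n. ennreal (mag_kernel A s r (F n) z * indicator (?D n) z)) \<partial>lborel)
      = (\<Sum>n. mag_int (?D n) A s r (F n))"
    unfolding mag_int_def eqm by (rule nn_integral_suminf) measurable
  then have "AE z in lborel. (\<Sum>n. ennreal (mag_kernel A s r (F n) z * indicator (?D n) z)) \<noteq> \<infinity>"
    using rest by (intro nn_integral_PInf_AE) auto
  then have AE: "AE z in lborel. ennreal (mag_kernel A s p g z) * indicator (\<Omega> \<times> \<Omega>) z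
     \<le> liminf (\<lambda>n. ennreal (mag_kernel A s p (F n) z) * indicator (\<Lambda> n \<times> \<Lambda> n) z)"
    using AE_lborel_pair[OF lim]
  proof eventually_elim
    case (elim z)
    show ?case
    proof (cases "z \<in> \<Omega> \<times> \<Omega> \<and> 0 < mag_kernel A s p g z")
      case True
      then have "(\<lambda>n. F n (fst z)) \<longlonglongrightarrow> g (fst z)" "(\<lambda>n. F n (snd z)) \<longlonglongrightarrow> g (snd z)"
        using elim(2) by (auto simp: mem_Times_iff)
      then have conv: "(\<lambda>n. mag_kernel A s q (F n) z) \<longlonglongrightarrow> mag_kernel A s q g z" if "0 < q" for q
        using mag_kernel_tendsto[OF that, of F "fst z" g "snd z" A s] by simp
      have pos: "0 < mag_kernel A s r g z" using True unfolding mag_kernel_pos_iff by simp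
      have "(\<lambda>n. mag_kernel A s r (F n) z * indicator (?D n) z) \<longlonglongrightarrow> 0"
        by (rule suminf_ennreal_imp_tendsto_0[OF _ elim(1)]) simp
      \<comment> \<open>Half of the limit separates the two behaviours: a pair still in the
        complement would have its r-kernel both below and above this value.\<close>
      then have "\<forall>\<^sub>F n in sequentially. mag_kernel A s r (F n) z * indicator (?D n) z < mag_kernel A s r g z / 2"
        using pos by (intro order_tendstoD) auto
      moreover have "\<forall>\<^sub>F n in sequentially. mag_kernel A s r g z / 2 < mag_kernel A s r (F n) z"
        using pos by (intro order_tendstoD[OF conv[OF pr(2)]]) auto
      ultimately have "\<forall>\<^sub>F n in sequentially. z \<in> \<Lambda> n \<times> \<Lambda> n"
      proof eventually_elim
        case (elim n)
        then show ?case using True by (cases "z \<in> \<Lambda> n \<times> \<Lambda> n") auto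
      qed
      then have ev: "\<forall>\<^sub>F n in sequentially. ennreal (mag_kernel A s p (F n) z) = ennreal (mag_kernel A s p (F n) z) * indicator (\<Lambda> n \<times> \<Lambda> n) z"
        by eventually_elim simp
      have "(\<lambda>n. ennreal (mag_kernel A s p (F n) z)) \<longlonglongrightarrow> ennreal (mag_kernel A s p g z)"
        by (intro tendsto_ennrealI conv pr)
      then have "(\<lambda>n. ennreal (mag_kernel A s p (F n) z) * indicator (\<Lambda> n \<times> \<Lambda> n) z) \<longlonglongrightarrow> ennreal (mag_kernel A s p g z)"
        by (rule Lim_transform_eventually[OF _ ev])
      then have "liminf (\<lambda>n. ennreal (mag_kernel A s p (F n) z) * indicator (\<Lambda> n \<times> \<Lambda> n) z) = ennreal (mag_kernel A s p g z)"
        by (rule lim_imp_Liminf[OF sequentially_bot])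
      then show ?thesis using True by simp
    next
      case False
      then have "ennreal (mag_kernel A s p g z) * indicator (\<Omega> \<times> \<Omega>) z = 0"
        using mag_kernel_nonneg[of A s p g z] by (auto split: split_indicator)
      then show ?thesis by (simp only: zero_le)
    qed
  qed
  have "mag_int (\<Omega> \<times> \<Omega>) A s p g \<le> (\<integral>\<^sup>+z. liminf (\<lambda>n. ennreal (mag_kernel A s p (F n) z) * indicator (\<Lambda> n \<times> \<Lambda> n) z) \<partial>lborel)"
    unfolding mag_int_def by (intro nn_integral_mono_AE AE)
  also have "\<dots> \<le> liminf (\<lambda>n. mag_int (\<Lambda> n \<times> \<Lambda> n) A s p (F n))"
    unfolding mag_int_def by (rule nn_integral_liminf) measurable
  also have "\<dots> \<le> c"
    by (rule order_trans[OF Liminf_le_Limsup Limsup_bounded]) (use le in auto)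
  finally show ?thesis .
qed

lemma mag_kernel_cmult: "mag_kernel A s p (\<lambda>x. c * f x) z = norm c powr p * mag_kernel A s p f z"
proof (cases z)
  case (Pair x y)
  let ?e = "exp (\<i> * complex_of_real ((x - y) \<bullet> A (midpoint x y)))"
  have "c * f x - ?e * (c * f y) = c * (f x - ?e * f y)" by (simp add: algebra_simps)
  then have "norm (c * f x - ?e * (c * f y)) = norm c * norm (f x - ?e * f y)" by (simp only: norm_mult)
  then show ?thesis by (simp add: Pair mag_kernel_def powr_mult)
qed

lemma mag_int_cmult:
  assumes [measurable]: "A \<in> borel_measurable borel" "f \<in> borel_measurable borel" "D \<in> sets borel"
  shows "mag_int D A s p (\<lambda>x. c * f x) = ennreal (norm c powr p) * mag_int D A s p f"
  unfolding mag_int_def mag_kernel_cmult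
  by (subst nn_integral_cmult[symmetric]) (auto simp: ennreal_mult mult.assoc)

text \<open>The inequalities are strict, so the order can be lowered slightly. In both cases with
  finite q the hypothesis amounts to n/Q + s - n/r > 0.\<close>

lemma subcritical_smaller_order:
  assumes s: "0 < s" and r: "1 \<le> r" and q: "1 \<le> q" and "s < real n"
    and cond: "(r = 1 \<and> q < ennreal (real n / (real n - s)))
       \<or> (s * r > real n \<and> q = \<infinity>)
       \<or> (q < ennreal (real n * r / (real n - s * r)) \<and> s * r < real n)"
  obtains s' where "0 < s'" "s' < s" "subcritical n q s' r"
proof -
  note result = that
  have fin: thesis if Q: "q = ennreal Q" and pos: "0 < real n / Q + s - real n / r" for Q
  proof -
    have "1 \<le> Q" using q Q by (simp add: ennreal_ge_1)
    define e where "e = real n / Q - real n / r"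
    have e: "0 < e + s" using pos by (simp add: e_def)
    \<comment> \<open>Here e + s is the slack of the inequality; s' gives up at most half of it and
      stays at least s / 2.\<close>
    define s' where "s' = max (s / 2) (s - (e + s) / 2)"
    have "s / 2 \<le> s'" "s - (e + s) / 2 \<le> s'" by (simp_all add: s'_def)
    then have "0 < s'" "0 < e + s'" using s e by (linarith, argo)
    moreover have "s' < s" unfolding s'_def using s e by simp
    ultimately have "0 < s'" "s' < s" "0 < real n / Q + s' - real n / r" by (simp_all add: e_def)
    then show thesis using Q \<open>1 \<le> Q\<close> by (intro result[of s']) (auto simp: subcritical_def)
  qed
  from cond show thesis
  proof (elim disjE conjE)
    assume "r = 1" and qlt: "q < ennreal (real n / (real n - s))"
    then obtain Q where Q: "q = ennreal Q" "0 \<le> Q" by (cases q) auto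
    then have "1 \<le> Q" using q by (simp add: ennreal_ge_1)
    have "Q < real n / (real n - s)" using qlt Q by (auto simp: ennreal_less_iff)
    then have "real n - s < real n / Q" using \<open>1 \<le> Q\<close> \<open>s < real n\<close> by (simp add: field_simps)
    then show thesis using Q \<open>r = 1\<close> by (intro fin) auto
  next
    assume sr: "real n < s * r" and "q = \<infinity>"
    define e where "e = real n / r"
    define s' where "s' = (s + e) / 2"
    have "0 \<le> e" "e < s" using sr r by (auto simp: e_def field_simps)
    then have "0 < s'" "s' < s" "e < s'" using s by (auto simp: s'_def)
    moreover from this have "real n < s' * r" using r by (simp add: e_def field_simps)
    ultimately show thesis using \<open>q = \<infinity>\<close> by (intro that[of s']) (auto simp: subcritical_def)
  next
    assume qlt: "q < ennreal (real n * r / (real n - s * r))" and sr: "s * r < real n"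
    then obtain Q where Q: "q = ennreal Q" "0 \<le> Q" by (cases q) auto
    then have "1 \<le> Q" using q by (simp add: ennreal_ge_1)
    have "Q < real n * r / (real n - s * r)" using qlt Q by (auto simp: ennreal_less_iff)
    then have "Q * (real n - s * r) < real n * r" using sr by (simp add: field_simps)
    then have "(real n - s * r) / r < real n / Q" using \<open>1 \<le> Q\<close> r by (simp add: field_simps)
    then show thesis using Q r by (intro fin) (auto simp: diff_divide_distrib)
  qed
qed

section \<open>The localised inequality\<close>

text \<open>A is the given field, which enters the energy and the ground states; A' is a Borel
  representative bounded everywhere, with which the integrals are computed. The order s' is lowered
  so that q is still subcritical for it.\<close>

locale magnetic_setting = corkscrew_scales \<Omega> \<kappa> t0 \<zeta>
  for \<Omega> :: "(real^'n) set" and \<kappa> t0 \<zeta> +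
  fixes A A' :: "real^'n \<Rightarrow> real^'n" and a s s' p r :: real and q :: ennreal
  assumes A'_measurable [measurable]: "A' \<in> borel_measurable borel"
    and A'_AE: "AE x in lborel. x \<in> convex hull \<Omega> \<longrightarrow> A x = A' x"
    and A'_bound: "\<And>x. norm (A' x) \<le> a"
    and s'_pos: "0 < s'" and s'_less: "s' < s" and s_less: "s < 1"
    and q_ge: "1 \<le> q" and r_ge: "1 \<le> r" and r_less: "r < p"
    and subcritical: "subcritical CARD('n) q s' r"
begin

abbreviation "FS \<equiv> frac_sobolev \<Omega> s p"
abbreviation "gs \<equiv> ground_states \<Omega> A s p q"

lemma p_facts: "0 < p" "1 \<le> p" "0 < r" "0 < s" "0 \<le> a"
  using r_ge r_less s'_pos s'_less order_trans[OF norm_ge_zero A'_bound] by auto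

lemma FS_measurable: "f \<in> FS \<Longrightarrow> f \<in> borel_measurable (lebesgue_on \<Omega>)"
  by (simp add: frac_sobolev_def)

lemma Lnorm_representative:
  assumes "1 \<le> q'" "f \<in> borel_measurable (lebesgue_on \<Omega>)" "f' \<in> borel_measurable borel" "AE x in lborel. x \<in> \<Omega> \<longrightarrow> f x = f' x"
  shows "Lnorm \<Omega> q' f = Lnorm \<Omega> q' f'"
  using assms by (intro Lnorm_cong_AE) (auto simp: AE_lebesgue_on_iff[OF \<Omega>_lebesgue] intro: borel_imp_lebesgue_on)

lemma mag_double_representative:
  assumes f': "AE x in lborel. x \<in> \<Omega> \<longrightarrow> f x = f' x" and \<Lambda>: "\<Lambda> \<subseteq> \<Omega>" "\<Lambda>' \<subseteq> \<Omega>" "\<Lambda>' \<in> sets borel" "AE x in lborel. x \<in> \<Lambda> \<longleftrightarrow> x \<in> \<Lambda>'"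
  shows "mag_double (\<Lambda> \<times> \<Lambda>) A s q' f = ennpow (mag_int (\<Lambda>' \<times> \<Lambda>') A' s q' f') (1 / q')"
    and "mag_double (\<Omega> \<times> \<Omega> - \<Lambda> \<times> \<Lambda>) A s q' f = ennpow (mag_int (\<Omega> \<times> \<Omega> - \<Lambda>' \<times> \<Lambda>') A' s q' f') (1 / q')"
proof -
  have [measurable]: "\<Lambda>' \<times> \<Lambda>' \<in> sets borel" using \<Lambda>(3) by (metis borel_prod pair_measureI)
  have AE: "AE z in lborel. (z \<in> \<Lambda> \<times> \<Lambda>) = (z \<in> \<Lambda>' \<times> \<Lambda>')"
    using AE_lborel_pair[OF \<Lambda>(4)]
  proof eventually_elim
    case (elim z)
    then show ?case by (cases z) auto
  qed
  show "mag_double (\<Lambda> \<times> \<Lambda>) A s q' f = ennpow (mag_int (\<Lambda>' \<times> \<Lambda>') A' s q' f') (1 / q')"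
    by (rule mag_double_eq_mag_int[OF f' A'_AE]) (use \<Lambda> AE in auto)
  have AE': "AE z in lborel. (z \<in> \<Omega> \<times> \<Omega> - \<Lambda> \<times> \<Lambda>) = (z \<in> \<Omega> \<times> \<Omega> - \<Lambda>' \<times> \<Lambda>')"
    using AE by eventually_elim blast
  show "mag_double (\<Omega> \<times> \<Omega> - \<Lambda> \<times> \<Lambda>) A s q' f = ennpow (mag_int (\<Omega> \<times> \<Omega> - \<Lambda>' \<times> \<Lambda>') A' s q' f') (1 / q')"
    by (rule mag_double_eq_mag_int[OF f' A'_AE _ _ AE']) (use \<Lambda> in auto)
qed

lemma mag_seminorm_representative:
  assumes f': "AE x in lborel. x \<in> \<Omega> \<longrightarrow> f x = f' x"
  shows "mag_seminorm \<Omega> A s q' f = ennpow (energy A' s q' f') (1 / q')"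
    and "mag_seminorm \<Omega> (\<lambda>_. 0) s q' f = ennpow (energy (\<lambda>_. 0) s q' f') (1 / q')"
  unfolding mag_seminorm_def
  by (rule mag_double_eq_mag_int[OF f']; use A'_AE in simp)+

lemma FS_representative:
  assumes "f \<in> FS"
  obtains f' where "f' \<in> borel_measurable borel" "AE x in lborel. x \<in> \<Omega> \<longrightarrow> f x = f' x"
    "Lp_int p f' < \<infinity>" "energy (\<lambda>_. 0) s p f' < \<infinity>"
proof -
  obtain f' where f': "f' \<in> borel_measurable borel" "AE x in lborel. x \<in> \<Omega> \<longrightarrow> f x = f' x"
    by (rule borel_representative[OF \<Omega>_lebesgue FS_measurable[OF assms]])
  have "Lnorm \<Omega> (ennreal p) f' < \<infinity>"
    using assms Lnorm_representative[OF _ FS_measurable[OF assms] f', of "ennreal p"] p_facts by (simp add: frac_sobolev_def)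
  then have "Lp_int p f' < \<infinity>"
    using p_facts by (simp add: Lnorm_real nn_integral_\<Omega>)
  moreover have "energy (\<lambda>_. 0) s p f' < \<infinity>"
    using assms mag_seminorm_representative(2)[OF f'(2), of p] by (simp add: frac_sobolev_def)
  ultimately show thesis using f' by (intro that)
qed

lemma FS_I:
  assumes "f \<in> borel_measurable borel"
    "Lp_int p f < \<infinity>" "energy (\<lambda>_. 0) s p f < \<infinity>"
  shows "f \<in> FS"
  using assms p_facts mag_seminorm_representative(2)[of f f p]
  by (auto simp: frac_sobolev_def Lnorm_real nn_integral_\<Omega> intro: borel_imp_lebesgue_on)

lemma L1_finite:
  fixes f :: "real^'n \<Rightarrow> complex"
  assumes [measurable]: "f \<in> borel_measurable borel"
    and Lp: "Lp_int p f < \<infinity>"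
  shows "L1_int f < \<infinity>"
proof -
  have "(\<integral>\<^sup>+x. ennreal (norm (f x)) \<partial>lebesgue_on \<Omega>) \<le> (emeasure lebesgue \<Omega> + 1) * Lnorm \<Omega> (ennreal p) f"
    using p_facts by (intro L1_le_Lnorm \<Omega>_lebesgue borel_imp_lebesgue_on) auto
  also have "\<dots> < \<infinity>"
    using Lp p_facts emeasure_\<Omega> by (simp add: Lnorm_real nn_integral_\<Omega> ennreal_mult_less_top ennreal_one_less_top)
  finally show ?thesis by (simp add: nn_integral_\<Omega>)
qed

text \<open>Splitting with \<Lambda> = \<Omega> leaves no complement, so f has finite energy of
  order s' and exponent r, for which \<open>Lnorm_finite\<close> gives a finite L^q norm.\<close>

lemma Lnorm_FS_finite:
  assumes "f \<in> FS"
  shows "Lnorm \<Omega> q f < \<infinity>"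
proof -
  obtain f' where f': "f' \<in> borel_measurable borel" "AE x in lborel. x \<in> \<Omega> \<longrightarrow> f x = f' x"
    "Lp_int p f' < \<infinity>" "energy (\<lambda>_. 0) s p f' < \<infinity>"
    by (rule FS_representative[OF assms])
  have "energy (\<lambda>_. 0) s' r f' < \<infinity>"
  proof (rule mag_int_split_le[OF p_facts(3) r_less s'_less])
    fix K c :: real
    assume le: "\<And>A f \<Lambda>. A \<in> borel_measurable borel \<Longrightarrow> f \<in> borel_measurable borel \<Longrightarrow> \<Lambda> \<in> sets borel \<Longrightarrow> \<Lambda> \<subseteq> \<Omega> \<Longrightarrow>
      energy A s' r f \<le> mag_int (\<Lambda> \<times> \<Lambda>) A s p f + ennreal K + ennreal c * mag_int (\<Omega> \<times> \<Omega> - \<Lambda> \<times> \<Lambda>) A s r f"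
    have "mag_int (\<Omega> \<times> \<Omega> - \<Omega> \<times> \<Omega>) (\<lambda>_. 0) s r f' = 0" by (simp add: mag_int_def)
    then show ?thesis
      using le[of "\<lambda>_. 0" f' \<Omega>] f' by (auto simp: ennreal_add_less_top intro: le_less_trans)
  qed
  then have "Lnorm \<Omega> q f' < \<infinity>"
    using f' by (intro Lnorm_finite[OF q_ge subcritical s'_pos r_ge] L1_finite) auto
  then show ?thesis using Lnorm_representative[OF q_ge FS_measurable[OF assms] f'(1,2)] by simp
qed

text \<open>\<open>FS\<close> is defined by the energy without field; passing to the bounded field
  costs a constant factor and the L^p norm.\<close>

lemma mag_seminorm_FS_finite:
  assumes "f \<in> FS"
  shows "mag_seminorm \<Omega> A s p f < \<infinity>"
proof -
  obtain f' where f': "f' \<in> borel_measurable borel" "AE x in lborel. x \<in> \<Omega> \<longrightarrow> f x = f' x"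
    "Lp_int p f' < \<infinity>" "energy (\<lambda>_. 0) s p f' < \<infinity>"
    by (rule FS_representative[OF assms])
  have "energy A' s p f' < \<infinity>"
  proof (rule mag_int_change_field[OF p_facts(1) s_less, of a])
    fix C :: real
    assume le: "\<And>A A' f. A \<in> borel_measurable borel \<Longrightarrow> A' \<in> borel_measurable borel \<Longrightarrow> f \<in> borel_measurable borel \<Longrightarrow>
      (\<And>x. norm (A x) \<le> a) \<Longrightarrow> (\<And>x. norm (A' x) \<le> a) \<Longrightarrow>
      energy A s p f \<le> ennreal C * (energy A' s p f + Lp_int p f)"
    have "energy A' s p f' \<le> ennreal C * (energy (\<lambda>_. 0) s p f' + Lp_int p f')"
      using A'_bound p_facts f'(1) by (intro le) auto
    also have "\<dots> < \<infinity>" using f' by (simp add: ennreal_mult_less_top ennreal_add_less_top)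
    finally show ?thesis .
  qed
  then show ?thesis using mag_seminorm_representative(1)[OF f'(2), of p] by simp
qed

lemma FS_cmult:
  assumes "f \<in> FS"
  shows "(\<lambda>x. c * f x) \<in> FS" "mag_seminorm \<Omega> A s p (\<lambda>x. c * f x) = ennreal (norm c) * mag_seminorm \<Omega> A s p f"
proof -
  obtain f' where f'[measurable]: "f' \<in> borel_measurable borel" and f'2: "AE x in lborel. x \<in> \<Omega> \<longrightarrow> f x = f' x"
    by (rule FS_representative[OF assms])
  have AE: "AE x in lborel. x \<in> \<Omega> \<longrightarrow> c * f x = c * f' x" using f'2 by eventually_elim simp
  have hom: "ennpow (ennreal (norm c powr p) * X) (1 / p) = ennreal (norm c) * ennpow X (1 / p)" for X
    using p_facts by (simp add: ennpow_mult ennpow_ennreal powr_powr)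
  have "mag_seminorm \<Omega> (\<lambda>_. 0) s p (\<lambda>x. c * f x) = ennreal (norm c) * mag_seminorm \<Omega> (\<lambda>_. 0) s p f"
    unfolding mag_seminorm_representative(2)[OF AE] mag_seminorm_representative(2)[OF f'2]
    by (subst mag_int_cmult) (auto simp: hom)
  moreover have "Lnorm \<Omega> (ennreal p) (\<lambda>x. c * f x) = ennreal (norm c) * Lnorm \<Omega> (ennreal p) f"
    using p_facts FS_measurable[OF assms] by (intro Lnorm_cmult) auto
  ultimately show "(\<lambda>x. c * f x) \<in> FS"
    using assms by (auto simp: frac_sobolev_def ennreal_mult_less_top)
  show "mag_seminorm \<Omega> A s p (\<lambda>x. c * f x) = ennreal (norm c) * mag_seminorm \<Omega> A s p f"
    unfolding mag_seminorm_representative(1)[OF AE] mag_seminorm_representative(1)[OF f'2]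
    by (subst mag_int_cmult) (auto simp: hom)
qed

lemma Lnorm_pos_iff: "f \<in> FS \<Longrightarrow> 0 < Lnorm \<Omega> q f \<longleftrightarrow> f \<in> frac_sobolev_nz \<Omega> s p"
  using Lnorm_eq_0_iff[OF q_ge FS_measurable] by (auto simp: frac_sobolev_nz_def zero_less_iff_neq_zero)

text \<open>The quotient is invariant under scaling. This is what lets \<open>normalise\<close>
  rescale the distance condition.\<close>

lemma ground_states_cmult:
  assumes \<phi>: "\<phi> \<in> gs" and c: "c \<noteq> 0"
  shows "(\<lambda>x. c * \<phi> x) \<in> gs"
proof -
  have FS: "\<phi> \<in> FS" "\<phi> \<in> frac_sobolev_nz \<Omega> s p" using \<phi> by (auto simp: ground_states_def frac_sobolev_nz_def)
  obtain l where l: "Lnorm \<Omega> q \<phi> = ennreal l" "0 < l"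
    using Lnorm_FS_finite[OF FS(1)] Lnorm_pos_iff[OF FS(1)] FS(2) by (cases "Lnorm \<Omega> q \<phi>") auto
  obtain x where x: "mag_seminorm \<Omega> A s p \<phi> = ennreal x" "0 \<le> x"
    using mag_seminorm_FS_finite[OF FS(1)] by (cases "mag_seminorm \<Omega> A s p \<phi>") auto
  have L: "Lnorm \<Omega> q (\<lambda>x. c * \<phi> x) = ennreal (norm c * l)"
    using Lnorm_cmult[OF q_ge FS_measurable[OF FS(1)], of c] l by (simp add: ennreal_mult)
  have M: "mag_seminorm \<Omega> A s p (\<lambda>x. c * \<phi> x) = ennreal (norm c * x)"
    using FS_cmult(2)[OF FS(1), of c] x by (simp add: ennreal_mult)
  have "mag_seminorm \<Omega> A s p (\<lambda>x. c * \<phi> x) / Lnorm \<Omega> q (\<lambda>x. c * \<phi> x) = mag_seminorm \<Omega> A s p \<phi> / Lnorm \<Omega> q \<phi>"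
    unfolding L M using c l x by (simp add: divide_ennreal)
  moreover have "(\<lambda>x. c * \<phi> x) \<in> frac_sobolev_nz \<Omega> s p"
    using Lnorm_pos_iff[OF FS_cmult(1)[OF FS(1), of c]] L c l by simp
  ultimately show ?thesis using \<phi> by (simp add: ground_states_def)
qed

text \<open>Division by the L^q norm together with the passage to Borel representatives. Either term
  on the left of the strict inequality is bounded separately, and dividing the second one by C
  produces c0 / C.\<close>

lemma normalise:
  assumes f: "f \<in> FS" and \<Lambda>: "\<Lambda> \<in> sets lebesgue" "\<Lambda> \<subseteq> \<Omega>" and C: "0 < C" and c0: "0 \<le> c0"
    and dist: "ennreal \<delta> * Lnorm \<Omega> q f \<le> ground_dist \<Omega> A s p q f"
    and less: "mag_double (\<Lambda> \<times> \<Lambda>) A s p f + ennreal C * mag_double (\<Omega> \<times> \<Omega> - \<Lambda> \<times> \<Lambda>) A s r f < ennreal c0 * Lnorm \<Omega> q f"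
  obtains g \<Lambda>' where "g \<in> borel_measurable borel" "\<Lambda>' \<in> sets borel" "\<Lambda>' \<subseteq> \<Omega>" "Lnorm \<Omega> q g = 1"
    "mag_int (\<Lambda>' \<times> \<Lambda>') A' s p g \<le> ennreal (c0 powr p)"
    "mag_int (\<Omega> \<times> \<Omega> - \<Lambda>' \<times> \<Lambda>') A' s r g \<le> ennreal ((c0 / C) powr r)"
    "\<And>\<phi>. \<phi> \<in> gs \<Longrightarrow> ennreal \<delta> \<le> Lnorm \<Omega> q (\<lambda>x. g x - \<phi> x)"
proof -
  \<comment> \<open>The strict inequality excludes a zero norm, so f can be normalised.\<close>
  have "0 < Lnorm \<Omega> q f" using less by (auto simp: zero_less_iff_neq_zero)
  then obtain l where l: "Lnorm \<Omega> q f = ennreal l" "0 < l"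
    using Lnorm_FS_finite[OF f] by (cases "Lnorm \<Omega> q f") auto
  obtain f' where f'[measurable]: "f' \<in> borel_measurable borel" and f'2: "AE x in lborel. x \<in> \<Omega> \<longrightarrow> f x = f' x"
    by (rule FS_representative[OF f])
  obtain \<Lambda>' where \<Lambda>': "\<Lambda>' \<in> sets borel" "AE x in lborel. x \<in> \<Lambda> \<longleftrightarrow> x \<in> \<Lambda>'" "\<Lambda>' \<subseteq> \<Lambda>"
    by (rule borel_set_representative[OF \<Lambda>(1)])
  have \<Lambda>'\<Omega>: "\<Lambda>' \<subseteq> \<Omega>" using \<Lambda>' \<Lambda> by blast
  have [measurable]: "\<Lambda>' \<times> \<Lambda>' \<in> sets borel" using \<Lambda>'(1) by (metis borel_prod pair_measureI)
  have [measurable]: "\<Omega> \<times> \<Omega> - \<Lambda>' \<times> \<Lambda>' \<in> sets borel" by measurable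
  define g where "g x = complex_of_real (1 / l) * f' x" for x
  have g[measurable]: "g \<in> borel_measurable borel" unfolding g_def[abs_def] by measurable
  note less_l = less[unfolded l(1)]
  have "mag_double (\<Lambda> \<times> \<Lambda>) A s p f \<le> ennreal c0 * ennreal l"
    by (rule order_trans[OF _ less_imp_le[OF less_l]]) simp
  then have 1: "mag_int (\<Lambda>' \<times> \<Lambda>') A' s p f' \<le> ennreal ((c0 * l) powr p)"
    unfolding mag_double_representative(1)[OF f'2 \<Lambda>(2) \<Lambda>'\<Omega> \<Lambda>'(1,2)] ennpow_root_le_iff[OF p_facts(1)]
    using c0 l by (simp add: ennreal_mult[symmetric] ennpow_ennreal)
  have "ennreal C * mag_double (\<Omega> \<times> \<Omega> - \<Lambda> \<times> \<Lambda>) A s r f \<le> ennreal c0 * ennreal l"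
    by (rule order_trans[OF _ less_imp_le[OF less_l]]) simp
  then have "ennreal (1 / C) * (ennreal C * mag_double (\<Omega> \<times> \<Omega> - \<Lambda> \<times> \<Lambda>) A s r f) \<le> ennreal (1 / C) * (ennreal c0 * ennreal l)"
    by (intro mult_left_mono) auto
  then have "mag_double (\<Omega> \<times> \<Omega> - \<Lambda> \<times> \<Lambda>) A s r f \<le> ennreal (c0 / C * l)"
    using C c0 l by (simp add: mult.assoc[symmetric] ennreal_mult[symmetric])
  then have 2: "mag_int (\<Omega> \<times> \<Omega> - \<Lambda>' \<times> \<Lambda>') A' s r f' \<le> ennreal ((c0 / C * l) powr r)"
    unfolding mag_double_representative(2)[OF f'2 \<Lambda>(2) \<Lambda>'\<Omega> \<Lambda>'(1,2)] ennpow_root_le_iff[OF p_facts(3)]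
    using c0 l C by (simp add: ennpow_ennreal)
  have scale: "ennreal (norm (complex_of_real (1 / l)) powr e) * X \<le> ennreal (b powr e)"
    if "X \<le> ennreal ((b * l) powr e)" "0 \<le> b" for X b e
  proof -
    have "ennreal (norm (complex_of_real (1 / l)) powr e) * X \<le> ennreal ((1 / l) powr e) * ennreal ((b * l) powr e)"
      using that l by (intro mult_mono) (auto simp: norm_divide)
    also have "\<dots> = ennreal ((1 / l * (b * l)) powr e)"
      unfolding powr_mult[of "1 / l" "b * l"] by (rule ennreal_mult[symmetric]) auto
    also have "1 / l * (b * l) = b" using l by simp
    finally show ?thesis .
  qed
  show thesis
  proof (rule that[OF g \<Lambda>'(1) \<Lambda>'\<Omega>])
    have "Lnorm \<Omega> q f' = ennreal l" using Lnorm_representative[OF q_ge FS_measurable[OF f] f' f'2] l by simp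
    then show "Lnorm \<Omega> q g = 1"
      unfolding g_def using l by (subst Lnorm_cmult[OF q_ge]) (auto intro: borel_imp_lebesgue_on simp: ennreal_mult[symmetric] norm_divide)
    show "mag_int (\<Lambda>' \<times> \<Lambda>') A' s p g \<le> ennreal (c0 powr p)"
      unfolding g_def[abs_def] using scale[OF 1 c0] by (subst mag_int_cmult) auto
    show "mag_int (\<Omega> \<times> \<Omega> - \<Lambda>' \<times> \<Lambda>') A' s r g \<le> ennreal ((c0 / C) powr r)"
      unfolding g_def[abs_def] using scale[OF 2] c0 C by (subst mag_int_cmult) auto
    fix \<phi> assume \<phi>: "\<phi> \<in> gs"
    then have \<phi>FS: "\<phi> \<in> FS" by (auto simp: ground_states_def frac_sobolev_nz_def)
    note [measurable] = FS_measurable[OF \<phi>FS] FS_measurable[OF f] borel_imp_lebesgue_on[OF g]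
    \<comment> \<open>The multiple l \<phi> is again a ground state and hence competes in the
      distance of f.\<close>
    have "ennreal \<delta> * ennreal l \<le> Lnorm \<Omega> q (\<lambda>x. f x - complex_of_real l * \<phi> x)"
      using dist ground_states_cmult[OF \<phi>, of "complex_of_real l"] l
      unfolding ground_dist_def by (auto intro: order_trans[OF _ INF_lower])
    also have "\<dots> = Lnorm \<Omega> q (\<lambda>x. complex_of_real l * (g x - \<phi> x))"
    proof (rule Lnorm_cong_AE[OF q_ge])
      show "AE x in lebesgue_on \<Omega>. f x - complex_of_real l * \<phi> x = complex_of_real l * (g x - \<phi> x)"
        unfolding AE_lebesgue_on_iff[OF \<Omega>_lebesgue] using f'2
        by eventually_elim (use l in \<open>auto simp: g_def algebra_simps\<close>)
    qed measurable
    also have "\<dots> = ennreal l * Lnorm \<Omega> q (\<lambda>x. g x - \<phi> x)"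
      using l by (subst Lnorm_cmult[OF q_ge]) auto
    finally have le: "ennreal \<delta> * ennreal l \<le> ennreal l * Lnorm \<Omega> q (\<lambda>x. g x - \<phi> x)" .
    have inv: "ennreal (1 / l) * (ennreal l * X) = X" for X
      using l by (simp add: mult.assoc[symmetric] ennreal_mult[symmetric])
    have "ennreal (1 / l) * (ennreal l * ennreal \<delta>) \<le> ennreal (1 / l) * (ennreal l * Lnorm \<Omega> q (\<lambda>x. g x - \<phi> x))"
      using le by (subst mult.commute[of "ennreal l" "ennreal \<delta>"]) (rule mult_left_mono[OF _ zero_le])
    then show "ennreal \<delta> \<le> Lnorm \<Omega> q (\<lambda>x. g x - \<phi> x)"
      by (simp only: inv)
  qed
qed

text \<open>The field forces the order of the bounds: the magnetic energy of order s' and exponent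
  r, from it the L^r norm by the Poincare type inequality, and then the energy without field, to
  which \<open>compactness\<close> applies. For the limit, the magnetic energy of order s comes from
  \<open>mag_int_Fatou\<close>, and membership in \<open>FS\<close> follows by the same two steps
  with exponent p.\<close>

lemma minimising_limit:
  assumes G[measurable]: "\<And>n. G n \<in> borel_measurable borel" and \<Lambda>: "\<And>n. \<Lambda> n \<in> sets borel" "\<And>n. \<Lambda> n \<subseteq> \<Omega>"
    and L1: "\<And>n. Lnorm \<Omega> q (G n) = 1" and c0: "0 \<le> c0"
    and Gp: "\<And>n. mag_int (\<Lambda> n \<times> \<Lambda> n) A' s p (G n) \<le> ennreal (c0 powr p)"
    and Gr: "\<And>n. mag_int (\<Omega> \<times> \<Omega> - \<Lambda> n \<times> \<Lambda> n) A' s r (G n) \<le> ennreal ((c0 / 2 ^ n) powr r)"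
    and far: "\<And>n \<phi>. \<phi> \<in> gs \<Longrightarrow> ennreal \<delta> \<le> Lnorm \<Omega> q (\<lambda>x. G n x - \<phi> x)"
  obtains g where "g \<in> FS" "Lnorm \<Omega> q g = 1" "mag_seminorm \<Omega> A s p g \<le> ennreal c0"
    "\<And>\<phi>. \<phi> \<in> gs \<Longrightarrow> ennreal \<delta> \<le> Lnorm \<Omega> q (\<lambda>x. g x - \<phi> x)"
proof -
  note Gm[measurable] = borel_imp_lebesgue_on[OF G, where S = \<Omega>]
  \<comment> \<open>The Poincare type inequality averages over \<Omega>, which is nonempty because a
    function on it has norm 1.\<close>
  have ne: "\<Omega> \<noteq> {}"
  proof
    assume "\<Omega> = {}"
    then have "AE x in lebesgue_on \<Omega>. G 0 x = 0" by (simp add: AE_lebesgue_on_iff)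
    then have "Lnorm \<Omega> q (G 0) = 0" by (subst Lnorm_eq_0_iff[OF q_ge Gm])
    then show False using L1[of 0] by simp
  qed
  define w where "w = enn2real (emeasure lebesgue \<Omega> + 1)"
  have w: "emeasure lebesgue \<Omega> + 1 = ennreal w"
    unfolding w_def using emeasure_\<Omega> by (simp add: ennreal_one_less_top)
  have GL1: "L1_int (G n) \<le> ennreal w" for n
    using L1_le_Lnorm[OF q_ge \<Omega>_lebesgue Gm, of n] by (simp only: nn_integral_\<Omega> w L1 mult_1_right)
  have bound_A: "\<exists>B. \<forall>n. energy A' s' r (G n) \<le> ennreal B"
  proof (rule mag_int_split_le[OF p_facts(3) r_less s'_less])
    fix K c :: real
    assume Kc: "0 \<le> K" "0 \<le> c" and le: "\<And>A f \<Lambda>. A \<in> borel_measurable borel \<Longrightarrow> f \<in> borel_measurable borel \<Longrightarrow> \<Lambda> \<in> sets borel \<Longrightarrow> \<Lambda> \<subseteq> \<Omega> \<Longrightarrow>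
      energy A s' r f \<le> mag_int (\<Lambda> \<times> \<Lambda>) A s p f + ennreal K + ennreal c * mag_int (\<Omega> \<times> \<Omega> - \<Lambda> \<times> \<Lambda>) A s r f"
    have "energy A' s' r (G n) \<le> ennreal (c0 powr p + K + c * c0 powr r)" for n
    proof -
      have "(c0 / 2 ^ n) powr r \<le> c0 powr r" using c0 p_facts by (intro powr_mono2) (auto simp: divide_le_eq mult_le_cancel_left1)
      then have "mag_int (\<Omega> \<times> \<Omega> - \<Lambda> n \<times> \<Lambda> n) A' s r (G n) \<le> ennreal (c0 powr r)"
        using Gr[of n] by (meson ennreal_leI order_trans)
      then have "energy A' s' r (G n) \<le> ennreal (c0 powr p) + ennreal K + ennreal c * ennreal (c0 powr r)"
        by (intro order_trans[OF le[OF A'_measurable G \<Lambda>]] add_mono mult_left_mono) (auto intro: Gp)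
      also have "\<dots> = ennreal (c0 powr p + K + c * c0 powr r)"
        using Kc by (simp add: ennreal_mult[symmetric] ennreal_plus[symmetric] del: ennreal_plus)
      finally show ?thesis .
    qed
    then show ?thesis by blast
  qed
  then obtain BA where BA: "\<And>n. energy A' s' r (G n) \<le> ennreal BA" by blast
  have bound_r: "\<exists>B. \<forall>n. Lp_int r (G n) \<le> ennreal B"
  proof (rule Lp_le_mag_int[OF r_ge s'_pos ne])
    fix C :: real
    assume C: "0 \<le> C" and le: "\<And>A f. A \<in> borel_measurable borel \<Longrightarrow> f \<in> borel_measurable borel \<Longrightarrow>
      Lp_int r f
        \<le> ennreal C * (energy A s' r f + ennpow (L1_int f) r)"
    have "Lp_int r (G n) \<le> ennreal C * (ennreal (max BA 0) + ennpow (ennreal w) r)" for n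
      by (rule order_trans[OF le[OF A'_measurable G]], intro mult_left_mono add_mono ennpow_mono GL1 order_trans[OF BA])
        (use p_facts in \<open>auto intro: ennreal_leI\<close>)
    moreover have "ennreal C * (ennreal (max BA 0) + ennpow (ennreal w) r) = ennreal (C * (max BA 0 + w powr r))"
    proof -
      have "0 \<le> w" by (simp add: w_def)
      then show ?thesis using C by (simp only: ennpow_ennreal ennreal_plus[symmetric] ennreal_mult[symmetric] powr_ge_zero max.cobounded2 add_nonneg_nonneg)
    qed
    ultimately show ?thesis by metis
  qed
  then obtain Br where Br: "\<And>n. Lp_int r (G n) \<le> ennreal Br" by blast
  have bound_0: "\<exists>B. \<forall>n. energy (\<lambda>_. 0) s' r (G n) \<le> ennreal B"
  proof (rule mag_int_change_field[OF p_facts(3), of s' a])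
    show "s' < 1" using s'_less s_less by simp
    fix C :: real
    assume C: "0 \<le> C" and le: "\<And>A A' f. A \<in> borel_measurable borel \<Longrightarrow> A' \<in> borel_measurable borel \<Longrightarrow> f \<in> borel_measurable borel \<Longrightarrow>
      (\<And>x. norm (A x) \<le> a) \<Longrightarrow> (\<And>x. norm (A' x) \<le> a) \<Longrightarrow>
      energy A s' r f \<le> ennreal C * (energy A' s' r f + Lp_int r f)"
    have "energy (\<lambda>_. 0) s' r (G n) \<le> ennreal C * (energy A' s' r (G n) + Lp_int r (G n))" for n
      using A'_bound p_facts by (intro le) auto
    also have "\<dots> n \<le> ennreal C * (ennreal (max BA 0) + ennreal (max Br 0))" for n
      by (intro mult_left_mono add_mono order_trans[OF BA] order_trans[OF Br]) (auto intro: ennreal_leI)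
    also have "ennreal C * (ennreal (max BA 0) + ennreal (max Br 0)) = ennreal (C * (max BA 0 + max Br 0))"
      using C by (simp only: ennreal_plus[symmetric] ennreal_mult[symmetric] max.cobounded2 add_nonneg_nonneg)
    finally show ?thesis by blast
  qed
  then obtain B0 where B0: "\<And>n. energy (\<lambda>_. 0) s' r (G n) \<le> ennreal B0" by blast
  show thesis
  proof (rule compactness[OF q_ge subcritical s'_pos r_ge G GL1 B0])
    fix k :: "nat \<Rightarrow> nat" and g
    assume k: "strict_mono k" and g[measurable]: "g \<in> borel_measurable borel"
      and lim: "AE x in lebesgue_on \<Omega>. (\<lambda>n. G (k n) x) \<longlonglongrightarrow> g x"
      and conv: "\<And>n. Lnorm \<Omega> q (\<lambda>x. g x - G (k n) x) \<le> ennreal ((1/2) ^ n)"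
    note gm[measurable] = borel_imp_lebesgue_on[OF g, where S = \<Omega>]
    \<comment> \<open>Limits of inequalities are taken with an additive error, as terms in
      [0, \<infinity>] cannot be moved across by subtraction.\<close>
    have approx: "x \<le> y" if "\<And>n. x \<le> ennreal ((1/2) ^ n) + y" for x y
    proof (rule LIMSEQ_le_const)
      have "(\<lambda>n. (1/2) ^ n) \<longlonglongrightarrow> (0::real)" by (rule LIMSEQ_realpow_zero) auto
      then have "(\<lambda>n. ennreal ((1/2) ^ n) + y) \<longlonglongrightarrow> ennreal 0 + y" by (intro tendsto_add tendsto_ennrealI tendsto_const)
      then show "(\<lambda>n. ennreal ((1/2) ^ n) + y) \<longlonglongrightarrow> y" by simp
    qed (use that in blast)
    have Lg: "Lnorm \<Omega> q g = 1"
    proof (rule antisym; rule approx)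
      fix n
      have "Lnorm \<Omega> q (\<lambda>x. (g x - G (k n) x) + G (k n) x) \<le> Lnorm \<Omega> q (\<lambda>x. g x - G (k n) x) + Lnorm \<Omega> q (G (k n))"
        by (intro Lnorm_triangle q_ge) measurable
      also have "\<dots> \<le> ennreal ((1/2) ^ n) + 1" unfolding L1 by (intro add_right_mono conv)
      finally show "Lnorm \<Omega> q g \<le> ennreal ((1/2) ^ n) + 1" by simp
      have "Lnorm \<Omega> q (\<lambda>x. (G (k n) x - g x) + g x) \<le> Lnorm \<Omega> q (\<lambda>x. G (k n) x - g x) + Lnorm \<Omega> q g"
        by (intro Lnorm_triangle q_ge) measurable
      also have "\<dots> \<le> ennreal ((1/2) ^ n) + Lnorm \<Omega> q g"
        unfolding Lnorm_minus_commute[of \<Omega> q "G (k n)" g] by (intro add_right_mono conv)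
      finally show "1 \<le> ennreal ((1/2) ^ n) + Lnorm \<Omega> q g" using L1[of "k n"] by simp
    qed
    have far': "ennreal \<delta> \<le> Lnorm \<Omega> q (\<lambda>x. g x - \<phi> x)" if \<phi>: "\<phi> \<in> gs" for \<phi>
    proof (rule approx)
      fix n
      have [measurable]: "\<phi> \<in> borel_measurable (lebesgue_on \<Omega>)"
        using \<phi> by (intro FS_measurable) (auto simp: ground_states_def frac_sobolev_nz_def)
      have "ennreal \<delta> \<le> Lnorm \<Omega> q (\<lambda>x. G (k n) x - \<phi> x)" by (rule far[OF \<phi>])
      also have "\<dots> \<le> Lnorm \<Omega> q (\<lambda>x. G (k n) x - g x) + Lnorm \<Omega> q (\<lambda>x. g x - \<phi> x)"
        by (intro Lnorm_minus_triangle q_ge) measurable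
      also have "\<dots> \<le> ennreal ((1/2) ^ n) + Lnorm \<Omega> q (\<lambda>x. g x - \<phi> x)"
        unfolding Lnorm_minus_commute[of \<Omega> q "G (k n)" g] by (intro add_right_mono conv)
      finally show "ennreal \<delta> \<le> ennreal ((1/2) ^ n) + Lnorm \<Omega> q (\<lambda>x. g x - \<phi> x)" .
    qed
    have gA: "energy A' s p g \<le> ennreal (c0 powr p)"
    proof (rule mag_int_Fatou[where F = "\<lambda>n. G (k n)" and \<Lambda> = "\<lambda>n. \<Lambda> (k n)" and r = r])
      show "AE x in lborel. x \<in> \<Omega> \<longrightarrow> (\<lambda>n. G (k n) x) \<longlonglongrightarrow> g x"
        using lim by (simp only: AE_lebesgue_on_iff[OF \<Omega>_lebesgue])
      show "\<Lambda> (k n) \<times> \<Lambda> (k n) \<in> sets borel" for n using \<Lambda>(1) by (metis borel_prod pair_measureI)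
      \<comment> \<open>The constants 2^n enter here: the bounds (c0 / 2^(k n))^r are dominated by a
        geometric series, because r \<ge> 1 and n \<le> k n.\<close>
      have "(\<Sum>n. mag_int (\<Omega> \<times> \<Omega> - \<Lambda> (k n) \<times> \<Lambda> (k n)) A' s r (G (k n))) \<le> (\<Sum>n. ennreal (c0 powr r * (1/2) ^ n))"
      proof (intro suminf_le allI)
        fix n
        have "n \<le> k n" using k by (rule strict_mono_imp_increasing)
        then have h: "(1/2::real) ^ k n \<le> (1/2) ^ n" by (intro power_decreasing) auto
        have "((1/2::real) ^ k n) powr r \<le> ((1/2) ^ k n) powr 1"
          using r_ge by (intro powr_mono') (auto simp: power_le_one)
        also have "\<dots> = (1/2) ^ k n" by simp
        also note h
        finally have "((1/2::real) ^ k n) powr r \<le> (1/2) ^ n" .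
        then have "c0 powr r * ((1/2) ^ k n) powr r \<le> c0 powr r * (1/2) ^ n" by (intro mult_left_mono) auto
        moreover have "(c0 / 2 ^ k n) powr r = c0 powr r * ((1/2) ^ k n) powr r"
        proof -
          have "c0 / 2 ^ k n = c0 * (1/2) ^ k n" by (simp add: power_one_over)
          then show ?thesis by (simp only: powr_mult)
        qed
        ultimately show "mag_int (\<Omega> \<times> \<Omega> - \<Lambda> (k n) \<times> \<Lambda> (k n)) A' s r (G (k n)) \<le> ennreal (c0 powr r * (1/2) ^ n)"
          by (intro order_trans[OF Gr] ennreal_leI) simp
      qed auto
      also have "\<dots> = ennreal (\<Sum>n. c0 powr r * (1/2) ^ n)"
        by (intro suminf_ennreal2 summable_mult summable_geometric) auto
      also have "\<dots> < \<infinity>" by simp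
      finally show "(\<Sum>n. mag_int (\<Omega> \<times> \<Omega> - \<Lambda> (k n) \<times> \<Lambda> (k n)) A' s r (G (k n))) < \<infinity>" .
    qed (use p_facts Gp \<Lambda> in auto)
    have gL1: "L1_int g \<le> ennreal w"
      using L1_le_Lnorm[OF q_ge \<Omega>_lebesgue gm] by (simp only: nn_integral_\<Omega> w Lg mult_1_right)
    have gLp: "Lp_int p g < \<infinity>"
    proof (rule Lp_le_mag_int[OF p_facts(2,4) ne])
      fix C :: real
      assume le: "\<And>A f. A \<in> borel_measurable borel \<Longrightarrow> f \<in> borel_measurable borel \<Longrightarrow>
        Lp_int p f
          \<le> ennreal C * (energy A s p f + ennpow (L1_int f) p)"
      have "L1_int g < \<infinity>" using gL1 by (rule le_less_trans) simp
      moreover have "energy A' s p g < \<infinity>" using gA by (rule le_less_trans) simp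
      ultimately show ?thesis
        by (intro le_less_trans[OF le[OF A'_measurable g]]) (simp add: ennreal_mult_less_top ennreal_add_less_top)
    qed
    have g0: "energy (\<lambda>_. 0) s p g < \<infinity>"
    proof (rule mag_int_change_field[OF p_facts(1) s_less, of a])
      fix C :: real
      assume le: "\<And>A A' f. A \<in> borel_measurable borel \<Longrightarrow> A' \<in> borel_measurable borel \<Longrightarrow> f \<in> borel_measurable borel \<Longrightarrow>
        (\<And>x. norm (A x) \<le> a) \<Longrightarrow> (\<And>x. norm (A' x) \<le> a) \<Longrightarrow>
        energy A s p f \<le> ennreal C * (energy A' s p f + Lp_int p f)"
      have "energy (\<lambda>_. 0) s p g \<le> ennreal C * (energy A' s p g + Lp_int p g)"
        using A'_bound p_facts by (intro le) auto
      also have "\<dots> < \<infinity>" using gLp le_less_trans[OF gA] by (simp add: ennreal_mult_less_top ennreal_add_less_top)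
      finally show ?thesis .
    qed
    show thesis
    proof (rule that[OF FS_I[OF g gLp g0] Lg _ far'])
      have "mag_seminorm \<Omega> A s p g = ennpow (energy A' s p g) (1 / p)"
        by (rule mag_seminorm_representative) simp
      also have "\<dots> \<le> ennreal c0"
        unfolding ennpow_root_le_iff[OF p_facts(1)] using gA c0 by (simp add: ennpow_ennreal)
      finally show "mag_seminorm \<Omega> A s p g \<le> ennreal c0" .
    qed
  qed
qed

lemma localised_inequality:
  assumes \<delta>: "0 < \<delta>" and \<epsilon>: "0 < \<epsilon>"
  obtains C where "0 < C" "\<And>\<Lambda> f. \<Lambda> \<in> sets lebesgue \<Longrightarrow> \<Lambda> \<subseteq> \<Omega> \<Longrightarrow> f \<in> FS \<Longrightarrow>
     ennreal \<delta> * Lnorm \<Omega> q f \<le> ground_dist \<Omega> A s p q f \<Longrightarrow>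
     (1 / (best_const \<Omega> A s p q \<delta> + ennreal \<epsilon>) + mag_energy \<Omega> A s p q) * Lnorm \<Omega> q f
       \<le> mag_double (\<Lambda> \<times> \<Lambda>) A s p f + ennreal C * mag_double (\<Omega> \<times> \<Omega> - \<Lambda> \<times> \<Lambda>) A s r f"
proof (rule ccontr)
  assume no: "\<not> thesis"
  note result = that
  define S where "S = best_const \<Omega> A s p q \<delta>"
  define E where "E = mag_energy \<Omega> A s p q"
  define Ce where "Ce = 1 / (S + ennreal \<epsilon>) + E"
  have "\<exists>\<Lambda> f. \<Lambda> \<in> sets lebesgue \<and> \<Lambda> \<subseteq> \<Omega> \<and> f \<in> FS \<and> ennreal \<delta> * Lnorm \<Omega> q f \<le> ground_dist \<Omega> A s p q f \<and>
     mag_double (\<Lambda> \<times> \<Lambda>) A s p f + ennreal C * mag_double (\<Omega> \<times> \<Omega> - \<Lambda> \<times> \<Lambda>) A s r f < Ce * Lnorm \<Omega> q f" if "0 < C" for C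
  \<comment> \<open>A constant C without counterexample would itself be a witness for the
    conclusion.\<close>
  proof (rule ccontr)
    assume none: "\<not> ?thesis"
    have thesis
      by (rule result[OF \<open>0 < C\<close>], rule leI) (use none in \<open>unfold Ce_def S_def E_def, blast\<close>)
    with no show False by contradiction
  qed
  note ex = this
  \<comment> \<open>A counterexample has positive norm, so the infimum E is over a nonempty set of
    finite quotients. Finiteness of E makes c0 a real number and lets E be subtracted from
    X.\<close>
  have Efin: "E < \<infinity>"
  proof -
    obtain f where f: "f \<in> FS" "0 < Lnorm \<Omega> q f"
      using ex[of 1] by (auto simp: zero_less_iff_neq_zero) (metis mult_zero_right not_less_zero)
    then have "E \<le> mag_seminorm \<Omega> A s p f / Lnorm \<Omega> q f"
      unfolding E_def mag_energy_def using Lnorm_pos_iff by (intro INF_lower) auto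
    also have "\<dots> < \<infinity>"
      using mag_seminorm_FS_finite[OF f(1)] Lnorm_FS_finite[OF f(1)] f(2)
      by (cases "mag_seminorm \<Omega> A s p f"; cases "Lnorm \<Omega> q f") (auto simp: divide_ennreal)
    finally show ?thesis .
  qed
  have "1 / (S + ennreal \<epsilon>) < \<infinity>" using \<epsilon> by (simp add: less_top[symmetric] ennreal_divide_eq_top_iff)
  then have "Ce < \<infinity>" using Efin by (simp add: Ce_def ennreal_add_less_top)
  then obtain c0 where c0: "Ce = ennreal c0" "0 \<le> c0" by (cases Ce) auto
  define Good where "Good n g \<Lambda>' \<longleftrightarrow> g \<in> borel_measurable borel \<and> \<Lambda>' \<in> sets borel \<and> \<Lambda>' \<subseteq> \<Omega> \<and> Lnorm \<Omega> q g = 1 \<and>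
    mag_int (\<Lambda>' \<times> \<Lambda>') A' s p g \<le> ennreal (c0 powr p) \<and>
    mag_int (\<Omega> \<times> \<Omega> - \<Lambda>' \<times> \<Lambda>') A' s r g \<le> ennreal ((c0 / 2 ^ n) powr r) \<and>
    (\<forall>\<phi>\<in>gs. ennreal \<delta> \<le> Lnorm \<Omega> q (\<lambda>x. g x - \<phi> x))" for n :: nat and g \<Lambda>'
  have "\<exists>g \<Lambda>'. Good n g \<Lambda>'" for n
  proof -
    have "0 < (2::real) ^ n" by simp
    from ex[OF this] obtain \<Lambda> f where *: "f \<in> FS" "\<Lambda> \<in> sets lebesgue" "\<Lambda> \<subseteq> \<Omega>"
      "ennreal \<delta> * Lnorm \<Omega> q f \<le> ground_dist \<Omega> A s p q f"
      "mag_double (\<Lambda> \<times> \<Lambda>) A s p f + ennreal (2 ^ n) * mag_double (\<Omega> \<times> \<Omega> - \<Lambda> \<times> \<Lambda>) A s r f < ennreal c0 * Lnorm \<Omega> q f"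
      unfolding c0(1) by (elim exE conjE)
    show ?thesis
    proof (rule normalise[OF *(1-3) \<open>0 < 2 ^ n\<close> c0(2) *(4,5)])
      fix g \<Lambda>'
      assume "g \<in> borel_measurable borel" "\<Lambda>' \<in> sets borel" "\<Lambda>' \<subseteq> \<Omega>" "Lnorm \<Omega> q g = 1"
        "mag_int (\<Lambda>' \<times> \<Lambda>') A' s p g \<le> ennreal (c0 powr p)"
        "mag_int (\<Omega> \<times> \<Omega> - \<Lambda>' \<times> \<Lambda>') A' s r g \<le> ennreal ((c0 / 2 ^ n) powr r)"
        "\<And>\<phi>. \<phi> \<in> gs \<Longrightarrow> ennreal \<delta> \<le> Lnorm \<Omega> q (\<lambda>x. g x - \<phi> x)"
      then have "Good n g \<Lambda>'" unfolding Good_def by (intro conjI ballI)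
      then show ?thesis by (intro exI)
    qed
  qed
  then obtain G \<Lambda> where Good: "\<And>n. Good n (G n) (\<Lambda> n)" by metis
  have G: "G n \<in> borel_measurable borel" "\<Lambda> n \<in> sets borel" "\<Lambda> n \<subseteq> \<Omega>" "Lnorm \<Omega> q (G n) = 1"
    "mag_int (\<Lambda> n \<times> \<Lambda> n) A' s p (G n) \<le> ennreal (c0 powr p)"
    "mag_int (\<Omega> \<times> \<Omega> - \<Lambda> n \<times> \<Lambda> n) A' s r (G n) \<le> ennreal ((c0 / 2 ^ n) powr r)"
    "\<forall>\<phi>\<in>gs. ennreal \<delta> \<le> Lnorm \<Omega> q (\<lambda>x. G n x - \<phi> x)" for n
    using Good[of n] unfolding Good_def by blast+
  show False
  proof (rule minimising_limit[OF G(1-4) c0(2) G(5,6)])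
    show "ennreal \<delta> \<le> Lnorm \<Omega> q (\<lambda>x. G n x - \<phi> x)" if "\<phi> \<in> gs" for n \<phi> using G(7) that by blast
    fix g
    assume g: "g \<in> FS" "Lnorm \<Omega> q g = 1" "mag_seminorm \<Omega> A s p g \<le> ennreal c0"
      and far: "\<And>\<phi>. \<phi> \<in> gs \<Longrightarrow> ennreal \<delta> \<le> Lnorm \<Omega> q (\<lambda>x. g x - \<phi> x)"
    have div1: "y / 1 = y" for y :: ennreal by (simp add: divide_ennreal_def)
    define X where "X = mag_seminorm \<Omega> A s p g"
    have X: "X \<le> 1 / (S + ennreal \<epsilon>) + E" using g(3) unfolding X_def c0(1)[symmetric] Ce_def .
    have gnz: "g \<in> frac_sobolev_nz \<Omega> s p" using Lnorm_pos_iff[OF g(1)] g(2) by simp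
    have EX: "E \<le> X" unfolding E_def mag_energy_def X_def using g(2) by (intro INF_lower2[OF gnz]) (simp add: div1)
    show False
    proof (cases "S = \<infinity>")
      \<comment> \<open>For S = \<infinity> there is no real admissible constant to test with g.
        Instead 1 / (S + \<epsilon>) = 0 gives X = E, so g is a ground state, and its distance 0 to
        itself contradicts \<delta> > 0.\<close>
      case True
      then have "1 / (S + ennreal \<epsilon>) = 0" by (simp add: divide_ennreal_def)
      with X EX have "X = E" by simp
      then have "g \<in> gs" using gnz g(2) unfolding ground_states_def X_def E_def by (simp add: div1)
      from far[OF this] have "ennreal \<delta> \<le> Lnorm \<Omega> q (\<lambda>_. 0)" by simp
      also have "\<dots> = 0" by (subst Lnorm_eq_0_iff[OF q_ge]) auto
      finally show False using \<delta> by simp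
    next
      case False
      then obtain S' where S': "S = ennreal S'" "0 \<le> S'" by (cases S) auto
      have away: "g \<in> away_from_ground \<Omega> A s p q \<delta>"
        unfolding away_from_ground_def ground_dist_def using g far by (auto intro: INF_greatest)
      \<comment> \<open>\<open>best_const\<close> is an infimum, so an admissible K below S +
        \<epsilon> stands in for S. Tested with g, it gives 1 \<le> K / (S + \<epsilon>) <
        1.\<close>
      have "S < S + ennreal \<epsilon>" using S' \<epsilon> by (simp add: ennreal_plus[symmetric] ennreal_less_iff del: ennreal_plus)
      then obtain K where K: "K < S + ennreal \<epsilon>" "\<forall>f \<in> away_from_ground \<Omega> A s p q \<delta>.
            Lnorm \<Omega> q f \<le> K * (mag_seminorm \<Omega> A s p f - mag_energy \<Omega> A s p q * Lnorm \<Omega> q f)"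
        unfolding S_def best_const_def Inf_less_iff by blast
      obtain K' where K': "K = ennreal K'" "0 \<le> K'" using K(1) by (cases K) auto
      have KS: "K' < S' + \<epsilon>" using K(1) K' S' \<epsilon> by (simp add: ennreal_plus[symmetric] ennreal_less_iff del: ennreal_plus)
      have "1 \<le> K * (X - E)" using K(2) away g(2) unfolding X_def E_def by force
      also have "X - E \<le> 1 / (S + ennreal \<epsilon>)" using X Efin by (intro ennreal_minus_le_iff[THEN iffD2]) (auto simp: add.commute)
      finally have "1 \<le> K * (1 / (S + ennreal \<epsilon>))" by (simp add: mult_left_mono)
      also have "\<dots> = ennreal (K' / (S' + \<epsilon>))"
      proof -
        have "1 / (S + ennreal \<epsilon>) = ennreal (1 / (S' + \<epsilon>))"
          using S' \<epsilon> by (simp add: ennreal_plus[symmetric] divide_ennreal ennreal_1[symmetric] del: ennreal_plus ennreal_1)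
        then show ?thesis using K' S' \<epsilon> by (simp add: ennreal_mult[symmetric])
      qed
      finally have "1 \<le> K' / (S' + \<epsilon>)" by simp
      then show False using KS S' \<epsilon> by (simp add: le_divide_eq)
    qed
  qed
qed

end

theorem theorem1p9:
  fixes \<Omega> :: "(real^'n) set" and A :: "real^'n \<Rightarrow> real^'n"
    and s p r \<delta> :: real and q :: ennreal
  assumes "open \<Omega>" and "bounded \<Omega>" and "lipschitz_boundary \<Omega>"
    and "A \<in> borel_measurable (lebesgue_on (convex hull \<Omega>))" and "bounded (A ` (convex hull \<Omega>))"
    and "0 < s" and "s < 1"
    and "1 \<le> q" and "1 \<le> r" and "r < p"
    and "(r = 1 \<and> q < ennreal (real CARD('n) / (real CARD('n) - s)))
       \<or> (s * r > real CARD('n) \<and> q = \<infinity>)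
       \<or> (q < ennreal (real CARD('n) * r / (real CARD('n) - s * r)) \<and> s * r < real CARD('n)
           \<and> ennreal (real CARD('n) / (real CARD('n) - s)) \<le> q \<and> q < \<infinity>)"
    and "(s * p < real CARD('n) \<and> q < ennreal (real CARD('n) * p / (real CARD('n) - s * p)))
       \<or> (s * p = real CARD('n) \<and> q < \<infinity>)
       \<or> (s * p > real CARD('n) \<and> q \<le> \<infinity>)"
    and "0 < \<delta>" and "\<delta> \<le> 1"
  shows "\<forall>\<epsilon>>0. \<exists>C>0. \<forall>\<Lambda> f. \<Lambda> \<in> sets lebesgue \<longrightarrow> \<Lambda> \<subseteq> \<Omega> \<longrightarrow> f \<in> frac_sobolev \<Omega> s p \<longrightarrow>
           ground_dist \<Omega> A s p q f \<ge> ennreal \<delta> * Lnorm \<Omega> q f \<longrightarrow>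
           mag_double (\<Lambda> \<times> \<Lambda>) A s p f
             + ennreal C * mag_double (\<Omega> \<times> \<Omega> - \<Lambda> \<times> \<Lambda>) A s r f
           \<ge> (1 / (best_const \<Omega> A s p q \<delta> + ennreal \<epsilon>) + mag_energy \<Omega> A s p q) * Lnorm \<Omega> q f"
proof (intro allI impI)
  fix \<epsilon> :: real assume \<epsilon>: "0 < \<epsilon>"
  obtain \<kappa> t0 where ct: "0 < \<kappa>" "0 < t0" "corkscrew \<Omega> \<kappa> t0"
    by (rule lipschitz_boundary_corkscrew[OF assms(1-3)])
  have "\<exists>\<zeta>. \<zeta> \<in> borel_measurable borel \<and> finite (range \<zeta>) \<and>
    (\<forall>x\<in>\<Omega>. ball (\<zeta> x) (\<kappa> * (t0 / 2 ^ j)) \<subseteq> \<Omega> \<inter> ball x (2 * (t0 / 2 ^ j)))" for j :: nat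
  proof -
    have "0 < t0 / 2 ^ j" "t0 / 2 ^ j \<le> t0" using ct(2) by (auto simp: divide_le_eq mult_le_cancel_left1)
    from corkscrew_selection[OF ct(3) assms(2) this] show ?thesis by metis
  qed
  then obtain \<zeta> where \<zeta>: "\<And>j. \<zeta> j \<in> borel_measurable borel" "\<And>j. finite (range (\<zeta> j))"
    "\<And>j. \<forall>x\<in>\<Omega>. ball (\<zeta> j x) (\<kappa> * (t0 / 2 ^ j)) \<subseteq> \<Omega> \<inter> ball x (2 * (t0 / 2 ^ j))"
    by metis
  obtain a where a: "0 < a" "\<And>x. x \<in> convex hull \<Omega> \<Longrightarrow> norm (A x) \<le> a"
    using assms(5) unfolding bounded_pos by auto
  have hull: "convex hull \<Omega> \<in> sets lebesgue" using assms(1) by (simp add: open_convex_hull)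
  obtain A1 where A1[measurable]: "A1 \<in> borel_measurable borel" and A1_AE: "AE x in lborel. x \<in> convex hull \<Omega> \<longrightarrow> A x = A1 x"
    by (rule borel_representative[OF hull assms(4)])
  \<comment> \<open>Truncation makes the bound hold everywhere and changes nothing almost everywhere
    on the hull, where A1 agrees with A and is therefore bounded by a.\<close>
  define A' where "A' x = (if norm (A1 x) \<le> a then A1 x else 0)" for x
  have A': "A' \<in> borel_measurable borel" "\<And>x. norm (A' x) \<le> a"
    unfolding A'_def[abs_def] using a by auto
  have A'_AE: "AE x in lborel. x \<in> convex hull \<Omega> \<longrightarrow> A x = A' x"
    using A1_AE
  proof eventually_elim
    case (elim x)
    then show ?case using a(2)[of x] by (auto simp: A'_def)
  qed
  have "1 \<le> real CARD('n)" by simp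
  \<comment> \<open>This keeps the denominator n - s of condition (a) positive.\<close>
  then have "s < real CARD('n)" using assms(7) by linarith
  then obtain s' where s': "0 < s'" "s' < s" "subcritical CARD('n) q s' r"
    by (rule subcritical_smaller_order[OF assms(6,9,8)]) (use assms(11) in blast)+
  interpret magnetic_setting \<Omega> \<kappa> t0 \<zeta> A A' a s s' p r q
    by unfold_locales (use assms ct \<zeta> A' A'_AE s' in auto)
  show "\<exists>C>0. \<forall>\<Lambda> f. \<Lambda> \<in> sets lebesgue \<longrightarrow> \<Lambda> \<subseteq> \<Omega> \<longrightarrow> f \<in> frac_sobolev \<Omega> s p \<longrightarrow>
           ground_dist \<Omega> A s p q f \<ge> ennreal \<delta> * Lnorm \<Omega> q f \<longrightarrow>
           mag_double (\<Lambda> \<times> \<Lambda>) A s p f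
             + ennreal C * mag_double (\<Omega> \<times> \<Omega> - \<Lambda> \<times> \<Lambda>) A s r f
           \<ge> (1 / (best_const \<Omega> A s p q \<delta> + ennreal \<epsilon>) + mag_energy \<Omega> A s p q) * Lnorm \<Omega> q f"
    by (rule localised_inequality[OF assms(13) \<epsilon>]) blast
qed

end
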